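(* Let $K$ be a number field and let $f:\mathbb{A}^n\to\mathbb{A}^n$ be a regular polynomial automorphism defined over $K$. Then the set of periodic points of $f$ in $\mathbb{A}^n(\overline{K})$ is Zariski dense.
   Context: A polynomial automorphism $f$ of $\mathbb{A}^n$ is a polynomial map with polynomial inverse $f^{-1}$; it is regular if the meromorphic extensions of $f$ and $f^{-1}$ to $\mathbb{P}^n$ have no common indeterminacy point.
   Formalization: The automorphism f is assumed to have degree at least 2, since affine automorphisms such as translations have no indeterminacy points and may have no periodic points; K is taken as a subfield of the complex numbers. *)

theory Defs
  imports "HOL-Computational_Algebra.Polynomial" "HOL-Library.Poly_Mapping"
begin

type_synonym 'v cmpoly = "('v \<Rightarrow>\<^sub>0 nat) \<Rightarrow>\<^sub>0 complex"

definition mon_eval :: "('v \<Rightarrow>\<^sub>0 nat) \<Rightarrow> ('v \<Rightarrow> complex) \<Rightarrow> complex" where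
  "mon_eval m x = (\<Prod>i\<in>Poly_Mapping.keys m. x i ^ Poly_Mapping.lookup m i)"

definition mon_deg :: "('v \<Rightarrow>\<^sub>0 nat) \<Rightarrow> nat" where
  "mon_deg m = (\<Sum>i\<in>Poly_Mapping.keys m. Poly_Mapping.lookup m i)"

definition mp_eval :: "'v cmpoly \<Rightarrow> ('v \<Rightarrow> complex) \<Rightarrow> complex" where
  "mp_eval p x = (\<Sum>m\<in>Poly_Mapping.keys p. Poly_Mapping.lookup p m * mon_eval m x)"

definition mp_tdeg :: "'v cmpoly \<Rightarrow> nat" where
  "mp_tdeg p = Max (insert 0 (mon_deg ` Poly_Mapping.keys p))"

definition mp_hom_eval :: "'v cmpoly \<Rightarrow> nat \<Rightarrow> ('v \<Rightarrow> complex) \<Rightarrow> complex" where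
  "mp_hom_eval p d x = (\<Sum>m\<in>{m\<in>Poly_Mapping.keys p. mon_deg m = d}. Poly_Mapping.lookup p m * mon_eval m x)"

type_synonym 'n polymap = "'n \<Rightarrow> 'n cmpoly"

definition pm_apply :: "'n polymap \<Rightarrow> ('n \<Rightarrow> complex) \<Rightarrow> ('n \<Rightarrow> complex)" where
  "pm_apply F x = (\<lambda>i. mp_eval (F i) x)"

definition pm_deg :: "('n::finite) polymap \<Rightarrow> nat" where
  "pm_deg F = Max (range (\<lambda>i. mp_tdeg (F i)))"

definition pm_coeffs_in :: "'n polymap \<Rightarrow> complex set \<Rightarrow> bool" where
  "pm_coeffs_in F K \<longleftrightarrow> (\<forall>i m. Poly_Mapping.lookup (F i) m \<in> K)"

definition pm_inverse :: "'n polymap \<Rightarrow> 'n polymap \<Rightarrow> bool" where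
  "pm_inverse F G \<longleftrightarrow> (\<forall>x. pm_apply G (pm_apply F x) = x) \<and> (\<forall>x. pm_apply F (pm_apply G x) = x)"

text \<open>Indeterminacy set of the extension of F to P^n, as a set of affine representatives
  X \<noteq> 0 of points [0:X] on the hyperplane at infinity: the common zeros of the top-degree
  homogeneous parts of the components.\<close>
definition pm_indet :: "('n::finite) polymap \<Rightarrow> ('n \<Rightarrow> complex) set" where
  "pm_indet F = {X. X \<noteq> (\<lambda>_. 0) \<and> (\<forall>i. mp_hom_eval (F i) (pm_deg F) X = 0)}"

definition regular_automorphism :: "('n::finite) polymap \<Rightarrow> 'n polymap \<Rightarrow> bool" where
  "regular_automorphism F G \<longleftrightarrow> pm_inverse F G \<and> pm_indet F \<inter> pm_indet G = {}"

definition number_field :: "complex set \<Rightarrow> bool" where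
  "number_field K \<longleftrightarrow> 0 \<in> K \<and> 1 \<in> K \<and>
     (\<forall>x\<in>K. \<forall>y\<in>K. x + y \<in> K \<and> x - y \<in> K \<and> x * y \<in> K) \<and>
     (\<forall>x\<in>K. inverse x \<in> K) \<and>
     (\<exists>B. finite B \<and> B \<subseteq> K \<and>
        (\<forall>x\<in>K. \<exists>c. (\<forall>b\<in>B. c b \<in> \<rat>) \<and> x = (\<Sum>b\<in>B. c b * b)))"

text \<open>Algebraic closure of K inside \<complex>: the algebraic numbers.\<close>
definition Qbar :: "complex set" where
  "Qbar = {z. algebraic z}"

definition periodic_points :: "'n polymap \<Rightarrow> ('n \<Rightarrow> complex) set" where
  "periodic_points F = {x. (\<forall>i. x i \<in> Qbar) \<and> (\<exists>k>0. (pm_apply F ^^ k) x = x)}"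

definition zariski_dense_Qbar :: "('n \<Rightarrow> complex) set \<Rightarrow> bool" where
  "zariski_dense_Qbar S \<longleftrightarrow> S \<subseteq> {x. \<forall>i. x i \<in> Qbar} \<and>
     (\<forall>p::'n cmpoly. (\<forall>m. Poly_Mapping.lookup p m \<in> Qbar) \<longrightarrow> (\<forall>x\<in>S. mp_eval p x = 0) \<longrightarrow> p = 0)"

end

theory Submission
  imports Defs "HOL-Computational_Algebra.Fundamental_Theorem_Algebra" "HOL-Computational_Algebra.Primes"
    "HOL-Analysis.Continuum_Not_Denumerable" "HOL-Library.FuncSet"
begin

text \<open>
  Suppose that \<open>h \<noteq> 0\<close> vanishes at all periodic points, and choose \<open>x\<^sub>0 \<in> \<int>\<^sup>n\<close> with \<open>h(x\<^sub>0) \<noteq> 0\<close>.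
  All coefficients involved, and \<open>1/h(x\<^sub>0)\<close>, lie in a ring \<open>R \<subseteq> \<complex>\<close> that is finite over \<open>\<int>\<close>
  localised at a large prime \<open>p\<close>. As \<open>F\<close> permutes the finite set \<open>(R/p)\<^sup>n\<close>, some \<open>F\<^sup>k\<close> fixes \<open>x\<^sub>0\<close>
  modulo \<open>p\<close>. Let \<open>J\<close> be the ideal of \<open>R[x]\<close> generated by the \<open>n\<close> coordinates of \<open>F\<^sup>k(x) - x\<close>.

  Regularity and the Nullstellensatz express large powers of the variables through the leading forms
  of \<open>F\<close> and \<open>G = F\<^bsup>-1\<^esup>\<close>. As all points of a cycle have a successor and a predecessor in the cycle,
  this bounds degrees and makes \<open>R[x]/J\<close> a finite \<open>R\<close>-module. So the fixed points of \<open>F\<^sup>k\<close> are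
  algebraic, and \<open>p\<^sup>s h\<^sup>m \<in> J\<close> by the Nullstellensatz. Near \<open>(p, x\<^sub>0)\<close>, where \<open>h\<close> is a unit, \<open>J\<close>
  then contains \<open>p\<^sup>s\<close>, so that \<open>n\<close> elements define a finite scheme in a regular ring of dimension
  \<open>n + 1\<close>, which contradicts Krull's height theorem.
\<close>

subsection \<open>Subrings and linear systems\<close>

text \<open>The order of choices shapes the proof. The prime \<open>p\<close> has to avoid all
  denominators, and the period \<open>k\<close> is known only after \<open>p\<close>. So no
  certificate may be extracted from \<open>F^k\<close>: its coefficients could have \<open>p\<close>
  in the denominator. The certificate is found once, for \<open>F\<close> and \<open>G\<close>,
  before \<open>p\<close> is chosen; to use it for every \<open>k\<close>, degrees are measured in
  the coordinates of all points of the cycle together and not in the variables.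

  Finiteness of R[x]/J is wanted over \<open>R\<close>, not only over its fraction field. It is what
  keeps a fixed point modulo \<open>p\<close> from having no lift, since the lifts might otherwise
  escape to infinity p-adically.

  In \<open>R\<close> the number \<open>p\<close> may fail to be prime, and \<open>R\<close> may
  fail to be normal. Dimension therefore enters by counting: from 1/p not in \<open>R\<close> it
  follows that polynomials with small integer coefficients are incongruent modulo powers of (p, x_1,
  ..., x_n), which bounds the index of these powers from below; \<open>n\<close> equations with a
  finite set of residues bound it from above.\<close>

definition is_subring :: "'a::comm_ring_1 set \<Rightarrow> bool" where
  "is_subring R \<longleftrightarrow> 1 \<in> R \<and> (\<forall>x\<in>R. \<forall>y\<in>R. x - y \<in> R \<and> x * y \<in> R)"

lemma
  assumes "is_subring R"
  shows subring_1: "1 \<in> R"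
    and subring_0: "0 \<in> R"
    and subring_diff: "x \<in> R \<Longrightarrow> y \<in> R \<Longrightarrow> x - y \<in> R"
    and subring_mult: "x \<in> R \<Longrightarrow> y \<in> R \<Longrightarrow> x * y \<in> R"
    and subring_uminus: "x \<in> R \<Longrightarrow> - x \<in> R"
    and subring_add: "x \<in> R \<Longrightarrow> y \<in> R \<Longrightarrow> x + y \<in> R"
proof -
  show 1: "1 \<in> R" using assms by (simp add: is_subring_def)
  show d: "x - y \<in> R" if "x \<in> R" "y \<in> R" for x y using assms that by (simp add: is_subring_def)
  show "x * y \<in> R" if "x \<in> R" "y \<in> R" for x y using assms that by (simp add: is_subring_def)
  show 0: "0 \<in> R" using d[OF 1 1] by simp
  show m: "- x \<in> R" if "x \<in> R" for x using d[OF 0 that] by simp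
  show "x + y \<in> R" if "x \<in> R" "y \<in> R" for x y using d[OF that(1) m[OF that(2)]] by simp
qed

lemma subring_sum:
  assumes "is_subring R" "\<And>x. x \<in> A \<Longrightarrow> f x \<in> R"
  shows "sum f A \<in> R"
  using assms(2) by (induction A rule: infinite_finite_induct)
    (auto intro: subring_0[OF assms(1)] subring_add[OF assms(1)])

lemma subring_prod:
  assumes "is_subring R" "\<And>x. x \<in> A \<Longrightarrow> f x \<in> R"
  shows "prod f A \<in> R"
  using assms(2) by (induction A rule: infinite_finite_induct)
    (auto intro: subring_1[OF assms(1)] subring_mult[OF assms(1)])

lemma subring_power:
  assumes "is_subring R" "x \<in> R"
  shows "x ^ n \<in> R"
  by (induction n) (auto intro: subring_1[OF assms(1)] subring_mult[OF assms(1)] assms(2))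

lemma subring_of_nat:
  assumes "is_subring R"
  shows "of_nat n \<in> R"
  by (induction n) (auto intro: subring_0[OF assms] subring_1[OF assms] subring_add[OF assms])

lemma is_subring_UNIV: "is_subring UNIV"
  by (simp add: is_subring_def)

text \<open>Elimination by cross-multiplication: no division occurs, so the solution stays in the
  subring \<open>R\<close>. It serves over all complex numbers in the Nullstellensatz and over
  smaller rings in \<open>power_relation\<close>.\<close>

lemma homogeneous_system_nontrivial:
  fixes q :: "'a \<Rightarrow> 'b \<Rightarrow> 'c::idom"
  assumes R: "is_subring R" and "finite S" "finite A" "card S < card A"
    and "\<And>a s. a \<in> A \<Longrightarrow> s \<in> S \<Longrightarrow> q a s \<in> R"
  shows "\<exists>l. (\<forall>a. l a \<in> R) \<and> (\<exists>a\<in>A. l a \<noteq> 0) \<and> (\<forall>s\<in>S. (\<Sum>a\<in>A. l a * q a s) = 0)"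
  using assms(2-)
proof (induction S arbitrary: A q rule: finite_induct)
  case empty
  then obtain a where "a \<in> A" by (metis card.empty card_gt_0_iff equals0I)
  thus ?case using subring_1[OF R] by (intro exI[of _ "\<lambda>_. 1"]) auto
next
  case (insert s S)
  show ?case
  proof (cases "\<forall>a\<in>A. q a s = 0")
    case True
    have "\<exists>l. (\<forall>a. l a \<in> R) \<and> (\<exists>a\<in>A. l a \<noteq> 0) \<and> (\<forall>s\<in>S. (\<Sum>a\<in>A. l a * q a s) = 0)"
      using insert.prems insert.hyps by (intro insert.IH) auto
    thus ?thesis using True by auto
  next
    case False
    then obtain a0 where a0: "a0 \<in> A" "q a0 s \<noteq> 0" by auto
    define q' where "q' a t = q a0 s * q a t - q a s * q a0 t" for a t
    have "\<exists>l. (\<forall>a. l a \<in> R) \<and> (\<exists>a\<in>A-{a0}. l a \<noteq> 0) \<and> (\<forall>s\<in>S. (\<Sum>a\<in>A-{a0}. l a * q' a s) = 0)"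
    proof (rule insert.IH)
      show "card S < card (A - {a0})" using insert a0 by simp
      show "q' a t \<in> R" if "a \<in> A - {a0}" "t \<in> S" for a t
        unfolding q'_def using that insert.prems(3) a0
        by (intro subring_diff[OF R] subring_mult[OF R]) auto
    qed (use insert in auto)
    then obtain l where l: "\<And>a. l a \<in> R" "\<exists>a\<in>A-{a0}. l a \<noteq> 0"
      "\<And>s. s \<in> S \<Longrightarrow> (\<Sum>a\<in>A-{a0}. l a * q' a s) = 0" by auto
    \<comment> \<open>Back substitution: equation \<open>s\<close> determines the pivot unknown
      \<open>a0\<close> after all others have been multiplied by the pivot
      \<open>q a0 s\<close>.\<close>
    define k where "k a = (if a = a0 then - (\<Sum>a\<in>A-{a0}. l a * q a s)
      else if a \<in> A then l a * q a0 s else 0)" for a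
    have sp: "(\<Sum>a\<in>A. k a * q a t) = (\<Sum>a\<in>A-{a0}. l a * q' a t)" for t
    proof -
      have "(\<Sum>a\<in>A. k a * q a t) = k a0 * q a0 t + (\<Sum>a\<in>A-{a0}. k a * q a t)"
        using a0 insert.prems by (simp add: sum.remove)
      also have "(\<Sum>a\<in>A-{a0}. k a * q a t) = (\<Sum>a\<in>A-{a0}. l a * q a0 s * q a t)"
        by (intro sum.cong) (auto simp: k_def)
      also have "k a0 * q a0 t = (\<Sum>a\<in>A-{a0}. - (l a * q a s * q a0 t))"
        by (simp add: k_def sum_distrib_right sum_negf)
      finally show ?thesis
        by (simp add: q'_def sum.distrib [symmetric] algebra_simps)
    qed
    have "q' a s = 0" for a by (simp add: q'_def mult.commute)
    hence "\<forall>t\<in>insert s S. (\<Sum>a\<in>A. k a * q a t) = 0"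
      using l(3) by (auto simp: sp)
    moreover have "\<forall>a. k a \<in> R" unfolding k_def
      using l(1) insert.prems(3) a0
      by (auto intro!: subring_uminus[OF R] subring_sum[OF R] subring_mult[OF R] subring_0[OF R])
    moreover have "\<exists>a\<in>A. k a \<noteq> 0" using l(2) a0 by (auto simp: k_def)
    ultimately show ?thesis by blast
  qed
qed

section \<open>Subfields and linear retractions\<close>

definition is_subfield :: "'a::field set \<Rightarrow> bool" where
  "is_subfield K \<longleftrightarrow> is_subring K \<and> (\<forall>x\<in>K. inverse x \<in> K)"

text \<open>The values \<open>w x\<close> are the images of the \<open>v x\<close> under a \<open>K\<close>-linear retraction onto \<open>K\<close>.\<close>
lemma subfield_retraction:
  fixes v :: "'a \<Rightarrow> 'c::field"
  assumes K: "is_subfield K" and "finite X"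
  shows "\<exists>w. (\<forall>x. w x \<in> K) \<and>
    (\<forall>c. (\<forall>x. c x \<in> K) \<longrightarrow> (\<Sum>x\<in>X. c x * v x) \<in> K \<longrightarrow> (\<Sum>x\<in>X. c x * w x) = (\<Sum>x\<in>X. c x * v x))"
  using assms(2)
proof (induction X rule: finite_induct)
  case empty
  have "0 \<in> K" using K by (auto simp: is_subfield_def subring_0)
  thus ?case by (intro exI[of _ "\<lambda>_. 0"]) auto
next
  case (insert y X)
  have R: "is_subring K" and inv: "\<And>x. x \<in> K \<Longrightarrow> inverse x \<in> K" using K by (auto simp: is_subfield_def)
  note cl = subring_diff[OF R] subring_mult[OF R] subring_add[OF R] subring_0[OF R]
    subring_sum[OF R] subring_uminus[OF R]
  obtain w where w: "\<And>x. w x \<in> K"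
    "\<And>c. (\<forall>x. c x \<in> K) \<Longrightarrow> (\<Sum>x\<in>X. c x * v x) \<in> K \<Longrightarrow> (\<Sum>x\<in>X. c x * w x) = (\<Sum>x\<in>X. c x * v x)"
    using insert.IH by blast
  have upd: "(\<Sum>x\<in>X. c x * (w(y := a)) x) = (\<Sum>x\<in>X. c x * w x)" for a c
    using insert by (intro sum.cong) auto
  show ?case
  \<comment> \<open>If \<open>v y\<close> is a \<open>K\<close>-combination of the other
    \<open>v x\<close> up to an element of \<open>K\<close>, its image is forced. Otherwise no
    relation with value in \<open>K\<close> involves \<open>y\<close>, and its image may be
    0.\<close>
  proof (cases "\<exists>d. (\<forall>x. d x \<in> K) \<and> v y - (\<Sum>x\<in>X. d x * v x) \<in> K")
    case True
    then obtain d where d: "\<And>x. d x \<in> K" "v y - (\<Sum>x\<in>X. d x * v x) \<in> K" by auto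
    define k where "k = v y - (\<Sum>x\<in>X. d x * v x)"
    define a where "a = (\<Sum>x\<in>X. d x * w x) + k"
    have kK: "k \<in> K" using d k_def by simp
    have aK: "a \<in> K" unfolding a_def by (intro cl(3) cl(5) cl(2) kK w(1) d(1))
    show ?thesis
    proof (intro exI[of _ "w(y := a)"] conjI allI impI)
      show "(w(y := a)) x \<in> K" for x using aK w(1) by simp
      fix c assume c: "\<forall>x. c x \<in> K" and s: "(\<Sum>x\<in>insert y X. c x * v x) \<in> K"
      have vy: "v y = (\<Sum>x\<in>X. d x * v x) + k" by (simp add: k_def)
      have gen: "c y * ((\<Sum>x\<in>X. d x * u x) + k) + (\<Sum>x\<in>X. c x * u x) = (\<Sum>x\<in>X. (c x + c y * d x) * u x) + c y * k" for u
        by (simp add: sum.distrib sum_distrib_left distrib_left distrib_right mult.assoc add_ac)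
      have e: "(\<Sum>x\<in>insert y X. c x * v x) = (\<Sum>x\<in>X. (c x + c y * d x) * v x) + c y * k"
        using insert.hyps gen[of v] by (simp add: vy)
      have "(\<Sum>x\<in>X. (c x + c y * d x) * v x) \<in> K"
        using cl(1)[OF s cl(2)[OF c[rule_format, of y] kK]] by (simp add: e)
      hence "(\<Sum>x\<in>X. (c x + c y * d x) * w x) = (\<Sum>x\<in>X. (c x + c y * d x) * v x)"
        by (intro w(2)) (auto intro!: cl(3) cl(2) simp: c d(1))
      thus "(\<Sum>x\<in>insert y X. c x * (w(y := a)) x) = (\<Sum>x\<in>insert y X. c x * v x)"
        unfolding e using insert.hyps gen[of w] upd[of c a] by (simp add: a_def)
    qed
  next
    case False
    show ?thesis
    proof (intro exI[of _ "w(y := 0)"] conjI allI impI)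
      show "(w(y := 0)) x \<in> K" for x using cl(4) w(1) by simp
      fix c assume c: "\<forall>x. c x \<in> K" and s: "(\<Sum>x\<in>insert y X. c x * v x) \<in> K"
      have s': "c y * v y + (\<Sum>x\<in>X. c x * v x) \<in> K" using s insert.hyps by simp
      have "c y = 0"
      proof (rule ccontr)
        assume "c y \<noteq> 0"
        hence eq: "v y - (\<Sum>x\<in>X. (- c x * inverse (c y)) * v x) = inverse (c y) * (c y * v y + (\<Sum>x\<in>X. c x * v x))"
          by (simp add: distrib_left sum_negf sum_distrib_left mult_ac)
        have "\<exists>d. (\<forall>x. d x \<in> K) \<and> v y - (\<Sum>x\<in>X. d x * v x) \<in> K"
        proof (intro exI[of _ "\<lambda>x. - c x * inverse (c y)"] conjI allI)
          show "- c x * inverse (c y) \<in> K" for x by (intro cl(2) cl(6) inv c[rule_format])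
          show "v y - (\<Sum>x\<in>X. (- c x * inverse (c y)) * v x) \<in> K"
            unfolding eq by (intro cl(2) s' inv c[rule_format])
        qed
        thus False using False by blast
      qed
      thus "(\<Sum>x\<in>insert y X. c x * (w(y := 0)) x) = (\<Sum>x\<in>insert y X. c x * v x)"
        using w(2)[OF c] s' insert.hyps upd[of c 0] by simp
    qed
  qed
qed

subsection \<open>Polynomials\<close>

abbreviation "cf \<equiv> Poly_Mapping.lookup"

definition Const :: "complex \<Rightarrow> 'v cmpoly" where
  "Const c = Poly_Mapping.single 0 c"

definition Var :: "'v \<Rightarrow> 'v cmpoly" where
  "Var i = Poly_Mapping.single (Poly_Mapping.single i 1) 1"

definition ring_hom_fun :: "('a::comm_ring_1 \<Rightarrow> 'b::comm_ring_1) \<Rightarrow> bool" where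
  "ring_hom_fun c \<longleftrightarrow> c 1 = 1 \<and> (\<forall>a b. c (a + b) = c a + c b \<and> c (a * b) = c a * c b)"

lemma
  assumes "ring_hom_fun c"
  shows hom_1: "c 1 = 1" and hom_add: "c (a + b) = c a + c b" and hom_mult: "c (a * b) = c a * c b"
    and hom_0: "c 0 = 0" and hom_diff: "c (a - b) = c a - c b" and hom_power: "c (a ^ n) = c a ^ n"
    and hom_sum: "c (sum f A) = (\<Sum>x\<in>A. c (f x))" and hom_prod: "c (prod f A) = (\<Prod>x\<in>A. c (f x))"
proof -
  show 1: "c 1 = 1" and add: "c (a + b) = c a + c b" and m: "c (a * b) = c a * c b" for a b
    using assms by (auto simp: ring_hom_fun_def)
  show 0: "c 0 = 0" using add[of 0 0] by simp
  show "c (a - b) = c a - c b" using add[of "a - b" b] by simp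
  show "c (a ^ n) = c a ^ n" by (induction n) (auto simp: 1 m)
  show "c (sum f A) = (\<Sum>x\<in>A. c (f x))" by (induction A rule: infinite_finite_induct) (auto simp: 0 add)
  show "c (prod f A) = (\<Prod>x\<in>A. c (f x))" by (induction A rule: infinite_finite_induct) (auto simp: 1 m)
qed

text \<open>The coefficient map \<open>c\<close> covers two uses: with the identity this is
  evaluation at a point, with \<open>Const\<close> it is substitution of polynomials for the
  variables.\<close>

definition peval :: "(complex \<Rightarrow> 'r::comm_ring_1) \<Rightarrow> ('v::finite \<Rightarrow> 'r) \<Rightarrow> 'v cmpoly \<Rightarrow> 'r" where
  "peval c x p = (\<Sum>m\<in>Poly_Mapping.keys p. c (cf p m) * (\<Prod>i\<in>UNIV. x i ^ cf m i))"

lemma poly_mapping_expand: "p = (\<Sum>m\<in>Poly_Mapping.keys p. Poly_Mapping.single m (cf p m))"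
  by (rule poly_mapping_eqI)
    (simp add: lookup_sum lookup_single when_def in_keys_iff sum.delta' cong: if_cong)

context
  fixes c :: "complex \<Rightarrow> 'r::comm_ring_1" and x :: "'v::finite \<Rightarrow> 'r"
  assumes c: "ring_hom_fun c"
begin

lemma peval_superset:
  assumes "finite S" "Poly_Mapping.keys p \<subseteq> S"
  shows "peval c x p = (\<Sum>m\<in>S. c (cf p m) * (\<Prod>i\<in>UNIV. x i ^ cf m i))"
  unfolding peval_def using assms
  by (intro sum.mono_neutral_left) (auto simp: in_keys_iff hom_0[OF c])

lemma peval_add: "peval c x (p + q) = peval c x p + peval c x q"
proof -
  let ?S = "Poly_Mapping.keys p \<union> Poly_Mapping.keys q"
  have "finite ?S" by simp
  thus ?thesis using keys_add[of p q]
    by (simp add: peval_superset[of ?S] lookup_add hom_add[OF c] sum.distrib distrib_right)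
qed

lemma peval_zero: "peval c x 0 = 0"
  by (simp add: peval_def)

lemma peval_single: "peval c x (Poly_Mapping.single m a) = c a * (\<Prod>i\<in>UNIV. x i ^ cf m i)"
  by (subst peval_superset[of "{m}"]) auto

lemma peval_sum: "peval c x (sum f A) = (\<Sum>a\<in>A. peval c x (f a))"
  by (induction A rule: infinite_finite_induct) (auto simp: peval_add peval_zero)

lemma peval_mult: "peval c x (p * q) = peval c x p * peval c x q"
proof -
  have "p * q = (\<Sum>m\<in>Poly_Mapping.keys p. \<Sum>k\<in>Poly_Mapping.keys q.
      Poly_Mapping.single (m + k) (cf p m * cf q k))"
    by (subst (1) poly_mapping_expand[of p], subst (1) poly_mapping_expand[of q])
      (simp add: sum_product mult_single)
  thus ?thesis
    by (simp add: peval_sum peval_single hom_mult[OF c] lookup_add power_add prod.distrib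
        peval_def[of c x p] peval_def[of c x q] sum_product mult_ac)
qed

lemma peval_Const: "peval c x (Const a) = c a"
  by (simp add: Const_def peval_single)

lemma peval_Var: "peval c x (Var i) = x i"
proof -
  have "(\<Prod>j\<in>UNIV. x j ^ cf (Poly_Mapping.single i 1) j) = (\<Prod>j\<in>UNIV. if j = i then x j else 1)"
    by (intro prod.cong) (auto simp: lookup_single when_def)
  thus ?thesis by (simp add: Var_def peval_single hom_1[OF c])
qed

lemma peval_hom: "ring_hom_fun (peval c x)"
  using peval_Const[of 1] by (simp add: ring_hom_fun_def peval_add peval_mult hom_1[OF c] Const_def)

end

lemma Const_hom: "ring_hom_fun Const"
  by (simp add: ring_hom_fun_def Const_def single_add mult_single)

lemma Const_simps: "Const 1 = 1" "Const 0 = 0"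
  by (simp_all add: Const_def)

lemma prod_single:
  "(\<Prod>i\<in>A. Poly_Mapping.single (f i) (1::complex)) = Poly_Mapping.single (\<Sum>i\<in>A. f i) 1"
  by (induction A rule: infinite_finite_induct) (auto simp: mult_single)

lemma Var_power: "Var i ^ n = Poly_Mapping.single (Poly_Mapping.single i n) 1"
proof (induction n)
  case (Suc n)
  thus ?case by (simp add: Var_def mult_single flip: single_add)
qed simp

lemma monomial_prod:
  fixes m :: "'v::finite \<Rightarrow>\<^sub>0 nat"
  shows "(\<Prod>i\<in>UNIV. Var i ^ cf m i) = Poly_Mapping.single m 1"
proof -
  have "(\<Sum>i\<in>UNIV. Poly_Mapping.single i (cf m i)) = m"
    by (rule poly_mapping_eqI) (simp add: lookup_sum lookup_single when_def)
  thus ?thesis by (simp add: Var_power prod_single)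
qed

lemma peval_id: "peval Const Var p = p"
proof -
  have "peval Const Var p = (\<Sum>m\<in>Poly_Mapping.keys p. Poly_Mapping.single m (cf p m))"
    unfolding peval_def monomial_prod by (simp add: Const_def mult_single)
  thus ?thesis using poly_mapping_expand[of p] by simp
qed

lemma peval_peval:
  fixes s :: "'v::finite \<Rightarrow> 'w::finite cmpoly"
  assumes "ring_hom_fun c"
  shows "peval c x (peval Const s p) = peval c (\<lambda>i. peval c x (s i)) p"
proof -
  note h = peval_hom[OF assms, of x]
  show ?thesis
    unfolding peval_def[of Const] peval_def[of c "\<lambda>i. peval c x (s i)"]
    by (simp add: hom_sum[OF h] hom_mult[OF h] hom_prod[OF h] hom_power[OF h] peval_Const[OF assms])
qed

lemma id_hom: "ring_hom_fun (\<lambda>c. c)"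
  by (simp add: ring_hom_fun_def)

lemma mp_eval_peval: "mp_eval p x = peval (\<lambda>c. c) x p"
  unfolding mp_eval_def peval_def mon_eval_def
  by (intro sum.cong arg_cong2[of _ _ _ _ "(*)"] prod.mono_neutral_left) (auto simp: in_keys_iff)

lemma mp_eval_hom: "ring_hom_fun (\<lambda>p. mp_eval p (x :: 'v::finite \<Rightarrow> complex))"
  unfolding mp_eval_peval using peval_hom[OF id_hom, of x] by simp

lemma
  fixes x :: "'v::finite \<Rightarrow> complex"
  shows mp_eval_add: "mp_eval (p + q) x = mp_eval p x + mp_eval q x"
    and mp_eval_diff: "mp_eval (p - q) x = mp_eval p x - mp_eval q x"
    and mp_eval_mult: "mp_eval (p * q) x = mp_eval p x * mp_eval q x"
    and mp_eval_power: "mp_eval (p ^ n) x = mp_eval p x ^ n"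
    and mp_eval_sum: "mp_eval (sum f A) x = (\<Sum>a\<in>A. mp_eval (f a) x)"
    and mp_eval_prod: "mp_eval (prod f A) x = (\<Prod>a\<in>A. mp_eval (f a) x)"
  using hom_add[OF mp_eval_hom[of x]] hom_diff[OF mp_eval_hom[of x]] hom_mult[OF mp_eval_hom[of x]]
    hom_power[OF mp_eval_hom[of x]] hom_sum[OF mp_eval_hom[of x]] hom_prod[OF mp_eval_hom[of x]]
  by blast+

lemma mp_eval_Const: "mp_eval (Const a) (x :: 'v::finite \<Rightarrow> complex) = a"
  and mp_eval_Var: "mp_eval (Var i) x = x i"
  by (simp_all add: mp_eval_peval peval_Const peval_Var id_hom)

lemma mp_eval_subst:
  fixes s :: "'v::finite \<Rightarrow> 'w::finite cmpoly"
  shows "mp_eval (peval Const s p) x = mp_eval p (\<lambda>i. mp_eval (s i) x)"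
  unfolding mp_eval_peval peval_peval[OF id_hom] ..

section \<open>Polynomials with coefficients in a subring\<close>

definition poly_over :: "complex set \<Rightarrow> 'v cmpoly set" where
  "poly_over R = {p. \<forall>m. cf p m \<in> R}"

lemma
  assumes R: "is_subring R"
  shows poly_over_Const: "a \<in> R \<Longrightarrow> Const a \<in> poly_over R"
    and poly_over_single: "a \<in> R \<Longrightarrow> Poly_Mapping.single m a \<in> poly_over R"
    and poly_over_Var: "Var i \<in> poly_over R"
  using subring_0[OF R] subring_1[OF R]
  by (auto simp: poly_over_def Const_def Var_def lookup_single when_def)

lemma lookup_mult_poly:
  "cf (p * q) b = (\<Sum>m\<in>Poly_Mapping.keys p. \<Sum>k\<in>Poly_Mapping.keys q. if m + k = b then cf p m * cf q k else 0)"
  for p q :: "'v cmpoly"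
proof -
  have "p * q = (\<Sum>m\<in>Poly_Mapping.keys p. \<Sum>k\<in>Poly_Mapping.keys q.
      Poly_Mapping.single (m + k) (cf p m * cf q k))"
    by (subst (1) poly_mapping_expand[of p], subst (1) poly_mapping_expand[of q])
      (simp add: sum_product mult_single)
  thus ?thesis by (simp add: lookup_sum lookup_single when_def)
qed

lemma poly_over_subring:
  assumes R: "is_subring R"
  shows "is_subring (poly_over R :: 'v cmpoly set)"
proof -
  have "1 \<in> (poly_over R :: 'v cmpoly set)" using poly_over_single[OF R subring_1[OF R], of 0] by simp
  thus ?thesis
    using subring_0[OF R] unfolding is_subring_def
    by (auto simp: poly_over_def lookup_minus lookup_mult_poly
      intro!: subring_diff[OF R] subring_mult[OF R] subring_sum[OF R])
qed

lemma poly_over_peval: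
  assumes R: "is_subring R" and "p \<in> poly_over R" "\<And>i. s i \<in> poly_over R"
  shows "peval Const s p \<in> poly_over R"
proof -
  have "Const (cf p m) \<in> poly_over R" for m
    using assms(2) by (intro poly_over_Const[OF R]) (simp add: poly_over_def)
  thus ?thesis unfolding peval_def using assms(3)
    by (intro subring_sum subring_mult subring_prod subring_power poly_over_subring R) auto
qed

lemma mp_eval_in:
  fixes x :: "'v::finite \<Rightarrow> complex"
  assumes R: "is_subring R" and "p \<in> poly_over R" "\<And>i. x i \<in> R"
  shows "mp_eval p x \<in> R"
  unfolding mp_eval_peval peval_def using assms
  by (intro subring_sum subring_mult subring_prod subring_power R) (auto simp: poly_over_def)

text \<open>Evaluate at the powers of distinct primes: by unique factorisation distinct monomials take
  distinct values, so that a Vandermonde argument applies.\<close>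
lemma nonzero_poly_value:
  fixes p :: "'v::finite cmpoly"
  assumes "p \<noteq> 0"
  shows "\<exists>x :: 'v \<Rightarrow> nat. mp_eval p (\<lambda>i. of_nat (x i)) \<noteq> 0"
proof (rule ccontr)
  assume "\<not> ?thesis"
  hence z: "mp_eval p (\<lambda>i. of_nat (x i)) = 0" for x :: "'v \<Rightarrow> nat" by auto
  have "infinite {q::nat. prime q}" by (rule primes_infinite)
  then obtain P where P: "P \<subseteq> {q::nat. prime q}" "card P = card (UNIV :: 'v set)" "finite P"
    using infinite_arbitrarily_large by metis
  obtain q where q: "bij_betw q (UNIV :: 'v set) P"
    using finite_same_card_bij[of "UNIV :: 'v set" P] P by auto
  have qp: "prime (q i)" for i using q P by (auto simp: bij_betw_def)
  have qi: "inj q" using q by (auto simp: bij_betw_def)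
  define v where "v m = (\<Prod>i\<in>UNIV. q i ^ cf m i)" for m
  have v_inj: "m = m'" if "v m = v m'" for m m'
  proof (rule poly_mapping_eqI)
    fix i
    have "multiplicity (q i) (v m) = cf m i" for m
    proof -
      have "v m = (\<Prod>r\<in>P. r ^ cf m (inv q r))"
        unfolding v_def using qi by (subst prod.reindex_bij_betw[OF q, symmetric]) (simp add: inv_f_f)
      moreover have "q i \<in> P" using q by (auto simp: bij_betw_def)
      moreover have "multiplicity (q i) (\<Prod>r\<in>P. r ^ cf m (inv q r)) = cf m (inv q (q i))"
        using P qp[of i] \<open>q i \<in> P\<close> by (subst multiplicity_prod_prime_powers) auto
      ultimately show ?thesis using qi by (simp add: inv_f_f)
    qed
    thus "cf m i = cf m' i" using that by metis
  qed
  obtain m0 where m0: "m0 \<in> Poly_Mapping.keys p" using assms by fastforce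
  \<comment> \<open>\<open>Q\<close> vanishes at every \<open>v m\<close> except
    \<open>v m0\<close>. Combining the power sums \<open>pw\<close> with the coefficients of
    \<open>Q\<close> therefore isolates the coefficient of \<open>m0\<close>.\<close>
  define Q :: "complex poly" where "Q = (\<Prod>m\<in>Poly_Mapping.keys p - {m0}. [:- of_nat (v m), 1:])"
  have pw: "(\<Sum>m\<in>Poly_Mapping.keys p. cf p m * of_nat (v m) ^ s) = 0" for s
  proof -
    have "mp_eval p (\<lambda>i. of_nat (q i ^ s)) = (\<Sum>m\<in>Poly_Mapping.keys p. cf p m * of_nat (v m) ^ s)"
      unfolding mp_eval_peval peval_def v_def
      by (intro sum.cong) (simp_all add: prod_power_distrib mult.commute flip: power_mult)
    thus ?thesis using z[of "\<lambda>i. q i ^ s"] by simp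
  qed
  have "(\<Sum>m\<in>Poly_Mapping.keys p. cf p m * poly Q (of_nat (v m))) =
      (\<Sum>m\<in>Poly_Mapping.keys p. \<Sum>s\<le>degree Q. coeff Q s * (cf p m * of_nat (v m) ^ s))"
    by (simp add: poly_altdef sum_distrib_left mult_ac)
  also have "\<dots> = (\<Sum>s\<le>degree Q. coeff Q s * (\<Sum>m\<in>Poly_Mapping.keys p. cf p m * of_nat (v m) ^ s))"
    by (subst sum.swap) (simp add: sum_distrib_left)
  also have "\<dots> = 0" by (simp add: pw)
  finally have "(\<Sum>m\<in>Poly_Mapping.keys p. cf p m * poly Q (of_nat (v m))) = 0" .
  moreover have "poly Q (of_nat (v m)) = 0" if "m \<in> Poly_Mapping.keys p - {m0}" for m
    using that unfolding Q_def poly_prod by (intro prod_zero) auto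
  ultimately have "cf p m0 * poly Q (of_nat (v m0)) = 0"
    by (simp add: sum.remove[OF _ m0])
  moreover have "poly Q (of_nat (v m0)) \<noteq> 0"
    using v_inj by (auto simp: Q_def poly_prod)
  ultimately show False using m0 by (auto simp: in_keys_iff)
qed

text \<open>\<open>pm_inverse\<close> speaks about functions; this turns such identities into
  identities of polynomials, which can be substituted and reduced modulo ideals.\<close>

lemma poly_eqI_eval:
  fixes p q :: "'v::finite cmpoly"
  assumes "\<And>x. mp_eval p x = mp_eval q x"
  shows "p = q"
  using nonzero_poly_value[of "p - q"] assms by (auto simp: mp_eval_diff)

subsection \<open>Hilbert's Nullstellensatz\<close>

text \<open>Relative to a carrier \<open>A\<close>, since the coefficient rings are sets of complex
  numbers and not types. Containment in \<open>A\<close> is assumed separately where products call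
  for it.\<close>

definition is_ideal :: "'r::comm_ring_1 set \<Rightarrow> 'r set \<Rightarrow> bool" where
  "is_ideal A I \<longleftrightarrow> 0 \<in> I \<and> (\<forall>x\<in>I. \<forall>y\<in>I. x + y \<in> I) \<and> (\<forall>a\<in>A. \<forall>x\<in>I. a * x \<in> I)"

lemma
  assumes "is_ideal A I"
  shows ideal_0: "0 \<in> I" and ideal_add: "x \<in> I \<Longrightarrow> y \<in> I \<Longrightarrow> x + y \<in> I"
    and ideal_mult: "a \<in> A \<Longrightarrow> x \<in> I \<Longrightarrow> a * x \<in> I"
    and ideal_mult_right: "a \<in> A \<Longrightarrow> x \<in> I \<Longrightarrow> x * a \<in> I"
  using assms by (auto simp: is_ideal_def mult.commute)

lemma
  assumes I: "is_ideal A I" and A: "is_subring A"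
  shows ideal_uminus: "x \<in> I \<Longrightarrow> - x \<in> I"
    and ideal_diff: "x \<in> I \<Longrightarrow> y \<in> I \<Longrightarrow> x - y \<in> I"
    and ideal_diff_trans: "x - y \<in> I \<Longrightarrow> y - z \<in> I \<Longrightarrow> x - z \<in> I"
proof -
  have "- 1 \<in> A" using subring_1[OF A] subring_uminus[OF A] by auto
  thus m: "- x \<in> I" if "x \<in> I" for x using ideal_mult[OF I _ that, of "-1"] by auto
  show "x \<in> I \<Longrightarrow> y \<in> I \<Longrightarrow> x - y \<in> I" using ideal_add[OF I _ m, of x y] by auto
  show "x - y \<in> I \<Longrightarrow> y - z \<in> I \<Longrightarrow> x - z \<in> I" using ideal_add[OF I, of "x - y" "y - z"] by auto
qed

lemma ideal_sum:
  assumes "is_ideal A I" "\<And>x. x \<in> X \<Longrightarrow> f x \<in> I"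
  shows "sum f X \<in> I"
  using assms(2) by (induction X rule: infinite_finite_induct)
    (auto intro: ideal_0[OF assms(1)] ideal_add[OF assms(1)])

lemma ideal_mult_cong:
  assumes I: "is_ideal A I" and A: "is_subring A"
    and "a \<in> A" "d \<in> A" "a - b \<in> I" "c - d \<in> I"
  shows "a * c - b * d \<in> I"
proof -
  have "a * c - b * d = a * (c - d) + d * (a - b)" by (simp add: algebra_simps)
  thus ?thesis using assms by (auto intro!: ideal_add[OF I] ideal_mult[OF I])
qed

lemma ideal_power_cong:
  assumes I: "is_ideal A I" and A: "is_subring A" and "a \<in> A" "b \<in> A" "a - b \<in> I"
  shows "a ^ n - b ^ n \<in> I"
  by (induction n) (use assms ideal_0[OF I] in \<open>auto intro!: ideal_mult_cong[OF I A] subring_power\<close>)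

lemma ideal_prod_cong:
  assumes I: "is_ideal A I" and A: "is_subring A"
    and "\<And>x. x \<in> X \<Longrightarrow> f x \<in> A" "\<And>x. x \<in> X \<Longrightarrow> g x \<in> A" "\<And>x. x \<in> X \<Longrightarrow> f x - g x \<in> I"
  shows "prod f X - prod g X \<in> I"
  using assms(3-) by (induction X rule: infinite_finite_induct)
    (auto simp: ideal_0[OF I] intro!: ideal_mult_cong[OF I A] subring_prod[OF A])

lemma peval_cong_ideal:
  assumes I: "is_ideal A I" and A: "is_subring A"
    and "\<And>m. c (cf p m) \<in> A" "\<And>i. s i \<in> A" "\<And>i. t i \<in> A" "\<And>i. s i - t i \<in> I"
  shows "peval c s p - peval c t p \<in> I"
  unfolding peval_def sum_subtractf[symmetric] right_diff_distrib[symmetric] using assms(3-)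
  by (intro ideal_sum[OF I] ideal_mult[OF I] ideal_prod_cong[OF I A] subring_power[OF A]
      ideal_power_cong[OF I A]) auto

lemma cf_Const_mult: "cf (Const a * p) m = a * cf p m"
  unfolding Const_def
  by (simp add: lookup_mult_poly sum.delta' in_keys_iff)

lemma exponents_le_finite: "finite {m :: 'v::finite \<Rightarrow>\<^sub>0 nat. \<forall>i. cf m i \<le> D}"
proof -
  have "finite (cf ` {m :: 'v \<Rightarrow>\<^sub>0 nat. \<forall>i. cf m i \<le> D})"
  proof (rule finite_subset)
    show "cf ` {m :: 'v \<Rightarrow>\<^sub>0 nat. \<forall>i. cf m i \<le> D} \<subseteq> PiE UNIV (\<lambda>_. {..D})"
      by (auto simp: PiE_UNIV_domain)
  qed (rule finite_PiE, auto)
  thus ?thesis by (rule finite_imageD) (simp add: inj_on_def poly_mapping.lookup_inject)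
qed

text \<open>An ideal \<open>M\<close> that is maximal among those avoiding the powers of \<open>h\<close> is prime, and
  the polynomial ring modulo \<open>M\<close>, localised at \<open>h\<close>, is a field of countable dimension over \<open>\<complex>\<close>. If no
  \<open>x\<^sub>j - a\<close> were in \<open>M\<close>, the inverses of the \<open>x\<^sub>j - a\<close>, for uncountably many \<open>a\<close>,
  would be linearly dependent, which makes \<open>x\<^sub>j\<close> algebraic over \<open>\<complex>\<close>.\<close>
theorem nullstellensatz:
  fixes f :: "'k::finite \<Rightarrow> 'v::finite cmpoly"
  assumes van: "\<And>x. (\<And>k. mp_eval (f k) x = 0) \<Longrightarrow> mp_eval h x = 0"
  shows "\<exists>N q. h ^ N = (\<Sum>k\<in>UNIV. q k * f k)"
proof (rule ccontr)
  assume no: "\<not> ?thesis"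
  note U = is_subring_UNIV
  define I0 where "I0 = {\<Sum>k\<in>UNIV. q k * f k | q. True}"
  define \<A> where "\<A> = {I. is_ideal UNIV I \<and> I0 \<subseteq> I \<and> (\<forall>N. h ^ N \<notin> I)}"
  have I0: "is_ideal UNIV I0"
    unfolding is_ideal_def
  proof (intro conjI ballI)
    show "0 \<in> I0" unfolding I0_def by (auto intro!: exI[of _ "\<lambda>_. 0"])
    fix x y assume "x \<in> I0"
    then obtain q where q: "x = (\<Sum>k\<in>UNIV. q k * f k)" unfolding I0_def by auto
    show "a * x \<in> I0" for a
      unfolding I0_def q by (auto intro!: exI[of _ "\<lambda>k. a * q k"] simp: sum_distrib_left mult_ac)
    assume "y \<in> I0"
    then obtain r where r: "y = (\<Sum>k\<in>UNIV. r k * f k)" unfolding I0_def by auto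
    show "x + y \<in> I0"
      unfolding I0_def q r by (auto intro!: exI[of _ "\<lambda>k. q k + r k"] simp: sum.distrib distrib_right)
  qed
  have "I0 \<in> \<A>" using no I0 by (auto simp: \<A>_def I0_def)
  hence "\<exists>M\<in>\<A>. \<forall>X\<in>\<A>. M \<subseteq> X \<longrightarrow> X = M"
  proof (intro subset_Zorn_nonempty)
    fix C assume C: "C \<noteq> {}" "subset.chain \<A> C"
    have "is_ideal UNIV (\<Union>C)"
      unfolding is_ideal_def
    proof (intro conjI ballI)
      show "0 \<in> \<Union>C" using C by (fastforce simp: subset.chain_def \<A>_def is_ideal_def)
      show "a * x \<in> \<Union>C" if "x \<in> \<Union>C" for a x
        using C that by (fastforce simp: subset.chain_def \<A>_def is_ideal_def)
      fix x y assume "x \<in> \<Union>C" "y \<in> \<Union>C"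
      then obtain X Y where XY: "X \<in> C" "Y \<in> C" "x \<in> X" "y \<in> Y" by auto
      have "X \<subseteq> Y \<or> Y \<subseteq> X" using C XY by (auto simp: subset.chain_def)
      then obtain Z where "Z \<in> C" "x \<in> Z" "y \<in> Z" using XY by auto
      moreover from this have "is_ideal UNIV Z" using C by (auto simp: subset.chain_def \<A>_def)
      ultimately show "x + y \<in> \<Union>C" using ideal_add by blast
    qed
    thus "\<Union>C \<in> \<A>" using C by (fastforce simp: subset.chain_def \<A>_def)
  qed auto
  then obtain M where MA: "M \<in> \<A>" and max: "\<And>X. X \<in> \<A> \<Longrightarrow> M \<subseteq> X \<Longrightarrow> X = M" by blast
  have M: "is_ideal UNIV M" and M0: "I0 \<subseteq> M" and Mh: "\<And>N. h ^ N \<notin> M" using MA by (auto simp: \<A>_def)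
  have one: "1 \<notin> M" using Mh[of 0] by simp
  have const: "a = 0" if "Const a \<in> M" for a
  proof (rule ccontr)
    assume "a \<noteq> 0"
    hence "Const (inverse a) * Const a = (1 :: 'v cmpoly)"
      by (simp add: hom_mult[OF Const_hom, symmetric] Const_simps)
    thus False using ideal_mult[OF M _ that, of "Const (inverse a)"] one by simp
  qed
  \<comment> \<open>Maximality: \<open>M\<close> enlarged by \<open>g\<close> contains a power of
    \<open>h\<close>, so \<open>g\<close> becomes invertible modulo \<open>M\<close> once
    \<open>h\<close> is inverted.\<close>
  have inv: "\<exists>N q. h ^ N - q * g \<in> M" if g: "g \<notin> M" for g
  proof (rule ccontr)
    assume no': "\<not> ?thesis"
    define X where "X = {m + q * g | m q. m \<in> M}"
    have "is_ideal UNIV X"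
      unfolding is_ideal_def
    proof (intro conjI ballI)
      show "0 \<in> X" unfolding X_def using ideal_0[OF M] by (auto intro!: exI[of _ 0])
      fix x y assume "x \<in> X"
      then obtain m q where q: "x = m + q * g" "m \<in> M" unfolding X_def by auto
      have "a * x = a * m + (a * q) * g" "a * m \<in> M" for a
        using q ideal_mult[OF M] by (auto simp: algebra_simps)
      thus "a * x \<in> X" for a unfolding X_def by blast
      assume "y \<in> X"
      then obtain m' q' where q': "y = m' + q' * g" "m' \<in> M" unfolding X_def by auto
      have "x + y = (m + m') + (q + q') * g" "m + m' \<in> M"
        using q q' ideal_add[OF M] by (auto simp: algebra_simps)
      thus "x + y \<in> X" unfolding X_def by blast
    qed
    moreover have MX: "M \<subseteq> X"
    proof
      fix x assume "x \<in> M"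
      moreover have "x = x + 0 * g" by simp
      ultimately show "x \<in> X" unfolding X_def by blast
    qed
    moreover have "h ^ N \<notin> X" for N
      using no' by (auto simp: X_def) (metis add_diff_cancel_right')
    ultimately have "X \<in> \<A>" using M0 by (auto simp: \<A>_def)
    hence "X = M" using max MX by blast
    moreover have "g \<in> X"
    proof -
      have "g = 0 + 1 * g" by simp
      thus ?thesis unfolding X_def using ideal_0[OF M] by blast
    qed
    ultimately show False using g by simp
  qed
  have prime: "a \<in> M \<or> b \<in> M" if ab: "a * b \<in> M" for a b
  proof (rule ccontr)
    assume "\<not> ?thesis"
    then obtain N q N' q' where q: "h ^ N - q * a \<in> M" "h ^ N' - q' * b \<in> M" using inv by metis
    have "h ^ (N + N') = (h ^ N - q * a) * h ^ N' + (q * a) * (h ^ N' - q' * b) + (q * q') * (a * b)"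
      by (simp add: algebra_simps power_add)
    also have "\<dots> \<in> M" by (intro ideal_add[OF M] ideal_mult[OF M] ideal_mult_right[OF M] q ab) auto
    finally show False using Mh by simp
  qed
  have prime_prod: "\<exists>x\<in>X. g x \<in> M" if "prod g X \<in> M" "finite X" for g and X :: "nat set"
    using that(2,1) by (induction X rule: finite_induct) (use one prime in auto)
  have "\<exists>a. Var j - Const a \<in> M" for j
  proof (rule ccontr)
    assume nj: "\<nexists>a. Var j - Const a \<in> M"
    hence "\<forall>a. \<exists>N q. h ^ N - q * (Var j - Const a) \<in> M" using inv by blast
    then obtain N q where q: "\<And>a. h ^ N a - q a * (Var j - Const a) \<in> M" by metis
    have "\<exists>D. \<forall>m\<in>Poly_Mapping.keys p. \<forall>i. cf m i \<le> D" for p :: "'v cmpoly"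
      by (rule exI[of _ "Max (\<Union>m\<in>Poly_Mapping.keys p. range (cf m))"]) (auto intro!: Max_ge)
    then obtain D where D: "\<And>p m i. m \<in> Poly_Mapping.keys p \<Longrightarrow> cf m i \<le> D (p :: 'v cmpoly)" by metis
    \<comment> \<open>Pigeonhole: there are uncountably many \<open>a\<close>, but only countably
      many pairs of a power of \<open>h\<close> and a bound on exponents. Infinitely many
      \<open>q a\<close> thus share the power \<open>h ^ n\<close> and lie in one finite-dimensional
      space.\<close>
    have "\<exists>u. infinite {a. (N a, D (q a)) = u}"
    proof (rule ccontr)
      assume "\<not> ?thesis"
      hence "countable (\<Union>u. {a. (N a, D (q a)) = u})" by (intro countable_UN) (auto intro: countable_finite)
      moreover have "(\<Union>u. {a. (N a, D (q a)) = u}) = UNIV" by auto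
      ultimately show False using uncountable_UNIV_complex by simp
    qed
    then obtain n e where inf: "infinite {a. (N a, D (q a)) = (n, e)}" by auto
    define S where "S = {m :: 'v \<Rightarrow>\<^sub>0 nat. \<forall>i. cf m i \<le> e}"
    have S: "finite S" unfolding S_def by (rule exponents_le_finite)
    obtain A where A: "A \<subseteq> {a. (N a, D (q a)) = (n, e)}" "card A = Suc (card S)" "finite A"
      using infinite_arbitrarily_large[OF inf] by blast
    obtain l where l: "\<exists>a\<in>A. l a \<noteq> 0" "\<forall>s\<in>S. (\<Sum>a\<in>A. l a * cf (q a) s) = 0"
      using homogeneous_system_nontrivial[OF is_subring_UNIV, of S A "\<lambda>a. cf (q a)"] S A by auto
    have lin: "(\<Sum>a\<in>A. Const (l a) * q a) = 0"
    proof (rule poly_mapping_eqI)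
      fix s
      show "cf (\<Sum>a\<in>A. Const (l a) * q a) s = cf 0 s"
      proof (cases "s \<in> S")
        case True
        thus ?thesis using l by (simp add: lookup_sum cf_Const_mult)
      next
        case False
        have "cf (q a) s = 0" if "a \<in> A" for a
          using that A(1) False D[of s "q a"] by (fastforce simp: S_def in_keys_iff)
        thus ?thesis by (simp add: lookup_sum cf_Const_mult)
      qed
    qed
    \<comment> \<open>A linear relation between the inverses of the \<open>x_j - a\<close>,
      multiplied by all denominators.\<close>
    define T where "T = (\<Sum>a\<in>A. Const (l a) * (\<Prod>b\<in>A-{a}. Var j - Const b))"
    have "h ^ n * T \<in> M"
    proof -
      have sp: "(\<Prod>b\<in>A. Var j - Const b) = (Var j - Const a) * (\<Prod>b\<in>A-{a}. Var j - Const b)"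
        if "a \<in> A" for a using that A by (simp add: prod.remove)
      have "h ^ n * T = h ^ n * T - (\<Sum>a\<in>A. Const (l a) * q a) * (\<Prod>b\<in>A. Var j - Const b)"
        by (simp add: lin)
      also have "(\<Sum>a\<in>A. Const (l a) * q a) * (\<Prod>b\<in>A. Var j - Const b) =
          (\<Sum>a\<in>A. Const (l a) * q a * ((Var j - Const a) * (\<Prod>b\<in>A-{a}. Var j - Const b)))"
        unfolding sum_distrib_right by (intro sum.cong refl) (simp add: sp)
      also have "h ^ n * T - \<dots> =
          (\<Sum>a\<in>A. (Const (l a) * (\<Prod>b\<in>A-{a}. Var j - Const b)) * (h ^ n - q a * (Var j - Const a)))"
        by (simp add: T_def sum_distrib_left sum_subtractf[symmetric] algebra_simps)
      also have "\<dots> \<in> M" using q A(1) by (intro ideal_sum[OF M] ideal_mult[OF M]) auto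
      finally show ?thesis .
    qed
    hence TM: "T \<in> M" using prime Mh by blast
    \<comment> \<open>The univariate version of \<open>T\<close>. It is nonzero because only one
      summand survives at \<open>a0\<close>, and it splits into linear factors, one of which would
      lie in the prime ideal \<open>M\<close>.\<close>
    define P where "P = (\<Sum>a\<in>A. smult (l a) (\<Prod>b\<in>A-{a}. [:-b, 1:]))"
    obtain a0 where a0: "a0 \<in> A" "l a0 \<noteq> 0" using l by auto
    have "poly P a0 = l a0 * (\<Prod>b\<in>A-{a0}. a0 - b)"
    proof -
      have "(\<Prod>b\<in>A-{a}. a0 - b) = 0" if "a \<in> A - {a0}" for a
        using that a0 A by (intro prod_zero) auto
      hence "(\<Sum>a\<in>A-{a0}. l a * (\<Prod>b\<in>A-{a}. a0 - b)) = 0" by (intro sum.neutral) auto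
      thus ?thesis using A a0 by (simp add: P_def poly_sum poly_prod sum.remove)
    qed
    hence "poly P a0 \<noteq> 0" using a0 A by auto
    hence P0: "P \<noteq> 0" by auto
    obtain root where root: "smult (lead_coeff P) (\<Prod>i<degree P. [:-root i, 1:]) = P"
      by (rule complex_poly_decompose')
    have "T = Const (lead_coeff P) * (\<Prod>i<degree P. Var j - Const (root i))"
    proof (rule poly_eqI_eval)
      fix x :: "'v \<Rightarrow> complex"
      have "mp_eval T x = poly P (x j)"
        by (simp add: T_def P_def mp_eval_sum mp_eval_mult mp_eval_prod mp_eval_diff mp_eval_Const
            mp_eval_Var poly_sum poly_prod)
      also have "\<dots> = mp_eval (Const (lead_coeff P) * (\<Prod>i<degree P. Var j - Const (root i))) x"
        by (subst root [symmetric])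
          (simp add: mp_eval_mult mp_eval_prod mp_eval_diff mp_eval_Const mp_eval_Var poly_prod)
      finally show "mp_eval T x = \<dots>" .
    qed
    hence "Const (lead_coeff P) \<in> M \<or> (\<Prod>i<degree P. Var j - Const (root i)) \<in> M"
      using TM prime by auto
    thus False using const[of "lead_coeff P"] P0 prime_prod[of "\<lambda>i. Var j - Const (root i)"] nj by auto
  qed
  \<comment> \<open>Modulo \<open>M\<close> every polynomial is now its value at the point
    \<open>a\<close>. So \<open>a\<close> is a common zero of the \<open>f k\<close>, hence a zero
    of \<open>h\<close>, which puts \<open>h\<close> into \<open>M\<close>.\<close>
  then obtain a where a: "\<And>j. Var j - Const (a j) \<in> M" by metis
  have ev: "g - Const (mp_eval g a) \<in> M" for g
  proof -
    have "(Const (mp_eval g a) :: 'v cmpoly) = peval Const (\<lambda>i. Const (a i)) g"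
      unfolding mp_eval_peval peval_def
      by (simp add: hom_sum[OF Const_hom] hom_mult[OF Const_hom] hom_prod[OF Const_hom] hom_power[OF Const_hom])
    thus ?thesis using peval_cong_ideal[OF M U, of Const g Var "\<lambda>i. Const (a i)"] a by (simp add: peval_id)
  qed
  have "mp_eval (f k) a = 0" for k
  proof (rule const)
    have "(\<Sum>i\<in>UNIV. (if i = k then 1 else 0) * f i) = (\<Sum>i\<in>UNIV. if i = k then f i else 0)"
      by (intro sum.cong) auto
    hence "f k = (\<Sum>i\<in>UNIV. (if i = k then 1 else 0) * f i)" by simp
    hence "\<exists>q. f k = (\<Sum>i\<in>UNIV. q i * f i)"
      by (intro exI[of _ "\<lambda>i. if i = k then 1 else 0"])
    hence "f k \<in> M" using M0 by (auto simp: I0_def)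
    from ideal_diff[OF M U this ev[of "f k"]] show "Const (mp_eval (f k) a) \<in> M" by simp
  qed
  hence "h \<in> M" using ev[of h] van[of a] by (simp add: Const_simps)
  thus False using Mh[of 1] by simp
qed

text \<open>Comparing coefficients of monomials gives linear equations over \<open>K\<close> for the
  \<open>v x\<close>. One retraction onto \<open>K\<close> preserves all of them at once, so its
  values solve the same system.\<close>

lemma linear_descent:
  assumes K: "is_subfield K" and "finite X" "\<And>x. x \<in> X \<Longrightarrow> P x \<in> poly_over K"
    and g: "g \<in> poly_over K" "g = (\<Sum>x\<in>X. Const (v x) * P x)"
  shows "\<exists>w. (\<forall>x. w x \<in> K) \<and> g = (\<Sum>x\<in>X. Const (w x) * P x)"
proof -
  obtain w where w: "\<And>x. w x \<in> K"
    "\<And>c. (\<forall>x. c x \<in> K) \<Longrightarrow> (\<Sum>x\<in>X. c x * v x) \<in> K \<Longrightarrow> (\<Sum>x\<in>X. c x * w x) = (\<Sum>x\<in>X. c x * v x)"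
    using subfield_retraction[OF K assms(2), of v] by blast
  have "0 \<in> K" using K by (auto simp: is_subfield_def subring_0)
  have "g = (\<Sum>x\<in>X. Const (w x) * P x)"
  proof (rule poly_mapping_eqI)
    fix m
    define c where "c x = (if x \<in> X then cf (P x) m else 0)" for x
    have e: "cf (\<Sum>x\<in>X. Const (u x) * P x) m = (\<Sum>x\<in>X. c x * u x)" for u
      unfolding lookup_sum cf_Const_mult c_def by (intro sum.cong) auto
    have "\<forall>x. c x \<in> K" using assms(3) \<open>0 \<in> K\<close> by (auto simp: c_def poly_over_def)
    moreover have "(\<Sum>x\<in>X. c x * v x) \<in> K" using g e[of v] by (metis (no_types) mem_Collect_eq poly_over_def)
    ultimately show "cf g m = cf (\<Sum>x\<in>X. Const (w x) * P x) m"
      using w(2)[of c] unfolding g(2) e by simp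
  qed
  thus ?thesis using w(1) by blast
qed

text \<open>Written out in monomials, membership in the ideal is a finite linear system for the
  coefficients of the \<open>q k\<close>.\<close>

lemma ideal_descent:
  fixes f :: "'k::finite \<Rightarrow> 'v cmpoly"
  assumes K: "is_subfield K" and f: "\<And>k. f k \<in> poly_over K"
    and g: "g \<in> poly_over K" "g = (\<Sum>k\<in>UNIV. q k * f k)"
  shows "\<exists>q'. (\<forall>k. q' k \<in> poly_over K) \<and> g = (\<Sum>k\<in>UNIV. q' k * f k)"
proof -
  have R: "is_subring K" using K by (simp add: is_subfield_def)
  note PR = poly_over_subring[OF R]
  define X where "X = (SIGMA k:UNIV. Poly_Mapping.keys (q k))"
  have X: "finite X" unfolding X_def by auto
  define P where "P = (\<lambda>(k, m). Poly_Mapping.single m 1 * f k)"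
  have P: "P x \<in> poly_over K" for x
    by (cases x) (auto simp: P_def intro!: subring_mult[OF PR] poly_over_single[OF R] subring_1[OF R] f)
  have e: "(\<Sum>x\<in>X. Const (u x) * P x) = (\<Sum>k\<in>UNIV. (\<Sum>m\<in>Poly_Mapping.keys (q k). Poly_Mapping.single m (u (k, m))) * f k)" for u
  proof -
    have "(\<Sum>x\<in>X. Const (u x) * P x) =
        (\<Sum>k\<in>UNIV. \<Sum>m\<in>Poly_Mapping.keys (q k). Const (u (k, m)) * P (k, m))"
      unfolding X_def by (subst sum.Sigma) auto
    also have "\<dots> = (\<Sum>k\<in>UNIV. (\<Sum>m\<in>Poly_Mapping.keys (q k). Poly_Mapping.single m (u (k, m))) * f k)"
      by (simp add: P_def Const_def mult_single sum_distrib_right flip: mult.assoc)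
    finally show ?thesis .
  qed
  have "g = (\<Sum>x\<in>X. Const ((\<lambda>(k, m). cf (q k) m) x) * P x)"
    unfolding e using g(2) poly_mapping_expand[of "q _"] by simp
  from linear_descent[OF K X P g(1) this] obtain w
    where w: "\<And>x. w x \<in> K" "g = (\<Sum>x\<in>X. Const (w x) * P x)" by auto
  show ?thesis
    by (rule exI[of _ "\<lambda>k. \<Sum>m\<in>Poly_Mapping.keys (q k). Poly_Mapping.single m (w (k, m))"])
      (use w in \<open>auto simp: e intro!: subring_sum[OF PR] poly_over_single[OF R]\<close>)
qed

subsection \<open>Finite extensions of localised integers\<close>

text \<open>Scalars enter through \<open>e\<close>: the identity for modules of complex numbers,
  \<open>Const\<close> for modules of polynomials.\<close>

definition span_by :: "(complex \<Rightarrow> 'r::comm_ring_1) \<Rightarrow> complex set \<Rightarrow> 'r set \<Rightarrow> 'r set" where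
  "span_by e L B = {\<Sum>b\<in>B. e (c b) * b | c. \<forall>b. c b \<in> L}"

lemma span_I: "(\<And>b. c b \<in> L) \<Longrightarrow> (\<Sum>b\<in>B. e (c b) * b) \<in> span_by e L B"
  unfolding span_by_def by (intro CollectI exI[of _ c]) auto

context
  fixes e :: "complex \<Rightarrow> 'r::comm_ring_1" and L :: "complex set"
  assumes e: "ring_hom_fun e" and L: "is_subring L"
begin

lemma span_zero: "0 \<in> span_by e L B"
  unfolding span_by_def using subring_0[OF L]
  by (auto intro!: exI[of _ "\<lambda>_. 0"] simp: hom_0[OF e])

lemma span_add: "x \<in> span_by e L B \<Longrightarrow> y \<in> span_by e L B \<Longrightarrow> x + y \<in> span_by e L B"
proof -
  assume "x \<in> span_by e L B" "y \<in> span_by e L B"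
  then obtain c d where c: "x = (\<Sum>b\<in>B. e (c b) * b)" "\<forall>b. c b \<in> L"
    and d: "y = (\<Sum>b\<in>B. e (d b) * b)" "\<forall>b. d b \<in> L" by (auto simp: span_by_def)
  have "x + y = (\<Sum>b\<in>B. e (c b + d b) * b)" by (simp add: c d hom_add[OF e] distrib_right sum.distrib)
  moreover have "(\<Sum>b\<in>B. e (c b + d b) * b) \<in> span_by e L B"
    using c(2) d(2) by (intro span_I[of "\<lambda>b. c b + d b"] subring_add[OF L]) auto
  ultimately show ?thesis by simp
qed

lemma span_scale: "a \<in> L \<Longrightarrow> x \<in> span_by e L B \<Longrightarrow> e a * x \<in> span_by e L B"
proof -
  assume a: "a \<in> L" and "x \<in> span_by e L B"
  then obtain c where c: "x = (\<Sum>b\<in>B. e (c b) * b)" "\<forall>b. c b \<in> L" by (auto simp: span_by_def)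
  have "e a * x = (\<Sum>b\<in>B. e (a * c b) * b)" by (simp add: c hom_mult[OF e] sum_distrib_left mult_ac)
  moreover have "(\<Sum>b\<in>B. e (a * c b) * b) \<in> span_by e L B"
    using c(2) by (intro span_I[of "\<lambda>b. a * c b"] subring_mult[OF L a]) auto
  ultimately show ?thesis by simp
qed

lemma span_base: "finite B \<Longrightarrow> b \<in> B \<Longrightarrow> b \<in> span_by e L B"
proof -
  assume b: "finite B" "b \<in> B"
  have "b = (\<Sum>x\<in>B. if x = b then x else 0)" using b by simp
  also have "\<dots> = (\<Sum>x\<in>B. e (if x = b then 1 else 0) * x)"
    by (intro sum.cong) (auto simp: hom_1[OF e] hom_0[OF e])
  finally show ?thesis unfolding span_by_def using subring_0[OF L] subring_1[OF L]
    by (intro CollectI exI[of _ "\<lambda>x. if x = b then 1 else 0"]) auto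
qed

lemma span_sum: "(\<And>x. x \<in> X \<Longrightarrow> f x \<in> span_by e L B) \<Longrightarrow> sum f X \<in> span_by e L B"
  by (induction X rule: infinite_finite_induct) (auto intro: span_zero span_add)

lemma span_subset: "B \<subseteq> span_by e L B' \<Longrightarrow> span_by e L B \<subseteq> span_by e L B'"
  unfolding span_by_def[of e L B] by (auto intro!: span_sum span_scale)

lemma span_mono: "finite B' \<Longrightarrow> B \<subseteq> B' \<Longrightarrow> span_by e L B \<subseteq> span_by e L B'"
  by (rule span_subset) (auto intro: span_base)

text \<open>One power more than there are generators forces a linear dependence. The relation may
  fail to be monic, but a nonzero one shows algebraicity and controls denominators.\<close>

lemma power_relation:
  assumes J: "is_ideal A J" "is_subring A" and eA: "\<And>a. a \<in> L \<Longrightarrow> e a \<in> A"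
    and B: "finite B" and z: "\<And>i. \<exists>y\<in>span_by e L B. z ^ i - y \<in> J"
  shows "\<exists>l. (\<forall>i. l i \<in> L) \<and> (\<exists>i\<le>card B. l i \<noteq> 0) \<and> (\<Sum>i\<le>card B. e (l i) * z ^ i) \<in> J"
proof -
  have "\<exists>c. (\<forall>b. c b \<in> L) \<and> z ^ i - (\<Sum>b\<in>B. e (c b) * b) \<in> J" for i
    using z[of i] by (auto simp: span_by_def)
  then obtain c where c: "\<And>i b. c i b \<in> L" "\<And>i. z ^ i - (\<Sum>b\<in>B. e (c i b) * b) \<in> J" by metis
  obtain l where l: "\<forall>i. l i \<in> L" "\<exists>i\<le>card B. l i \<noteq> 0" "\<forall>b\<in>B. (\<Sum>i\<le>card B. l i * c i b) = 0"
    using homogeneous_system_nontrivial[OF L B, of "{..card B}" c] c(1) by auto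
  have "(\<Sum>i\<le>card B. e (l i) * z ^ i) = (\<Sum>i\<le>card B. e (l i) * (z ^ i - (\<Sum>b\<in>B. e (c i b) * b)))
      + (\<Sum>i\<le>card B. \<Sum>b\<in>B. e (l i * c i b) * b)"
    by (simp add: sum.distrib[symmetric] right_diff_distrib sum_distrib_left hom_mult[OF e] mult.assoc)
  also have "(\<Sum>i\<le>card B. \<Sum>b\<in>B. e (l i * c i b) * b) = (\<Sum>b\<in>B. e (\<Sum>i\<le>card B. l i * c i b) * b)"
    by (subst sum.swap) (simp add: hom_sum[OF e] sum_distrib_right)
  also have "\<dots> = 0" using l(3) by (simp add: hom_0[OF e])
  also have "(\<Sum>i\<le>card B. e (l i) * (z ^ i - (\<Sum>b\<in>B. e (c i b) * b))) + 0 \<in> J"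
    using l(1) eA c(2) by (auto intro!: ideal_sum[OF J(1)] ideal_mult[OF J(1)])
  finally show ?thesis using l by blast
qed

end

lemma algebraic_of_span:
  assumes L: "is_subring L" "L \<subseteq> \<rat>" and B: "finite B" and z: "\<And>i. z ^ i \<in> span_by (\<lambda>c. c) L B"
  shows "algebraic (z :: complex)"
proof -
  have "is_ideal UNIV {0::complex}" by (simp add: is_ideal_def)
  from power_relation[OF id_hom L(1) this is_subring_UNIV _ B, of z] z
  obtain l where l: "\<forall>i. l i \<in> L" "\<exists>i\<le>card B. l i \<noteq> 0" "(\<Sum>i\<le>card B. l i * z ^ i) = 0" by auto
  define P where "P = (\<Sum>i\<le>card B. monom (l i) i)"
  have cP: "coeff P i = (if i \<le> card B then l i else 0)" for i
    by (simp add: P_def coeff_sum)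
  show ?thesis
  proof (rule algebraicI')
    show "coeff P i \<in> \<rat>" for i using l(1) L(2) by (auto simp: cP)
    show "P \<noteq> 0" using l(2) cP by (metis coeff_0)
    show "poly P z = 0" using l(3) by (simp add: P_def poly_sum poly_monom)
  qed
qed

text \<open>The localisation Z_(p). The condition on \<open>b\<close> also excludes
  \<open>b = 0\<close>, as every integer divides 0.\<close>

definition Zloc :: "nat \<Rightarrow> complex set" where
  "Zloc p = {of_int a / of_int b | a b. \<not> int p dvd b}"

definition good_ring :: "nat \<Rightarrow> complex set \<Rightarrow> bool" where
  "good_ring p R \<longleftrightarrow> is_subring R \<and> Zloc p \<subseteq> R \<and> (\<exists>B. finite B \<and> B \<subseteq> R \<and> R \<subseteq> span_by (\<lambda>c. c) (Zloc p) B)"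

lemma Zloc_I: "\<not> int p dvd b \<Longrightarrow> of_int a / of_int b \<in> Zloc p"
  unfolding Zloc_def by blast

lemma Zloc_rat: "Zloc p \<subseteq> \<rat>"
  unfolding Zloc_def by auto

context
  fixes p :: nat
  assumes p: "prime p"
begin

lemma prime_int_dvd_mult: "int p dvd a * b \<longleftrightarrow> int p dvd a \<or> int p dvd b"
  using p by (simp add: prime_dvd_mult_iff)

lemma not_dvd_nonzero: "\<not> int p dvd b \<Longrightarrow> b \<noteq> 0" by auto

lemma Zloc_subring: "is_subring (Zloc p)"
  unfolding is_subring_def
proof (intro conjI ballI)
  show "1 \<in> Zloc p" using Zloc_I[of p 1 1] p by (auto dest: prime_gt_1_nat)
  fix x y assume "x \<in> Zloc p" "y \<in> Zloc p"
  then obtain a b c d where x: "x = of_int a / of_int b" "\<not> int p dvd b"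
    and y: "y = of_int c / of_int d" "\<not> int p dvd d" by (auto simp: Zloc_def)
  have nz: "b \<noteq> 0" "d \<noteq> 0" and bd: "\<not> int p dvd b * d" using x y by (auto simp: prime_int_dvd_mult)
  have "x - y = of_int (a * d - c * b) / of_int (b * d)" using nz by (simp add: x y field_simps)
  thus "x - y \<in> Zloc p" using Zloc_I[OF bd] by metis
  have "x * y = of_int (a * c) / of_int (b * d)" by (simp add: x y)
  thus "x * y \<in> Zloc p" using Zloc_I[OF bd] by metis
qed

lemma Zloc_unit:
  assumes "c \<in> Zloc p"
  shows "inverse (1 - of_nat p * c) \<in> Zloc p" "1 - of_nat p * c \<noteq> 0"
proof -
  obtain a b where c: "c = of_int a / of_int b" "\<not> int p dvd b" using assms by (auto simp: Zloc_def)
  have d: "\<not> int p dvd b - int p * a" using c by (simp add: dvd_diff_left_iff)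
  have "1 - of_nat p * c = of_int (b - int p * a) / of_int b"
    using not_dvd_nonzero[OF c(2)] by (simp add: c field_simps)
  thus "inverse (1 - of_nat p * c) \<in> Zloc p" "1 - of_nat p * c \<noteq> 0"
    using Zloc_I[OF d, of b] not_dvd_nonzero[OF d] not_dvd_nonzero[OF c(2)]
    by (auto simp del: of_int_diff of_int_mult)
qed

lemma Zloc_decompose:
  assumes "c \<in> Zloc p" "c \<noteq> 0"
  shows "\<exists>s u. u \<noteq> 0 \<and> inverse u \<in> Zloc p \<and> c = of_nat p ^ s * u"
proof -
  obtain a b where c: "c = of_int a / of_int b" "\<not> int p dvd b" using assms by (auto simp: Zloc_def)
  have "a \<noteq> 0" using c assms by auto
  moreover have "\<not> is_unit (int p)" using p by (auto dest: prime_gt_1_nat)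
  ultimately obtain a' where a': "a = int p ^ multiplicity (int p) a * a'" "\<not> int p dvd a'"
    using multiplicity_decompose' by metis
  show ?thesis
  proof (intro exI conjI)
    show "c = of_nat p ^ multiplicity (int p) a * (of_int a' / of_int b)"
      unfolding c(1) by (subst a'(1)) simp
    show "inverse (of_int a' / of_int b) \<in> Zloc p" using Zloc_I[OF a'(2), of b] by simp
    show "of_int a' / of_int b \<noteq> (0 :: complex)"
      using not_dvd_nonzero a' c by auto
  qed
qed

text \<open>By Bezout the denominator \<open>b\<close> has an inverse \<open>u\<close> modulo
  \<open>p ^ s\<close>; the representative is \<open>a * u\<close> reduced modulo
  \<open>p ^ s\<close>.\<close>

lemma Zloc_residue:
  assumes "c \<in> Zloc p"
  shows "\<exists>k<p ^ s. \<exists>y\<in>Zloc p. c = of_nat k + of_nat p ^ s * y"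
proof -
  obtain a b where c: "c = of_int a / of_int b" "\<not> int p dvd b" using assms by (auto simp: Zloc_def)
  have "coprime (int p) b" using p c(2) by (simp add: prime_imp_coprime)
  hence "coprime b (int p ^ s)" by (simp add: coprime_commute)
  then obtain u v where uv: "u * b + v * int p ^ s = 1"
    using bezout_int[of b "int p ^ s"] by auto
  have ps: "int p ^ s > 0" using p by (simp add: prime_gt_0_nat)
  define k where "k = nat ((a * u) mod int p ^ s)"
  have ik: "int k = (a * u) mod int p ^ s" using ps by (simp add: k_def)
  define t where "t = a * v + b * ((a * u) div int p ^ s)"
  have "a = a * (u * b + v * int p ^ s)" using uv by simp
  also have "\<dots> = b * (a * u) + int p ^ s * (a * v)" by (simp add: algebra_simps)
  also have "a * u = int k + int p ^ s * ((a * u) div int p ^ s)" by (simp add: ik)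
  finally have t: "a - b * int k = int p ^ s * t" by (simp add: t_def algebra_simps)
  hence "of_int a = of_int b * of_nat k + of_nat p ^ s * (of_int t :: complex)"
    by (metis add_diff_cancel_left' diff_add_cancel of_int_add of_int_mult of_int_of_nat_eq of_int_power add.commute)
  hence "c = of_nat k + of_nat p ^ s * (of_int t / of_int b)"
    using not_dvd_nonzero[OF c(2)] by (simp add: c field_simps)
  moreover have "k < p ^ s" using ps ik by (metis of_nat_less_iff of_nat_power pos_mod_bound)
  ultimately show ?thesis using Zloc_I[OF c(2)] by blast
qed

lemma good_Zloc: "good_ring p (Zloc p)"
proof -
  have "Zloc p \<subseteq> span_by (\<lambda>c. c) (Zloc p) {1}"
    by (auto simp: span_by_def intro: exI[of _ "\<lambda>_. _"])
  thus ?thesis unfolding good_ring_def using Zloc_subring subring_1[OF Zloc_subring]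
    by (intro conjI exI[of _ "{1}"]) auto
qed

text \<open>For a monic equation the powers \<open>z ^ i\<close> with \<open>i < D\<close> span
  \<open>R[z]\<close> over \<open>R\<close>; their products with generators of \<open>R\<close> span
  it over Z_(p).\<close>

lemma good_extend:
  assumes R: "good_ring p R" and r: "\<And>i. r i \<in> R" and z: "z ^ D = (\<Sum>i<D. r i * z ^ i)"
  shows "\<exists>R'. good_ring p R' \<and> R \<subseteq> R' \<and> z \<in> R'"
proof -
  note L = Zloc_subring
  obtain B where B: "finite B" "B \<subseteq> R" "R \<subseteq> span_by (\<lambda>c. c) (Zloc p) B" and Rs: "is_subring R"
    and RL: "Zloc p \<subseteq> R"
    using R by (auto simp: good_ring_def)
  have D: "D > 0" using z by (cases D) auto
  define Zs where "Zs = (\<lambda>i. z ^ i) ` {..<D}"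
  define R' where "R' = span_by (\<lambda>c. c) R Zs"
  have fin: "finite Zs" by (simp add: Zs_def)
  note sp = span_zero[OF id_hom Rs, of Zs, folded R'_def] span_add[OF id_hom Rs, of _ Zs, folded R'_def]
    span_scale[OF id_hom Rs, of _ _ Zs, folded R'_def] span_base[OF id_hom Rs fin, folded R'_def]
    span_sum[OF id_hom Rs, of _ _ Zs, folded R'_def]
  have low: "z ^ i \<in> R'" if "i < D" for i using that by (intro sp) (auto simp: Zs_def)
  have zD: "z ^ D \<in> R'" unfolding z by (intro sp(5) sp(3) r low) auto
  have zm: "z * x \<in> R'" if x: "x \<in> R'" for x
  proof -
    obtain c where c: "x = (\<Sum>b\<in>Zs. c b * b)" "\<forall>b. c b \<in> R" using x by (auto simp: R'_def span_by_def)
    have "z * b \<in> R'" if b: "b \<in> Zs" for b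
    proof -
      obtain i where i: "i < D" "b = z ^ i" using b by (auto simp: Zs_def)
      show ?thesis using low[of "Suc i"] zD i by (cases "Suc i = D") auto
    qed
    hence "(\<Sum>b\<in>Zs. c b * (z * b)) \<in> R'" using c(2) by - (rule sp(5), rule sp(3), auto)
    thus ?thesis by (simp add: c sum_distrib_left mult_ac)
  qed
  have zm': "z ^ k * x \<in> R'" if "x \<in> R'" for k x
    using that by (induction k) (auto simp: mult.assoc intro: zm)
  have mul: "x * y \<in> R'" if x: "x \<in> R'" and "y \<in> R'" for x y
  proof -
    obtain c where c: "x = (\<Sum>b\<in>Zs. c b * b)" "\<forall>b. c b \<in> R" using x by (auto simp: R'_def span_by_def)
    have "b * y \<in> R'" if "b \<in> Zs" for b using that \<open>y \<in> R'\<close> by (auto simp: Zs_def intro: zm')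
    hence "(\<Sum>b\<in>Zs. c b * (b * y)) \<in> R'" using c(2) by - (rule sp(5), rule sp(3), auto)
    thus ?thesis by (simp add: c sum_distrib_right mult.assoc)
  qed
  have RR': "R \<subseteq> R'" using sp(3)[OF _ low[OF D]] by auto
  have "is_subring R'"
    unfolding is_subring_def
  proof (intro conjI ballI mul)
    show "1 \<in> R'" using RR' subring_1[OF Rs] by auto
    fix x y assume "x \<in> R'" "y \<in> R'"
    moreover have "-1 \<in> R" by (intro subring_uminus[OF Rs] subring_1[OF Rs])
    ultimately show "x - y \<in> R'" using sp(2)[OF _ sp(3)[of "-1"], of x y] by simp
  qed auto
  moreover have "\<exists>B. finite B \<and> B \<subseteq> R' \<and> R' \<subseteq> span_by (\<lambda>c. c) (Zloc p) B"
  proof (intro exI conjI)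
    let ?B = "(\<lambda>(b, z). b * z) ` (B \<times> Zs)"
    show fB: "finite ?B" using B fin by auto
    show "?B \<subseteq> R'" using B RR' sp(4) by (auto intro!: mul)
    show "R' \<subseteq> span_by (\<lambda>c. c) (Zloc p) ?B"
    proof
      fix x assume "x \<in> R'"
      then obtain c where c: "x = (\<Sum>b\<in>Zs. c b * b)" "\<forall>b. c b \<in> R" by (auto simp: R'_def span_by_def)
      have "c y * y \<in> span_by (\<lambda>c. c) (Zloc p) ?B" if y: "y \<in> Zs" for y
      proof -
        have "c y \<in> span_by (\<lambda>c. c) (Zloc p) B" using c B by auto
        then obtain d where d: "c y = (\<Sum>b\<in>B. d b * b)" "\<forall>b. d b \<in> Zloc p" by (auto simp: span_by_def)
        have "(\<Sum>b\<in>B. d b * (b * y)) \<in> span_by (\<lambda>c. c) (Zloc p) ?B"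
          using d y by (intro span_sum[OF id_hom L] span_scale[OF id_hom L] span_base[OF id_hom L fB]) auto
        thus ?thesis by (simp add: d sum_distrib_right mult.assoc)
      qed
      thus "x \<in> span_by (\<lambda>c. c) (Zloc p) ?B" unfolding c(1) by (intro span_sum[OF id_hom L])
    qed
  qed
  ultimately have "good_ring p R'" using RL RR' by (auto simp: good_ring_def)
  moreover have "z \<in> R'" using zm[OF low[OF D]] by simp
  ultimately show ?thesis using RR' by blast
qed

text \<open>A leading coefficient prime to \<open>p\<close> is a unit in Z_(p), so each equation
  becomes monic and its root can be adjoined.\<close>

lemma good_ring_exists:
  assumes "finite V" "\<And>v. v \<in> V \<Longrightarrow> \<exists>P. (\<forall>i. coeff P i \<in> \<int>) \<and> (\<exists>l. lead_coeff P = of_int l \<and> \<not> int p dvd l) \<and> poly P v = (0 :: complex)"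
  shows "\<exists>R. good_ring p R \<and> V \<subseteq> R"
  using assms
proof (induction V rule: finite_induct)
  case empty
  thus ?case using good_Zloc by blast
next
  case (insert v V)
  then obtain R where R: "good_ring p R" "V \<subseteq> R" by auto
  obtain P l where P: "\<forall>i. coeff P i \<in> \<int>" "lead_coeff P = of_int l" "\<not> int p dvd l" "poly P v = 0"
    using insert.prems by blast
  have l0: "of_int l \<noteq> (0 :: complex)" using P not_dvd_nonzero by auto
  define r where "r i = - coeff P i / of_int l" for i
  have "r i \<in> R" for i
  proof -
    obtain k where "coeff P i = of_int k" using P(1) by (meson Ints_cases)
    hence "r i = of_int (- k) / of_int l" by (simp add: r_def)
    hence "r i \<in> Zloc p" using Zloc_I[OF P(3)] by metis
    thus ?thesis using R(1) unfolding good_ring_def by blast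
  qed
  moreover have "v ^ degree P = (\<Sum>i<degree P. r i * v ^ i)"
  proof -
    have "(\<Sum>i<degree P. coeff P i * v ^ i) + of_int l * v ^ degree P = 0"
      using P(2,4) by (simp add: poly_altdef lessThan_Suc_atMost [symmetric])
    hence "of_int l * v ^ degree P = - (\<Sum>i<degree P. coeff P i * v ^ i)"
      by (simp add: eq_neg_iff_add_eq_0 add.commute)
    hence "v ^ degree P = - (\<Sum>i<degree P. coeff P i * v ^ i) / of_int l"
      using l0 by (simp add: field_simps)
    thus ?thesis by (simp add: r_def sum_negf sum_divide_distrib)
  qed
  ultimately obtain R' where "good_ring p R'" "R \<subseteq> R'" "v \<in> R'" using good_extend[OF R(1)] by metis
  thus ?case using R by auto
qed

context
  fixes R :: "complex set"
  assumes good: "good_ring p R"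
begin

lemma good_subring: "is_subring R" and good_Zloc_subset: "Zloc p \<subseteq> R"
  using good by (auto simp: good_ring_def)

lemma good_basis: "\<exists>B. finite B \<and> B \<subseteq> R \<and> R \<subseteq> span_by (\<lambda>c. c) (Zloc p) B"
  using good by (auto simp: good_ring_def)

lemma good_algebraic:
  assumes "z \<in> R"
  shows "algebraic z"
  using good_basis algebraic_of_span[OF Zloc_subring Zloc_rat, of _ z] subring_power[OF good_subring assms]
  by blast

text \<open>Nakayama's lemma: if \<open>p\<close> were invertible in \<open>R\<close>, every element of a generating set
  would be redundant.\<close>
lemma inverse_prime_notin: "inverse (of_nat p) \<notin> R"
proof
  assume inv: "inverse (of_nat p) \<in> R"
  note L = Zloc_subring
  have p0: "of_nat p \<noteq> (0 :: complex)" using p by auto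
  have "False" if "finite B" "B \<subseteq> R" "R \<subseteq> span_by (\<lambda>c. c) (Zloc p) B" for B
    using that
  proof (induction B rule: finite_induct)
    case empty
    thus ?case using subring_1[OF good_subring] by (auto simp: span_by_def)
  next
    case (insert b B)
    have "inverse (of_nat p) * b \<in> R" using insert.prems inv by (intro subring_mult[OF good_subring]) auto
    hence "inverse (of_nat p) * b \<in> span_by (\<lambda>c. c) (Zloc p) (insert b B)" using insert.prems by auto
    then obtain c where c: "inverse (of_nat p) * b = (\<Sum>b\<in>insert b B. c b * b)" "\<forall>b. c b \<in> Zloc p"
      by (auto simp: span_by_def)
    define u where "u = 1 - of_nat p * c b"
    have u: "inverse u \<in> Zloc p" "u \<noteq> 0" unfolding u_def using Zloc_unit c by auto
    have "b = of_nat p * (inverse (of_nat p) * b)" using p0 by simp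
    also have "\<dots> = of_nat p * c b * b + of_nat p * (\<Sum>b\<in>B. c b * b)"
      unfolding c(1) using insert.hyps by (simp add: algebra_simps)
    finally have "u * b = of_nat p * (\<Sum>b\<in>B. c b * b)" by (simp add: u_def algebra_simps)
    hence "b = inverse u * of_nat p * (\<Sum>b\<in>B. c b * b)" using u by (simp add: field_simps)
    moreover have "inverse u * of_nat p * (\<Sum>b\<in>B. c b * b) \<in> span_by (\<lambda>c. c) (Zloc p) B"
      using c u insert.hyps(1)
      by (intro span_scale[OF id_hom L] span_sum[OF id_hom L] span_base[OF id_hom L] subring_mult[OF L]
          subring_of_nat[OF L]) auto
    ultimately have "insert b B \<subseteq> span_by (\<lambda>c. c) (Zloc p) B"
      using span_base[OF id_hom L insert.hyps(1)] by auto
    hence "R \<subseteq> span_by (\<lambda>c. c) (Zloc p) B" using insert.prems span_subset[OF id_hom L] by blast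
    thus False using insert by auto
  qed
  thus False using good_basis by blast
qed

text \<open>Divide a relation for \<open>r\<close> over Z_(p) by the lowest power that occurs: its
  coefficient \<open>l m\<close>, a unit times a power of \<open>p\<close>, becomes a multiple of
  \<open>r\<close>. Denominators in the fraction field of \<open>R\<close> can thus be cleared by
  powers of \<open>p\<close> alone.\<close>

lemma good_dvd_prime_power:
  assumes r: "r \<in> R" "r \<noteq> 0"
  shows "\<exists>s. \<exists>r'\<in>R. r * r' = of_nat p ^ s"
proof -
  note L = Zloc_subring and S = good_subring
  obtain B where B: "finite B" "R \<subseteq> span_by (\<lambda>c. c) (Zloc p) B" using good_basis by auto
  have "is_ideal UNIV {0::complex}" by (simp add: is_ideal_def)
  from power_relation[OF id_hom L this is_subring_UNIV _ B(1), of r] B(2) subring_power[OF S r(1)]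
  obtain l where l: "\<forall>i. l i \<in> Zloc p" "\<exists>i\<le>card B. l i \<noteq> 0" "(\<Sum>i\<le>card B. l i * r ^ i) = 0"
    by (auto simp: subset_iff)
  define m where "m = (LEAST i. l i \<noteq> 0)"
  obtain i0 where i0: "i0 \<le> card B" "l i0 \<noteq> 0" using l by auto
  have lm0: "l m \<noteq> 0" unfolding m_def by (rule LeastI[of _ i0]) (rule i0)
  have "m \<le> i0" unfolding m_def by (rule Least_le) (rule i0)
  hence mB: "m \<le> card B" using i0 by simp
  have below: "l i = 0" if "i < m" for i
    using not_less_Least[of i "\<lambda>i. l i \<noteq> 0"] that unfolding m_def by blast
  define y where "y = (\<Sum>i\<in>{Suc m..card B}. l i * r ^ (i - Suc m))"
  have "0 = (\<Sum>i\<in>{m..card B}. l i * r ^ i)"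
    unfolding l(3)[symmetric] by (rule sum.mono_neutral_right) (use below in auto)
  also have "\<dots> = l m * r ^ m + (\<Sum>i\<in>{Suc m..card B}. l i * r ^ i)"
    using mB by (simp add: sum.atLeast_Suc_atMost)
  also have "(\<Sum>i\<in>{Suc m..card B}. l i * r ^ i) = r ^ m * (r * y)"
    unfolding y_def sum_distrib_left
  proof (intro sum.cong refl)
    fix i assume "i \<in> {Suc m..card B}"
    hence "r ^ i = r ^ m * (r * r ^ (i - Suc m))" by (simp flip: power_Suc power_add)
    thus "l i * r ^ i = r ^ m * (r * (l i * r ^ (i - Suc m)))" by simp
  qed
  finally have "r ^ m * (l m + r * y) = 0" by (simp add: algebra_simps)
  hence lm: "r * y = - l m" using r(2) by (simp add: add_eq_0_iff)
  obtain s u where u: "u \<noteq> 0" "inverse u \<in> Zloc p" "l m = of_nat p ^ s * u"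
    using Zloc_decompose[of "l m"] l(1) lm0 by blast
  have "y \<in> R" unfolding y_def using l(1) good_Zloc_subset r
    by (intro subring_sum[OF S] subring_mult[OF S] subring_power[OF S]) auto
  moreover have "inverse u \<in> R" using u good_Zloc_subset by auto
  ultimately have "- (inverse u * y) \<in> R" by (intro subring_uminus[OF S] subring_mult[OF S])
  moreover have "r * - (inverse u * y) = of_nat p ^ s"
    using lm u(1,3) by (simp add: field_simps)
  ultimately show ?thesis by blast
qed

text \<open>Otherwise \<open>a = p^j * u\<close> with \<open>j < t\<close> and \<open>u\<close>
  prime to \<open>p\<close>, so that \<open>u\<close> lies in \<open>pR\<close> and hence 1/p in
  \<open>R\<close>. Integers that differ modulo \<open>p ^ t\<close> therefore stay different modulo
  \<open>p ^ t\<close> in \<open>R\<close>.\<close>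

lemma int_not_in_prime_power:
  assumes "r \<in> R" "of_int a = of_nat p ^ t * r" "\<bar>a\<bar> < int p ^ t"
  shows "a = 0"
proof (rule ccontr)
  assume "a \<noteq> 0"
  note S = good_subring
  have p0: "of_nat p \<noteq> (0 :: complex)" using p by auto
  have "\<not> is_unit (int p)" using p by (auto dest: prime_gt_1_nat)
  then obtain u where u: "a = int p ^ multiplicity (int p) a * u" "\<not> int p dvd u"
    using multiplicity_decompose' \<open>a \<noteq> 0\<close> by metis
  define j where "j = multiplicity (int p) a"
  have a: "a = int p ^ j * u" unfolding j_def by (rule u(1))
  have "j < t"
  proof (rule ccontr)
    assume "\<not> j < t"
    hence "int p ^ t dvd a" unfolding a by (intro dvd_mult2 le_imp_power_dvd) auto
    hence "\<bar>int p ^ t\<bar> \<le> \<bar>a\<bar>" using \<open>a \<noteq> 0\<close> by (intro dvd_imp_le_int)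
    thus False using assms(3) by simp
  qed
  have u0: "of_int u \<noteq> (0 :: complex)" using not_dvd_nonzero u by auto
  have "of_nat p ^ j * of_int u = (of_int a :: complex)" by (simp add: a)
  also have "\<dots> = of_nat p ^ (j + Suc (t - Suc j)) * r" using assms(2) \<open>j < t\<close> by simp
  also have "\<dots> = of_nat p ^ j * (of_nat p * (of_nat p ^ (t - Suc j) * r))" by (simp add: power_add mult_ac)
  finally have "of_nat p ^ j * of_int u = of_nat p ^ j * (of_nat p * (of_nat p ^ (t - Suc j) * r))" .
  hence "of_int u = of_nat p * (of_nat p ^ (t - Suc j) * r)" using p0 by simp
  hence "inverse (of_nat p) = (1 / of_int u) * (of_nat p ^ (t - Suc j) * r)"
    using p0 u0 by (simp add: divide_simps)
  moreover have "(1 / of_int u) * (of_nat p ^ (t - Suc j) * r) \<in> R"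
    using Zloc_I[OF u(2), of 1] good_Zloc_subset assms(1)
    by (intro subring_mult[OF S] subring_power[OF S] subring_of_nat[OF S]) auto
  ultimately show False using inverse_prime_notin by simp
qed

end

lemma span_residue:
  assumes e: "ring_hom_fun e" and x: "x \<in> span_by e (Zloc p) B"
  shows "\<exists>k\<in>PiE B (\<lambda>_. {..<p ^ s}). \<exists>y\<in>span_by e (Zloc p) B.
    x = (\<Sum>b\<in>B. e (of_nat (k b)) * b) + e (of_nat p ^ s) * y"
proof -
  obtain c where c: "x = (\<Sum>b\<in>B. e (c b) * b)" "\<forall>b. c b \<in> Zloc p" using x by (auto simp: span_by_def)
  have "\<forall>b. \<exists>k y. k < p ^ s \<and> y \<in> Zloc p \<and> c b = of_nat k + of_nat p ^ s * y"
    using Zloc_residue c(2) by blast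
  from choice[OF this] obtain k where "\<forall>b. \<exists>y. k b < p ^ s \<and> y \<in> Zloc p \<and> c b = of_nat (k b) + of_nat p ^ s * y" ..
  from choice[OF this] obtain d
    where "\<forall>b. k b < p ^ s \<and> d b \<in> Zloc p \<and> c b = of_nat (k b) + of_nat p ^ s * d b" ..
  hence k: "\<And>b. k b < p ^ s" "\<And>b. d b \<in> Zloc p" "\<And>b. c b = of_nat (k b) + of_nat p ^ s * d b" by auto
  have "x = (\<Sum>b\<in>B. e (of_nat (restrict k B b)) * b) + e (of_nat p ^ s) * (\<Sum>b\<in>B. e (d b) * b)"
    unfolding c(1) sum_distrib_left sum.distrib[symmetric]
    by (intro sum.cong) (simp_all add: k(3) hom_add[OF e] hom_mult[OF e] algebra_simps)
  moreover have "(\<Sum>b\<in>B. e (d b) * b) \<in> span_by e (Zloc p) B" by (rule span_I) (rule k(2))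
  moreover have "restrict k B \<in> PiE B (\<lambda>_. {..<p ^ s})" using k(1) by auto
  ultimately show ?thesis by blast
qed

end

lemma common_good_ring:
  assumes V: "finite V" "\<And>v. v \<in> V \<Longrightarrow> algebraic v"
  shows "\<exists>p R. prime p \<and> good_ring p R \<and> V \<subseteq> R"
proof -
  have "\<exists>P l. (\<forall>i. coeff P i \<in> \<int>) \<and> lead_coeff P = of_int l \<and> l \<noteq> 0 \<and> poly P v = 0" if v: "v \<in> V" for v
  proof -
    obtain P where P: "\<And>i. coeff P i \<in> \<int>" "P \<noteq> 0" "poly P v = 0" using V(2)[OF v] unfolding algebraic_def by blast
    moreover obtain l where "lead_coeff P = of_int l" using P(1) by (meson Ints_cases)
    ultimately show ?thesis by (metis leading_coeff_0_iff of_int_0)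
  qed
  then obtain P l where P: "\<And>v i. v \<in> V \<Longrightarrow> coeff (P v) i \<in> \<int>" "\<And>v. v \<in> V \<Longrightarrow> lead_coeff (P v) = of_int (l v)"
    "\<And>v. v \<in> V \<Longrightarrow> l v \<noteq> 0" "\<And>v. v \<in> V \<Longrightarrow> poly (P v) v = 0" by metis
  \<comment> \<open>A prime above the sum of the absolute values of the leading coefficients divides
    none of them.\<close>
  define n where "n = (\<Sum>v\<in>V. nat \<bar>l v\<bar>)"
  obtain p where p: "prime p" "n < p" using bigger_prime by blast
  have "\<not> int p dvd l v" if "v \<in> V" for v
  proof
    assume "int p dvd l v"
    from dvd_imp_le_int[OF P(3)[OF that] this] have "int p \<le> \<bar>l v\<bar>" by simp
    moreover have "nat \<bar>l v\<bar> \<le> n" unfolding n_def using that V(1) by (intro member_le_sum) auto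
    ultimately show False using p(2) by linarith
  qed
  hence "\<exists>P. (\<forall>i. coeff P i \<in> \<int>) \<and> (\<exists>l. lead_coeff P = of_int l \<and> \<not> int p dvd l) \<and> poly P v = (0 :: complex)"
    if "v \<in> V" for v using P that by (intro exI[of _ "P v"]) auto
  hence "\<exists>R. good_ring p R \<and> V \<subseteq> R" by (intro good_ring_exists p V(1))
  thus ?thesis using p by blast
qed

subsection \<open>Counting residue classes\<close>

text \<open>Bounds the index of \<open>I\<close> in \<open>A\<close> through representatives: a
  finite \<open>E\<close> has at least as many elements as there are residue classes.\<close>

definition covers :: "'r::comm_ring_1 set \<Rightarrow> 'r set \<Rightarrow> 'r set \<Rightarrow> bool" where
  "covers A I E \<longleftrightarrow> E \<subseteq> A \<and> (\<forall>a\<in>A. \<exists>x\<in>E. a - x \<in> I)"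

definition ideal_plus :: "'r::comm_ring_1 set \<Rightarrow> 'r set \<Rightarrow> 'r \<Rightarrow> 'r set" where
  "ideal_plus A I f = {x + a * f | x a. x \<in> I \<and> a \<in> A}"

lemma ideal_plus_ideal:
  assumes A: "is_subring A" and I: "is_ideal A I"
  shows "is_ideal A (ideal_plus A I f)"
  unfolding is_ideal_def
proof (intro conjI ballI)
  have "0 = 0 + 0 * f" by simp
  thus "0 \<in> ideal_plus A I f" unfolding ideal_plus_def using ideal_0[OF I] subring_0[OF A] by blast
  fix x y assume "x \<in> ideal_plus A I f"
  then obtain u a where x: "x = u + a * f" "u \<in> I" "a \<in> A" by (auto simp: ideal_plus_def)
  have "c * x = c * u + (c * a) * f" for c by (simp add: x algebra_simps)
  thus "c * x \<in> ideal_plus A I f" if "c \<in> A" for c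
    unfolding ideal_plus_def using ideal_mult[OF I that x(2)] subring_mult[OF A that x(3)] by blast
  assume "y \<in> ideal_plus A I f"
  then obtain v b where y: "y = v + b * f" "v \<in> I" "b \<in> A" by (auto simp: ideal_plus_def)
  have "x + y = (u + v) + (a + b) * f" by (simp add: x y algebra_simps)
  thus "x + y \<in> ideal_plus A I f"
    unfolding ideal_plus_def using ideal_add[OF I x(2) y(2)] subring_add[OF A x(3) y(3)] by blast
qed

lemma ideal_plus_mono:
  assumes "is_subring A"
  shows "I \<subseteq> ideal_plus A I f"
proof
  fix x assume "x \<in> I"
  moreover have "x = x + 0 * f" by simp
  ultimately show "x \<in> ideal_plus A I f" unfolding ideal_plus_def using subring_0[OF assms] by blast
qed

text \<open>Expand in powers of \<open>f\<close> with digits in \<open>E\<close>; as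
  \<open>f ^ t\<close> lies in \<open>I\<close>, only the first \<open>t\<close> digits
  matter.\<close>

lemma covers_adjoin:
  assumes A: "is_subring A" and I: "is_ideal A I" and f: "f \<in> A" "f ^ t \<in> I"
    and E: "finite E" "covers A (ideal_plus A I f) E"
  shows "\<exists>E'. finite E' \<and> card E' \<le> card E ^ t \<and> covers A I E'"
proof -
  define \<phi> where "\<phi> g = (\<Sum>i<t. g i * f ^ i)" for g :: "nat \<Rightarrow> 'a"
  define E' where "E' = \<phi> ` PiE {..<t} (\<lambda>_. E)"
  have fin: "finite (PiE {..<t} (\<lambda>_. E))" using E by (intro finite_PiE) auto
  have card: "card E' \<le> card E ^ t"
    unfolding E'_def using card_image_le[OF fin, of \<phi>] by (simp add: card_PiE)
  have EA: "E \<subseteq> A" using E by (simp add: covers_def)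
  have step: "\<exists>x\<in>E. \<exists>b\<in>A. a - (x + b * f) \<in> I" if a: "a \<in> A" for a
  proof -
    obtain x where x: "x \<in> E" "a - x \<in> ideal_plus A I f" using E a by (auto simp: covers_def)
    then obtain u b where "a - x = u + b * f" "u \<in> I" "b \<in> A" by (auto simp: ideal_plus_def)
    moreover from this have "a - (x + b * f) = u" by (simp add: algebra_simps)
    ultimately show ?thesis using x by blast
  qed
  have ex: "\<exists>g b. (\<forall>i. i < k \<longrightarrow> g i \<in> E) \<and> b \<in> A \<and> a - ((\<Sum>i<k. g i * f ^ i) + b * f ^ k) \<in> I"
    if a: "a \<in> A" for k a
  proof (induction k)
    case 0
    have "a - ((\<Sum>i<0. undefined i * f ^ i) + a * f ^ 0) \<in> I" using ideal_0[OF I] by simp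
    thus ?case using a by blast
  next
    case (Suc k)
    then obtain g b where g: "\<forall>i. i < k \<longrightarrow> g i \<in> E" "b \<in> A"
      "a - ((\<Sum>i<k. g i * f ^ i) + b * f ^ k) \<in> I" by auto
    obtain x c where x: "x \<in> E" "c \<in> A" "b - (x + c * f) \<in> I" using step g(2) by blast
    have upd: "(\<Sum>i<k. (g(k := x)) i * f ^ i) = (\<Sum>i<k. g i * f ^ i)" by (intro sum.cong) auto
    have "a - ((\<Sum>i<Suc k. (g(k := x)) i * f ^ i) + c * f ^ Suc k) =
        (a - ((\<Sum>i<k. g i * f ^ i) + b * f ^ k)) + f ^ k * (b - (x + c * f))"
      by (simp add: upd algebra_simps)
    also have "\<dots> \<in> I" by (intro ideal_add[OF I] ideal_mult[OF I] g x subring_power[OF A] f)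
    finally have "a - ((\<Sum>i<Suc k. (g(k := x)) i * f ^ i) + c * f ^ Suc k) \<in> I" .
    moreover have "\<forall>i. i < Suc k \<longrightarrow> (g(k := x)) i \<in> E" using g x by (auto simp: less_Suc_eq)
    ultimately show ?case using x(2) by blast
  qed
  have "covers A I E'"
    unfolding covers_def
  proof (intro conjI ballI)
    show "E' \<subseteq> A"
    proof
      fix x assume "x \<in> E'"
      then obtain g where g: "g \<in> PiE {..<t} (\<lambda>_. E)" "x = \<phi> g" by (auto simp: E'_def)
      have "g i \<in> A" if "i \<in> {..<t}" for i using EA PiE_mem[OF g(1) that] by auto
      thus "x \<in> A" unfolding g(2) \<phi>_def using f
        by (intro subring_sum[OF A] subring_mult[OF A] subring_power[OF A]) auto
    qed
    fix a assume "a \<in> A"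
    then obtain g b where g: "\<forall>i. i < t \<longrightarrow> g i \<in> E" "b \<in> A"
      "a - ((\<Sum>i<t. g i * f ^ i) + b * f ^ t) \<in> I" using ex by blast
    have "a - \<phi> (restrict g {..<t}) = (a - ((\<Sum>i<t. g i * f ^ i) + b * f ^ t)) + b * f ^ t"
      by (simp add: \<phi>_def)
    also have "\<dots> \<in> I" by (intro ideal_add[OF I] ideal_mult[OF I] g f)
    finally have "a - \<phi> (restrict g {..<t}) \<in> I" .
    moreover have "restrict g {..<t} \<in> PiE {..<t} (\<lambda>_. E)" using g(1) by auto
    ultimately show "\<exists>x\<in>E'. a - x \<in> I" unfolding E'_def by blast
  qed
  thus ?thesis using card fin unfolding E'_def by blast
qed

definition gen_ideal :: "'r::comm_ring_1 set \<Rightarrow> 'k set \<Rightarrow> ('k \<Rightarrow> 'r) \<Rightarrow> 'r set" where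
  "gen_ideal A X f = {\<Sum>k\<in>X. q k * f k | q. \<forall>k. q k \<in> A}"

lemma gen_ideal_I: "(\<And>k. q k \<in> A) \<Longrightarrow> (\<Sum>k\<in>X. q k * f k) \<in> gen_ideal A X f"
  unfolding gen_ideal_def by (intro CollectI exI[of _ q]) auto

lemma gen_ideal_ideal:
  assumes A: "is_subring A"
  shows "is_ideal A (gen_ideal A X f)"
  unfolding is_ideal_def
proof (intro conjI ballI)
  show "0 \<in> gen_ideal A X f" using gen_ideal_I[of "\<lambda>_. 0" A f X] subring_0[OF A] by simp
  fix x y assume "x \<in> gen_ideal A X f"
  then obtain q where q: "x = (\<Sum>k\<in>X. q k * f k)" "\<forall>k. q k \<in> A" by (auto simp: gen_ideal_def)
  show "a * x \<in> gen_ideal A X f" if "a \<in> A" for a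
    using gen_ideal_I[of "\<lambda>k. a * q k" A f X] q subring_mult[OF A that]
    by (simp add: sum_distrib_left mult.assoc)
  assume "y \<in> gen_ideal A X f"
  then obtain r where r: "y = (\<Sum>k\<in>X. r k * f k)" "\<forall>k. r k \<in> A" by (auto simp: gen_ideal_def)
  show "x + y \<in> gen_ideal A X f"
    using gen_ideal_I[of "\<lambda>k. q k + r k" A f X] q r subring_add[OF A]
    by (simp add: sum.distrib distrib_right)
qed

lemma gen_ideal_base:
  assumes A: "is_subring A" and "finite X" "k \<in> X"
  shows "f k \<in> gen_ideal A X f"
proof -
  have "(\<Sum>i\<in>X. (if i = k then 1 else 0) * f i) = (\<Sum>i\<in>X. if i = k then f i else 0)"
    by (intro sum.cong) auto
  also have "\<dots> = f k" using assms by simp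
  finally show ?thesis
    using gen_ideal_I[of "\<lambda>i. if i = k then 1 else 0" A f X] subring_0[OF A] subring_1[OF A] by simp
qed

text \<open>The generators are adjoined to \<open>I\<close> one at a time, and each of them
  multiplies the exponent of \<open>card E\<close> by \<open>t\<close>.\<close>

lemma covers_adjoin_many:
  assumes A: "is_subring A" and I: "is_ideal A I" and X: "finite X"
    and f: "\<And>k. k \<in> X \<Longrightarrow> f k \<in> A" "\<And>k. k \<in> X \<Longrightarrow> f k ^ t \<in> I"
    and E: "finite E" "E \<subseteq> A" "\<And>a. a \<in> A \<Longrightarrow> \<exists>x\<in>E. \<exists>j\<in>gen_ideal A X f. a - x - j \<in> I"
  shows "\<exists>E'. finite E' \<and> card E' \<le> card E ^ (t ^ card X) \<and> covers A I E'"
  using X I f E(3)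
proof (induction X arbitrary: I rule: finite_induct)
  case empty
  thus ?case using E(1,2) by (intro exI[of _ E]) (auto simp: covers_def gen_ideal_def)
next
  case (insert k X)
  note I = insert.prems(1)
  let ?I = "ideal_plus A I (f k)"
  have "\<exists>E'. finite E' \<and> card E' \<le> card E ^ (t ^ card X) \<and> covers A ?I E'"
  proof (rule insert.IH)
    show "is_ideal A ?I" by (rule ideal_plus_ideal[OF A I])
    show "f i \<in> A" "f i ^ t \<in> ?I" if "i \<in> X" for i
      using insert.prems that ideal_plus_mono[OF A, of I "f k"] by auto
    fix a assume "a \<in> A"
    then obtain x j where x: "x \<in> E" "j \<in> gen_ideal A (insert k X) f" "a - x - j \<in> I"
      using insert.prems by blast
    then obtain q where q: "j = (\<Sum>i\<in>insert k X. q i * f i)" "\<forall>i. q i \<in> A" by (auto simp: gen_ideal_def)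
    have "a - x - (\<Sum>i\<in>X. q i * f i) = (a - x - j) + q k * f k"
      using insert.hyps by (simp add: q algebra_simps)
    hence "a - x - (\<Sum>i\<in>X. q i * f i) \<in> ?I" unfolding ideal_plus_def using x(3) q(2) by blast
    moreover have "(\<Sum>i\<in>X. q i * f i) \<in> gen_ideal A X f" using q(2) by (intro gen_ideal_I) auto
    ultimately show "\<exists>x\<in>E. \<exists>j\<in>gen_ideal A X f. a - x - j \<in> ?I" using x(1) by blast
  qed
  then obtain E1 where E1: "finite E1" "card E1 \<le> card E ^ (t ^ card X)" "covers A ?I E1" by blast
  obtain E' where E': "finite E'" "card E' \<le> card E1 ^ t" "covers A I E'"
    using covers_adjoin[OF A I insert.prems(2)[OF insertI1] insert.prems(3)[OF insertI1] E1(1,3)] by auto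
  have "card E' \<le> (card E ^ (t ^ card X)) ^ t" using E'(2) E1(2) power_mono le_trans by blast
  also have "\<dots> = card E ^ (t ^ card (insert k X))"
    using insert.hyps by (simp add: mult.commute flip: power_mult)
  finally show ?case using E' by blast
qed

section \<open>Powers of the ideal (p, x_1, ..., x_n) and their index\<close>

definition mdeg :: "('v::finite \<Rightarrow>\<^sub>0 nat) \<Rightarrow> nat" where "mdeg m = (\<Sum>i\<in>UNIV. cf m i)"

lemma mdeg_add: "mdeg (a + b) = mdeg a + mdeg b"
  by (simp add: mdeg_def lookup_add sum.distrib)

text \<open>The \<open>t\<close>-th power of the ideal \<open>(p, x\<^sub>1, \<dots>, x\<^sub>n)\<close> of \<open>R[x]\<close>.\<close>
definition val_ideal :: "complex set \<Rightarrow> nat \<Rightarrow> nat \<Rightarrow> 'v::finite cmpoly set" where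
  "val_ideal R p t = {g. \<forall>b. \<exists>r\<in>R. cf g b = of_nat p ^ (t - mdeg b) * r}"

context
  fixes p :: nat and R :: "complex set"
  assumes R: "is_subring R"
begin

lemma val_ideal_mult:
  assumes "g \<in> val_ideal R p s" "h \<in> val_ideal R p t"
  shows "g * h \<in> val_ideal R p (s + t)"
proof -
  define D where "D u = {c. \<exists>r\<in>R. c = of_nat p ^ u * r}" for u
  have D0: "0 \<in> D u" for u using subring_0[OF R] by (auto simp: D_def intro!: bexI[of _ 0])
  have Dadd: "c + d \<in> D u" if "c \<in> D u" "d \<in> D u" for c d u
  proof -
    obtain r r' where "r \<in> R" "r' \<in> R" "c + d = of_nat p ^ u * (r + r')"
      using \<open>c \<in> D u\<close> \<open>d \<in> D u\<close> by (auto simp: D_def distrib_left)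
    thus ?thesis unfolding D_def using subring_add[OF R] by blast
  qed
  have Dsum: "sum c X \<in> D u" if "\<And>x. x \<in> X \<Longrightarrow> c x \<in> D u" for c :: "('a \<Rightarrow>\<^sub>0 nat) \<Rightarrow> _" and X u
    using that by (induction X rule: infinite_finite_induct) (auto intro: D0 Dadd)
  have "cf (g * h) b \<in> D (s + t - mdeg b)" for b
    unfolding lookup_mult_poly
  proof (intro Dsum)
    fix m k
    show "(if m + k = b then cf g m * cf h k else 0) \<in> D (s + t - mdeg b)"
    proof (cases "m + k = b")
      case True
      obtain x y where x: "x \<in> R" "cf g m = of_nat p ^ (s - mdeg m) * x"
        and y: "y \<in> R" "cf h k = of_nat p ^ (t - mdeg k) * y" using assms unfolding val_ideal_def by blast
      \<comment> \<open>Slack of truncated subtraction: if \<open>mdeg m\<close> exceeds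
        \<open>s\<close> or \<open>mdeg k\<close> exceeds \<open>t\<close>, the two exponents may
        add up to more than is asked for.\<close>
      define d where "d = (s - mdeg m) + (t - mdeg k) - (s + t - mdeg b)"
      have "(s - mdeg m) + (t - mdeg k) = (s + t - mdeg b) + d"
        unfolding d_def using True by (auto simp: mdeg_add)
      hence "cf g m * cf h k = of_nat p ^ (s + t - mdeg b) * (of_nat p ^ d * (x * y))"
        by (simp add: x y mult_ac flip: power_add) (simp add: power_add mult_ac)
      moreover have "of_nat p ^ d * (x * y) \<in> R"
        by (intro subring_mult[OF R] subring_power[OF R] subring_of_nat[OF R] x y)
      ultimately show ?thesis using True unfolding D_def by auto
    qed (simp add: D0)
  qed
  thus ?thesis by (auto simp: val_ideal_def D_def)
qed

lemma val_ideal_0: "val_ideal R p 0 = poly_over R"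
  by (auto simp: val_ideal_def poly_over_def)

lemma val_ideal_ideal: "is_ideal (poly_over R) (val_ideal R p t)"
  unfolding is_ideal_def
proof (intro conjI ballI)
  show "0 \<in> val_ideal R p t" using subring_0[OF R] by (auto simp: val_ideal_def)
  show "a * x \<in> val_ideal R p t" if "a \<in> poly_over R" "x \<in> val_ideal R p t" for a x :: "'a cmpoly"
    using val_ideal_mult[of a 0 x t] that by (simp add: val_ideal_0)
  show "x + y \<in> val_ideal R p t" if x: "x \<in> val_ideal R p t" and y: "y \<in> val_ideal R p t" for x y :: "'a cmpoly"
    unfolding val_ideal_def
  proof (intro CollectI allI)
    fix b
    obtain r r' where "r \<in> R" "r' \<in> R" "cf x b = of_nat p ^ (t - mdeg b) * r" "cf y b = of_nat p ^ (t - mdeg b) * r'"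
      using x y unfolding val_ideal_def by blast
    thus "\<exists>r\<in>R. cf (x + y) b = of_nat p ^ (t - mdeg b) * r"
      using subring_add[OF R] by (intro bexI[of _ "r + r'"]) (auto simp: lookup_add distrib_left)
  qed
qed

lemma val_ideal_power: "g \<in> val_ideal R p 1 \<Longrightarrow> g ^ t \<in> val_ideal R p t"
proof (induction t)
  case 0
  thus ?case using subring_1[OF poly_over_subring[OF R]] by (simp add: val_ideal_0)
next
  case (Suc t)
  thus ?case using val_ideal_mult[of g 1 "g ^ t" t] by simp
qed

lemma val_ideal_1:
  assumes "g \<in> poly_over R" "r \<in> R" "cf g 0 = of_nat p * r"
  shows "g \<in> val_ideal R p 1"
  unfolding val_ideal_def
proof (intro CollectI allI)
  fix b
  show "\<exists>r\<in>R. cf g b = of_nat p ^ (1 - mdeg b) * r"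
  proof (cases "mdeg b = 0")
    case True
    hence "b = 0" by (intro poly_mapping_eqI) (auto simp: mdeg_def)
    thus ?thesis using assms True by auto
  next
    case False
    thus ?thesis using assms by (auto simp: poly_over_def)
  qed
qed

end

lemma mp_eval_at_zero: "mp_eval g (\<lambda>_. 0) = cf g (0 :: 'v::finite \<Rightarrow>\<^sub>0 nat)"
proof -
  have e: "(\<Prod>i\<in>UNIV. (0::complex) ^ cf m i) = (if m = 0 then 1 else 0)" for m :: "'v \<Rightarrow>\<^sub>0 nat"
  proof (cases "m = 0")
    case False
    then obtain i where "cf m i \<noteq> 0" by (metis lookup_zero poly_mapping_eqI)
    hence "(\<Prod>i\<in>UNIV. (0::complex) ^ cf m i) = 0" by (intro prod_zero) auto
    thus ?thesis using False by simp
  qed simp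
  have "mp_eval g (\<lambda>_. 0) = (\<Sum>m\<in>Poly_Mapping.keys g. if m = 0 then cf g 0 else 0)"
    unfolding mp_eval_peval peval_def e by (intro sum.cong) auto
  thus ?thesis by (simp add: in_keys_iff)
qed

text \<open>Polynomials with exponents below \<open>\<tau>\<close> and natural coefficients below
  \<open>p ^ \<tau>\<close> are pairwise incongruent: their monomials have degree at most
  \<open>n * \<tau>\<close>, so step \<open>(n + 1) * \<tau>\<close> of the filtration still demands
  that coefficients of differences be divisible by \<open>p ^ \<tau>\<close>.\<close>

lemma val_ideal_index:
  assumes p: "prime p" and good: "good_ring p R"
    and E: "finite E" "covers (poly_over R :: 'v::finite cmpoly set) (val_ideal R p ((card (UNIV :: 'v set) + 1) * \<tau>)) E"
  shows "p ^ (\<tau> ^ (card (UNIV :: 'v set) + 1)) \<le> card E"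
proof -
  note R = good_subring[OF p good]
  note PR = poly_over_subring[OF R]
  define n where "n = card (UNIV :: 'v set)"
  define t where "t = (n + 1) * \<tau>"
  note V = val_ideal_ideal[OF R, of p t]
  define Box where "Box = {m :: 'v \<Rightarrow>\<^sub>0 nat. \<forall>i. cf m i < \<tau>}"
  have cfBox: "bij_betw cf Box (PiE UNIV (\<lambda>_. {..<\<tau>}))"
    by (rule bij_betw_byWitness[of _ Abs_poly_mapping])
      (auto simp: Box_def PiE_UNIV_domain Abs_poly_mapping_inverse poly_mapping.lookup_inverse)
  have cBox: "card Box = \<tau> ^ n"
    using bij_betw_same_card[OF cfBox] by (simp add: card_PiE n_def)
  have fBox: "finite Box"
    unfolding bij_betw_finite[OF cfBox] by (rule finite_PiE) auto
  define \<Phi> where "\<Phi> = PiE Box (\<lambda>_. {..<p ^ \<tau>})"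
  define g :: "_ \<Rightarrow> 'v cmpoly" where "g r = (\<Sum>b\<in>Box. Poly_Mapping.single b (of_nat (r b)))" for r :: "('v \<Rightarrow>\<^sub>0 nat) \<Rightarrow> nat"
  have gR: "g r \<in> poly_over R" for r
    unfolding g_def by (intro subring_sum[OF PR] poly_over_single[OF R] subring_of_nat[OF R])
  have cfg: "cf (g r) b = (if b \<in> Box then of_nat (r b) else 0)" for r b
    unfolding g_def using fBox by (simp add: lookup_sum lookup_single when_def)
  have "\<exists>x\<in>E. g r - x \<in> val_ideal R p t" for r using E gR by (auto simp: covers_def t_def n_def)
  then obtain e where e: "\<And>r. e r \<in> E" "\<And>r. g r - e r \<in> val_ideal R p t" by metis
  have "inj_on e \<Phi>"
  proof (rule inj_onI)
    fix r r' assume r: "r \<in> \<Phi>" "r' \<in> \<Phi>" "e r = e r'"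
    have "g r - g r' \<in> val_ideal R p t"
      using ideal_diff[OF V PR e(2)[of r] e(2)[of r']] r(3) by simp
    hence d: "\<exists>y\<in>R. cf (g r) b - cf (g r') b = of_nat p ^ (t - mdeg b) * y" for b
      unfolding val_ideal_def by (auto simp: lookup_minus)
    show "r = r'"
    proof (rule PiE_ext)
      show "r \<in> PiE Box (\<lambda>_. {..<p ^ \<tau>})" "r' \<in> PiE Box (\<lambda>_. {..<p ^ \<tau>})"
        using r by (auto simp: \<Phi>_def)
      fix b assume b: "b \<in> Box"
      have "mdeg b \<le> (\<Sum>i\<in>(UNIV::'v set). \<tau>)"
        unfolding mdeg_def using b by (intro sum_mono) (auto simp: Box_def less_imp_le)
      hence tb: "\<tau> \<le> t - mdeg b" by (simp add: t_def n_def)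
      obtain y where y: "y \<in> R" "cf (g r) b - cf (g r') b = of_nat p ^ (t - mdeg b) * y" using d by blast
      have "int (r b) - int (r' b) = 0"
      proof (rule int_not_in_prime_power[OF p good])
        show "of_nat p ^ (t - mdeg b - \<tau>) * y \<in> R"
          by (intro subring_mult[OF R] subring_power[OF R] subring_of_nat[OF R] y)
        have "of_int (int (r b) - int (r' b)) = cf (g r) b - cf (g r') b" using b by (simp add: cfg)
        also have "\<dots> = of_nat p ^ (\<tau> + (t - mdeg b - \<tau>)) * y"
          unfolding y(2) le_add_diff_inverse[OF tb] ..
        finally show "of_int (int (r b) - int (r' b)) = of_nat p ^ \<tau> * (of_nat p ^ (t - mdeg b - \<tau>) * y)"
          by (simp add: power_add mult.assoc)
        have "r b < p ^ \<tau>" "r' b < p ^ \<tau>" using r b by (auto simp: \<Phi>_def PiE_def Pi_def)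
        hence "\<bar>int (r b) - int (r' b)\<bar> < int (p ^ \<tau>)" by linarith
        thus "\<bar>int (r b) - int (r' b)\<bar> < int p ^ \<tau>" by simp
      qed
      thus "r b = r' b" by simp
    qed
  qed
  hence "card \<Phi> \<le> card E" using e(1) E(1) by (intro card_inj_on_le[of e]) auto
  moreover have "card \<Phi> = p ^ (\<tau> ^ (n + 1))"
    by (simp add: \<Phi>_def card_PiE fBox cBox mult.commute flip: power_mult)
  ultimately show ?thesis by (simp add: n_def)
qed

text \<open>Otherwise the \<open>n\<close> elements \<open>f\<^sub>k\<close> would define a finite scheme in a regular local ring of
  dimension \<open>n + 1\<close>: the index of the \<open>t\<close>-th step of the filtration would be exponential in
  \<open>t\<^sup>n\<close> instead of \<open>t\<^bsup>n+1\<^esup>\<close>. This is the Hilbert-Samuel proof of Krull's height theorem.\<close>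
theorem no_finite_intersection:
  fixes f :: "'v::finite \<Rightarrow> 'v cmpoly"
  assumes p: "prime p" and good: "good_ring p R"
    and f: "\<And>k. f k \<in> val_ideal R p 1" "\<And>k. f k \<in> poly_over R"
    and E: "finite E" "E \<subseteq> poly_over R"
      "\<And>t a. a \<in> poly_over R \<Longrightarrow> \<exists>x\<in>E. \<exists>j\<in>gen_ideal (poly_over R) UNIV f. a - x - j \<in> val_ideal R p t"
  shows False
proof -
  note R = good_subring[OF p good]
  note PR = poly_over_subring[OF R]
  define n where "n = card (UNIV :: 'v set)"
  define c where "c = card E"
  \<comment> \<open>Chosen so that \<open>\<tau> ^ (n + 1)\<close> exceeds
    \<open>c * t ^ n = c * (n + 1) ^ n * \<tau> ^ n\<close>: the lower bound for the index then
    beats the upper bound \<open>c ^ (t ^ n)\<close>, which is at most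
    \<open>2 ^ (c * t ^ n)\<close>.\<close>
  define \<tau> where "\<tau> = c * (n + 1) ^ n + 1"
  define t where "t = (n + 1) * \<tau>"
  have "\<exists>E' :: 'v cmpoly set. finite E' \<and> card E' \<le> card E ^ (t ^ card (UNIV :: 'v set)) \<and> covers (poly_over R) (val_ideal R p t) E'"
    by (rule covers_adjoin_many[OF PR val_ideal_ideal[OF R] finite_UNIV f(2) val_ideal_power[OF R f(1)] E])
  then obtain E' :: "'v cmpoly set" where E': "finite E'" "card E' \<le> card E ^ (t ^ n)" "covers (poly_over R) (val_ideal R p t) E'"
    unfolding n_def by (elim exE conjE)
  have "2 ^ (\<tau> ^ (n + 1)) \<le> p ^ (\<tau> ^ (n + 1))" using p by (intro power_mono prime_ge_2_nat) auto
  also have "\<dots> \<le> card E'" using val_ideal_index[OF p good E'(1)] E'(3) by (simp add: t_def n_def)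
  also have "\<dots> \<le> c ^ (t ^ n)" using E'(2) by (simp add: c_def)
  also have "\<dots> \<le> (2 ^ c) ^ (t ^ n)" by (rule power_mono) (simp_all add: less_imp_le[OF less_exp])
  also have "\<dots> = 2 ^ (c * t ^ n)" by (simp add: power_mult)
  finally have "\<tau> ^ (n + 1) \<le> c * t ^ n" by simp
  hence "\<tau> * \<tau> ^ n \<le> (c * (n + 1) ^ n) * \<tau> ^ n"
    unfolding t_def power_mult_distrib by (simp only: Suc_eq_plus1[symmetric] power_Suc mult.assoc)
  moreover have "\<tau> ^ n > 0" by (simp add: \<tau>_def)
  ultimately have "\<tau> \<le> c * (n + 1) ^ n" by (metis mult_le_cancel2)
  thus False by (simp add: \<tau>_def)
qed

subsection \<open>Homogeneous components\<close>

definition hcomp :: "'v::finite cmpoly \<Rightarrow> nat \<Rightarrow> 'v cmpoly" where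
  "hcomp p d = (\<Sum>m\<in>{m \<in> Poly_Mapping.keys p. mdeg m = d}. Poly_Mapping.single m (cf p m))"

lemma cf_hcomp: "cf (hcomp p d) m = (if mdeg m = d then cf p m else 0)"
proof -
  have "cf (hcomp p d) m = (\<Sum>k\<in>{k \<in> Poly_Mapping.keys p. mdeg k = d}. if k = m then cf p m else 0)"
    unfolding hcomp_def lookup_sum lookup_single when_def by (intro sum.cong) auto
  also have "\<dots> = (if mdeg m = d then cf p m else 0)" by (simp add: in_keys_iff)
  finally show ?thesis .
qed

lemma mon_deg_mdeg: "mon_deg m = mdeg m"
  unfolding mon_deg_def mdeg_def by (rule sum.mono_neutral_left) (auto simp: in_keys_iff)

lemma mp_hom_eval_hcomp: "mp_hom_eval p d x = mp_eval (hcomp p d) x"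
proof -
  have k: "Poly_Mapping.keys (hcomp p d) = {m \<in> Poly_Mapping.keys p. mon_deg m = d}"
    by (auto simp: in_keys_iff cf_hcomp mon_deg_mdeg split: if_splits)
  show ?thesis unfolding mp_hom_eval_def mp_eval_def k
    by (intro sum.cong) (auto simp: cf_hcomp mon_deg_mdeg)
qed

lemma hcomp_add: "hcomp (p + q) d = hcomp p d + hcomp q d"
  by (rule poly_mapping_eqI) (simp add: cf_hcomp lookup_add)

lemma hcomp_sum: "hcomp (sum f A) d = (\<Sum>a\<in>A. hcomp (f a) d)"
  by (rule poly_mapping_eqI) (simp add: cf_hcomp lookup_sum)

lemma hcomp_poly_over: "is_subring R \<Longrightarrow> p \<in> poly_over R \<Longrightarrow> hcomp p d \<in> poly_over R"
  using subring_0[of R] by (auto simp: poly_over_def cf_hcomp)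

text \<open>As \<open>hcomp f d\<close> is homogeneous, only the part of \<open>q\<close> of degree
  \<open>N - d\<close> reaches degree \<open>N\<close>; \<open>d \<le> N\<close> keeps the
  subtraction exact.\<close>

lemma hcomp_mult:
  assumes "d \<le> N"
  shows "hcomp (q * hcomp f d) N = hcomp q (N - d) * hcomp f d"
proof (rule poly_mapping_eqI)
  fix b
  have k: "Poly_Mapping.keys (hcomp q (N - d)) \<subseteq> Poly_Mapping.keys q"
    by (auto simp: in_keys_iff cf_hcomp split: if_splits)
  have "cf (hcomp q (N - d) * hcomp f d) b = (\<Sum>m\<in>Poly_Mapping.keys q. \<Sum>k\<in>Poly_Mapping.keys (hcomp f d).
      if m + k = b then cf (hcomp q (N - d)) m * cf (hcomp f d) k else 0)"
    unfolding lookup_mult_poly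
    by (rule sum.mono_neutral_left[OF _ k]) (auto simp: in_keys_iff intro!: sum.neutral)
  also have "\<dots> = (\<Sum>m\<in>Poly_Mapping.keys q. \<Sum>k\<in>Poly_Mapping.keys (hcomp f d).
      if mdeg b = N then (if m + k = b then cf q m * cf (hcomp f d) k else 0) else 0)"
  proof (intro sum.cong refl)
    fix m k assume "k \<in> Poly_Mapping.keys (hcomp f d)"
    hence "mdeg k = d" by (auto simp: in_keys_iff cf_hcomp split: if_splits)
    thus "(if m + k = b then cf (hcomp q (N - d)) m * cf (hcomp f d) k else 0) =
      (if mdeg b = N then (if m + k = b then cf q m * cf (hcomp f d) k else 0) else 0)"
      using assms by (auto simp: cf_hcomp mdeg_add)
  qed
  also have "\<dots> = cf (hcomp (q * hcomp f d) N) b"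
    by (auto simp: cf_hcomp[of "q * hcomp f d"] lookup_mult_poly)
  finally show "cf (hcomp (q * hcomp f d) N) b = cf (hcomp q (N - d) * hcomp f d) b" by simp
qed

lemma hcomp_Var_power: "hcomp (Var i ^ N) N = Var i ^ N"
proof -
  have "mdeg (Poly_Mapping.single i N) = N"
    unfolding mdeg_def lookup_single when_def by simp
  thus ?thesis
    by (intro poly_mapping_eqI) (auto simp: cf_hcomp Var_power lookup_single when_def)
qed

definition deg_le :: "'v::finite cmpoly \<Rightarrow> nat \<Rightarrow> bool" where
  "deg_le p d \<longleftrightarrow> (\<forall>m. cf p m \<noteq> 0 \<longrightarrow> mdeg m \<le> d)"

lemma deg_le_hcomp: "deg_le (hcomp p d) d"
  by (auto simp: deg_le_def cf_hcomp)

lemma deg_le_lower: "deg_le p d \<Longrightarrow> d \<ge> 1 \<Longrightarrow> deg_le (p - hcomp p d) (d - 1)"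
  unfolding deg_le_def by (fastforce simp: cf_hcomp lookup_minus split: if_splits)

lemma pm_deg_deg_le: "deg_le (F i) (pm_deg F)"
  unfolding deg_le_def
proof (intro allI impI)
  fix m assume "cf (F i) m \<noteq> 0"
  hence "mdeg m \<le> mp_tdeg (F i)"
    unfolding mp_tdeg_def mon_deg_mdeg[symmetric] by (intro Max_ge) (auto simp: in_keys_iff)
  also have "\<dots> \<le> pm_deg F" unfolding pm_deg_def by (intro Max_ge) auto
  finally show "mdeg m \<le> pm_deg F" .
qed

lemma pm_deg_attained:
  assumes "pm_deg F \<ge> 1"
  shows "\<exists>i. hcomp (F i) (pm_deg F) \<noteq> 0"
proof -
  have "pm_deg F \<in> range (\<lambda>i. mp_tdeg (F i))" unfolding pm_deg_def by (rule Max_in) auto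
  then obtain i where i: "pm_deg F = mp_tdeg (F i)" by auto
  have "mp_tdeg (F i) \<in> insert 0 (mon_deg ` Poly_Mapping.keys (F i))" unfolding mp_tdeg_def by (rule Max_in) auto
  then obtain m where m: "m \<in> Poly_Mapping.keys (F i)" "mdeg m = pm_deg F"
    using i assms by (auto simp: mon_deg_mdeg)
  hence "cf (hcomp (F i) (pm_deg F)) m \<noteq> 0" by (simp add: cf_hcomp in_keys_iff)
  thus ?thesis by (metis lookup_zero)
qed

subsection \<open>Finiteness of the fixed point scheme\<close>

text \<open>A degree filtration of R[x]/J, expressed by congruences in R[x]. Degree is measured in
  the generators \<open>y z\<close>, later the coordinates of all points of a cycle, which may
  satisfy many relations.\<close>

locale filtration =
  fixes R :: "complex set" and J :: "'v::finite cmpoly set" and Z :: "'z set" and y :: "'z \<Rightarrow> 'v cmpoly"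
  assumes R: "is_subring R" and J: "is_ideal (poly_over R) J" and Z: "finite Z"
    and yA: "\<And>z. z \<in> Z \<Longrightarrow> y z \<in> poly_over R"
begin

lemmas PR = poly_over_subring[OF R]
lemmas sp = span_zero[OF Const_hom R] span_add[OF Const_hom R] span_scale[OF Const_hom R]
  span_base[OF Const_hom R] span_sum[OF Const_hom R] span_mono[OF Const_hom R] span_subset[OF Const_hom R]

definition expo :: "nat \<Rightarrow> ('z \<Rightarrow> nat) set" where
  "expo D = {\<alpha>. (\<forall>z. z \<notin> Z \<longrightarrow> \<alpha> z = 0) \<and> sum \<alpha> Z \<le> D}"

definition mon :: "('z \<Rightarrow> nat) \<Rightarrow> 'v cmpoly" where
  "mon \<alpha> = (\<Prod>z\<in>Z. y z ^ \<alpha> z)"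

definition fil :: "nat \<Rightarrow> 'v cmpoly set" where
  "fil D = {g. \<exists>h\<in>span_by Const R (mon ` expo D). g - h \<in> J}"

lemma finite_expo: "finite (expo D)"
proof (rule finite_subset)
  show "expo D \<subseteq> {\<alpha>. \<forall>z. (z \<in> Z \<longrightarrow> \<alpha> z \<in> {..D}) \<and> (z \<notin> Z \<longrightarrow> \<alpha> z = 0)}"
  proof
    fix \<alpha> assume a: "\<alpha> \<in> expo D"
    hence "\<alpha> z \<le> D" if "z \<in> Z" for z
      using member_le_sum[OF that, of \<alpha>] Z by (auto simp: expo_def)
    thus "\<alpha> \<in> {\<alpha>. \<forall>z. (z \<in> Z \<longrightarrow> \<alpha> z \<in> {..D}) \<and> (z \<notin> Z \<longrightarrow> \<alpha> z = 0)}"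
      using a by (auto simp: expo_def)
  qed
qed (rule finite_set_of_finite_funs[OF Z], auto)

lemma finite_mons: "finite (mon ` expo D)"
  using finite_expo by (rule finite_imageI)

lemma mon_add: "mon (\<lambda>z. \<alpha> z + \<beta> z) = mon \<alpha> * mon \<beta>"
  by (simp add: mon_def power_add prod.distrib)

lemma mon_poly_over: "mon \<alpha> \<in> poly_over R"
  unfolding mon_def by (intro subring_prod[OF PR] subring_power[OF PR] yA)

lemma span_poly_over: "h \<in> span_by Const R (mon ` S) \<Longrightarrow> h \<in> poly_over R"
  unfolding span_by_def using mon_poly_over
  by (auto intro!: subring_sum[OF PR] subring_mult[OF PR] poly_over_Const[OF R])

lemma fil_mono: "a \<le> b \<Longrightarrow> fil a \<subseteq> fil b"
proof -
  assume "a \<le> b"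
  hence "mon ` expo a \<subseteq> mon ` expo b" by (auto simp: expo_def)
  from sp(6)[OF finite_mons this] show ?thesis by (auto simp: fil_def)
qed

lemma span_fil: "h \<in> span_by Const R (mon ` expo D) \<Longrightarrow> h \<in> fil D"
  unfolding fil_def using ideal_0[OF J] by (auto intro!: bexI[of _ h])

lemma mon_fil: "\<alpha> \<in> expo D \<Longrightarrow> mon \<alpha> \<in> fil D"
  by (intro span_fil sp(4) finite_mons) auto

lemma fil_cong: "g \<in> fil D \<Longrightarrow> g' - g \<in> J \<Longrightarrow> g' \<in> fil D"
  unfolding fil_def using ideal_diff_trans[OF J PR] by blast

lemma fil_zero: "0 \<in> fil D"
  by (intro span_fil sp(1))

lemma fil_add:
  assumes "g \<in> fil D" "h \<in> fil D"
  shows "g + h \<in> fil D"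
proof -
  obtain g' h' where g: "g' \<in> span_by Const R (mon ` expo D)" "g - g' \<in> J"
    and h: "h' \<in> span_by Const R (mon ` expo D)" "h - h' \<in> J" using assms by (auto simp: fil_def)
  have "(g + h) - (g' + h') = (g - g') + (h - h')" by simp
  also have "\<dots> \<in> J" by (intro ideal_add[OF J] g h)
  finally show ?thesis unfolding fil_def using sp(2)[OF g(1) h(1)] by blast
qed

lemma fil_sum: "(\<And>x. x \<in> X \<Longrightarrow> f x \<in> fil D) \<Longrightarrow> sum f X \<in> fil D"
  by (induction X rule: infinite_finite_induct) (auto intro: fil_zero fil_add)

lemma fil_scale:
  assumes "a \<in> R" "g \<in> fil D"
  shows "Const a * g \<in> fil D"
proof -
  obtain g' where g: "g' \<in> span_by Const R (mon ` expo D)" "g - g' \<in> J" using assms by (auto simp: fil_def)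
  have "Const a * g - Const a * g' = Const a * (g - g')" by (simp add: algebra_simps)
  also have "\<dots> \<in> J" by (intro ideal_mult[OF J] poly_over_Const[OF R] assms g)
  finally show ?thesis unfolding fil_def using sp(3)[OF assms(1) g(1)] by blast
qed

lemma fil_uminus:
  assumes "g \<in> fil D"
  shows "- g \<in> fil D"
proof -
  have "Const (-1) * g \<in> fil D"
    by (intro fil_scale assms subring_uminus[OF R] subring_1[OF R])
  moreover have "Const (-1) * g = - g" by (simp add: Const_def single_uminus)
  ultimately show ?thesis by simp
qed

lemma span_mons_mult:
  assumes "g \<in> span_by Const R (mon ` expo a)" "h \<in> span_by Const R (mon ` expo b)"
  shows "g * h \<in> span_by Const R (mon ` expo (a + b))"
proof -
  obtain c d where c: "g = (\<Sum>x\<in>mon ` expo a. Const (c x) * x)" "\<forall>x. c x \<in> R"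
    and d: "h = (\<Sum>x\<in>mon ` expo b. Const (d x) * x)" "\<forall>x. d x \<in> R" using assms by (auto simp: span_by_def)
  have "x * z \<in> mon ` expo (a + b)" if x: "x \<in> mon ` expo a" and z: "z \<in> mon ` expo b" for x z
  proof -
    obtain \<alpha> \<beta> where "\<alpha> \<in> expo a" "x = mon \<alpha>" "\<beta> \<in> expo b" "z = mon \<beta>" using x z by auto
    thus ?thesis by (intro image_eqI[of _ _ "\<lambda>z. \<alpha> z + \<beta> z"]) (auto simp: mon_add expo_def sum.distrib)
  qed
  hence "Const (c x) * (Const (d z) * (x * z)) \<in> span_by Const R (mon ` expo (a + b))"
    if "x \<in> mon ` expo a" "z \<in> mon ` expo b" for x z
    using that c(2) d(2) by - (rule sp(3), blast, rule sp(3), blast, rule sp(4)[OF finite_mons], blast)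
  hence "(\<Sum>x\<in>mon ` expo a. \<Sum>z\<in>mon ` expo b. Const (c x) * (Const (d z) * (x * z))) \<in> span_by Const R (mon ` expo (a + b))"
    by (intro sp(5))
  thus ?thesis unfolding c(1) d(1) by (simp add: sum_product mult_ac)
qed

lemma fil_poly_over: "J \<subseteq> poly_over R \<Longrightarrow> g \<in> fil D \<Longrightarrow> g \<in> poly_over R"
  unfolding fil_def using span_poly_over subring_add[OF PR] by (fastforce dest: subsetD)

lemma fil_mult:
  assumes "J \<subseteq> poly_over R" and g: "g \<in> fil a" and h: "h \<in> fil b"
  shows "g * h \<in> fil (a + b)"
proof -
  obtain g' where g': "g' \<in> span_by Const R (mon ` expo a)" "g - g' \<in> J" using g by (auto simp: fil_def)
  obtain h' where h': "h' \<in> span_by Const R (mon ` expo b)" "h - h' \<in> J" using h by (auto simp: fil_def)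
  have "g * h - g' * h' \<in> J"
    by (intro ideal_mult_cong[OF J PR] g'(2) h'(2) span_poly_over[OF h'(1)] fil_poly_over[OF assms(1) g])
  thus ?thesis unfolding fil_def using span_mons_mult[OF g'(1) h'(1)] by blast
qed

lemma fil_var: "z \<in> Z \<Longrightarrow> y z \<in> fil 1"
proof -
  assume z: "z \<in> Z"
  have "mon (\<lambda>x. if x = z then 1 else 0) = (\<Prod>x\<in>Z. if x = z then y x else 1)"
    unfolding mon_def by (intro prod.cong) auto
  also have "\<dots> = y z" using z Z by simp
  finally show ?thesis using mon_fil[of "\<lambda>x. if x = z then 1 else 0" 1] z Z by (auto simp: expo_def)
qed

lemma fil_one: "1 \<in> fil 0"
proof -
  have "mon (\<lambda>_. 0) = 1" by (simp add: mon_def)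
  thus ?thesis using mon_fil[of "\<lambda>_. 0" 0] by (simp add: expo_def)
qed

lemma fil_power: "J \<subseteq> poly_over R \<Longrightarrow> g \<in> fil 1 \<Longrightarrow> g ^ n \<in> fil n"
proof (induction n)
  case (Suc n)
  thus ?case using fil_mult[of g 1 "g ^ n" n] by simp
qed (simp add: fil_one)

lemma fil_prod:
  assumes JA: "J \<subseteq> poly_over R" and "\<And>x. x \<in> X \<Longrightarrow> f x \<in> fil (d x)"
  shows "prod f X \<in> fil (sum d X)"
  using assms(2) by (induction X rule: infinite_finite_induct) (auto simp: fil_one intro: fil_mult[OF JA])

lemma fil_peval:
  assumes JA: "J \<subseteq> poly_over R" and q: "q \<in> poly_over R" "deg_le q D" and s: "\<And>i. s i \<in> fil 1"
  shows "peval Const s q \<in> fil D"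
  unfolding peval_def
proof (intro fil_sum fil_scale)
  fix m assume "m \<in> Poly_Mapping.keys q"
  hence "mdeg m \<le> D" using q by (auto simp: deg_le_def in_keys_iff)
  moreover have "(\<Prod>i\<in>UNIV. s i ^ cf m i) \<in> fil (mdeg m)"
    unfolding mdeg_def by (intro fil_prod[OF JA] fil_power[OF JA] s)
  ultimately show "(\<Prod>i\<in>UNIV. s i ^ cf m i) \<in> fil D" using fil_mono by blast
qed (use q in \<open>auto simp: poly_over_def\<close>)

text \<open>A monomial of degree above \<open>card Z * N\<close> contains some
  \<open>y z ^ N\<close>, which can be replaced by something of lower degree; so the filtration
  stops growing.\<close>

lemma fil_stable:
  assumes JA: "J \<subseteq> poly_over R" and N: "N \<ge> 1" and red: "\<And>z. z \<in> Z \<Longrightarrow> y z ^ N \<in> fil (N - 1)"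
  shows "fil D \<subseteq> fil (card Z * N)"
proof (induction D)
  case 0
  show ?case by (rule fil_mono) simp
next
  case (Suc D)
  show ?case
  proof (cases "Suc D \<le> card Z * N")
    case True
    thus ?thesis by (rule fil_mono)
  next
    case False
    have "mon \<alpha> \<in> fil D" if a: "\<alpha> \<in> expo (Suc D)" for \<alpha>
    proof (cases "sum \<alpha> Z \<le> D")
      case True
      thus ?thesis using a by (intro mon_fil) (auto simp: expo_def)
    next
      case large: False
      have "\<exists>z\<in>Z. \<alpha> z \<ge> N"
      proof (rule ccontr)
        assume "\<not> ?thesis"
        hence "sum \<alpha> Z \<le> (\<Sum>z\<in>Z. N)" by (intro sum_mono) (auto simp: not_le less_imp_le)
        thus False using False large by simp
      qed
      then obtain z where z: "z \<in> Z" "\<alpha> z \<ge> N" by blast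
      define \<beta> where "\<beta> = \<alpha>(z := \<alpha> z - N)"
      have sb: "sum \<alpha> Z = N + sum \<beta> Z"
        using z Z by (simp add: \<beta>_def sum.remove[of Z z])
      have "mon \<alpha> = y z ^ \<alpha> z * (\<Prod>x\<in>Z-{z}. y x ^ \<alpha> x)"
        unfolding mon_def using z Z by (simp add: prod.remove)
      also have "y z ^ \<alpha> z = y z ^ N * y z ^ \<beta> z" using z by (simp add: \<beta>_def flip: power_add)
      also have "(\<Prod>x\<in>Z-{z}. y x ^ \<alpha> x) = (\<Prod>x\<in>Z-{z}. y x ^ \<beta> x)"
        by (intro prod.cong) (auto simp: \<beta>_def)
      also have "y z ^ N * y z ^ \<beta> z * (\<Prod>x\<in>Z-{z}. y x ^ \<beta> x) = y z ^ N * mon \<beta>"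
        unfolding mon_def using z Z by (simp add: prod.remove mult.assoc)
      finally have e: "mon \<alpha> = y z ^ N * mon \<beta>" .
      have "\<beta> \<in> expo (Suc D - N)" using a sb z by (auto simp: expo_def \<beta>_def)
      hence "mon \<alpha> \<in> fil ((N - 1) + (Suc D - N))"
        unfolding e by (intro fil_mult[OF JA] red z mon_fil)
      moreover have "(N - 1) + (Suc D - N) = D" using N sb a by (auto simp: expo_def)
      ultimately show ?thesis by simp
    qed
    hence "h \<in> fil D" if "h \<in> span_by Const R (mon ` expo (Suc D))" for h
      using that unfolding span_by_def by (auto intro!: fil_sum fil_scale)
    hence "fil (Suc D) \<subseteq> fil D" using fil_cong by (auto simp: fil_def[of "Suc D"])
    thus ?thesis using Suc by blast
  qed
qed

end

section \<open>Iterates and the ideal of fixed points\<close>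

primrec iter_poly :: "'n::finite polymap \<Rightarrow> nat \<Rightarrow> 'n polymap" where
  "iter_poly F 0 = Var"
| "iter_poly F (Suc j) = (\<lambda>i. peval Const (iter_poly F j) (F i))"

lemma mp_eval_iter_poly: "mp_eval (iter_poly F j i) x = (pm_apply F ^^ j) x i"
proof (induction j arbitrary: i)
  case (Suc j)
  have "mp_eval (iter_poly F (Suc j) i) x = mp_eval (F i) (\<lambda>i. mp_eval (iter_poly F j i) x)"
    by (simp add: mp_eval_subst)
  also have "(\<lambda>i. mp_eval (iter_poly F j i) x) = (pm_apply F ^^ j) x" using Suc by auto
  also have "mp_eval (F i) \<dots> = (pm_apply F ^^ Suc j) x i"
    unfolding funpow.simps(2) comp_apply by (simp add: pm_apply_def[of F "(pm_apply F ^^ j) x"])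
  finally show ?case .
qed (simp add: mp_eval_Var)

lemma iter_poly_inverse:
  assumes "pm_inverse F G"
  shows "peval Const (iter_poly F (Suc j)) (G i) = iter_poly F j i"
proof (rule poly_eqI_eval)
  fix x
  have "mp_eval (peval Const (iter_poly F (Suc j)) (G i)) x = mp_eval (G i) (\<lambda>l. mp_eval (iter_poly F (Suc j) l) x)"
    by (rule mp_eval_subst)
  also have "(\<lambda>l. mp_eval (iter_poly F (Suc j) l) x) = (pm_apply F ^^ Suc j) x"
    by (rule ext) (rule mp_eval_iter_poly)
  also have "mp_eval (G i) \<dots> = pm_apply G (pm_apply F ((pm_apply F ^^ j) x)) i" by (simp add: pm_apply_def)
  also have "\<dots> = mp_eval (iter_poly F j i) x" using assms by (simp add: pm_inverse_def mp_eval_iter_poly)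
  finally show "mp_eval (peval Const (iter_poly F (Suc j)) (G i)) x = mp_eval (iter_poly F j i) x" .
qed

lemma iter_poly_over:
  assumes "is_subring R" "\<And>i. F i \<in> poly_over R"
  shows "iter_poly F j i \<in> poly_over R"
  by (induction j arbitrary: i) (auto intro: poly_over_Var poly_over_peval assms)

lemma gen_ideal_subset:
  assumes "is_subring A" "\<And>k. k \<in> X \<Longrightarrow> f k \<in> A"
  shows "gen_ideal A X f \<subseteq> A"
  unfolding gen_ideal_def using assms by (auto intro!: subring_sum subring_mult)

definition fix_ideal :: "complex set \<Rightarrow> 'n::finite polymap \<Rightarrow> nat \<Rightarrow> 'n cmpoly set" where
  "fix_ideal R F k = gen_ideal (poly_over R) UNIV (\<lambda>i. iter_poly F k i - Var i)"

text \<open>Modulo the fixed point ideal the coordinates of the whole cycle \<open>x, F x, \<dots>, F\<^bsup>k-1\<^esup> x\<close> satisfy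
  \<open>y\<^sub>j\<^sub>+\<^sub>1 = F y\<^sub>j\<close> and \<open>y\<^sub>j\<^sub>-\<^sub>1 = G y\<^sub>j\<close>. Substituting these relations for the leading forms in
  the certificate for \<open>y\<^sub>j\<^sub>i\<^sup>N\<close> lowers its degree.\<close>
lemma fixed_points_finite:
  fixes F G :: "'n::finite polymap"
  assumes R: "is_subring R" and inv: "pm_inverse F G" and k: "k > 0"
    and FR: "\<And>i. F i \<in> poly_over R" and GR: "\<And>i. G i \<in> poly_over R"
    and d: "\<And>i. deg_le (F i) d" "d \<ge> 2" "d \<le> N" and e: "\<And>i. deg_le (G i) e" "e \<ge> 2" "e \<le> N"
    and a: "\<And>i l. a i l \<in> poly_over R" "\<And>i l. deg_le (a i l) (N - d)"
    and b: "\<And>i l. b i l \<in> poly_over R" "\<And>i l. deg_le (b i l) (N - e)"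
    and cert: "\<And>i. Var i ^ N = (\<Sum>l\<in>UNIV. a i l * hcomp (F l) d) + (\<Sum>l\<in>UNIV. b i l * hcomp (G l) e)"
  shows "\<exists>E. finite E \<and> E \<subseteq> poly_over R \<and> (\<forall>g\<in>poly_over R. \<exists>h\<in>span_by Const R E. g - h \<in> fix_ideal R F k)"
proof -
  let ?Y = "\<lambda>z. iter_poly F (fst z) (snd z)"
  let ?Z = "{..<k} \<times> (UNIV :: 'n set)"
  let ?J = "fix_ideal R F k"
  note PR = poly_over_subring[OF R]
  have itR: "iter_poly F j i \<in> poly_over R" for j i by (rule iter_poly_over[OF R FR])
  have J: "is_ideal (poly_over R) ?J" unfolding fix_ideal_def by (rule gen_ideal_ideal[OF PR])
  have JA: "?J \<subseteq> poly_over R" unfolding fix_ideal_def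
    by (intro gen_ideal_subset[OF PR] subring_diff[OF PR] itR poly_over_Var[OF R])
  interpret filtration R ?J ?Z ?Y
    by unfold_locales (use R J itR in auto)
  have rel: "iter_poly F k i - Var i \<in> ?J" for i
    unfolding fix_ideal_def by (rule gen_ideal_base[OF PR]) auto
  have it: "iter_poly F j i \<in> fil 1" if "j < k" for j i using fil_var[of "(j, i)"] that by auto
  have V1: "Var i \<in> fil 1" for i using it[of 0] k by simp
  have nxt: "iter_poly F (Suc j) i \<in> fil 1" if "j < k" for j i
  proof (cases "Suc j = k")
    case True
    show ?thesis unfolding True by (rule fil_cong[OF V1 rel])
  qed (use that it[of "Suc j"] in auto)
  \<comment> \<open>Only \<open>j = 0\<close> has no earlier iterate. There the cycle closes: modulo
    the ideal \<open>Var\<close> is the \<open>k\<close>-th iterate, and \<open>G\<close> takes that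
    to the iterate \<open>k - 1\<close>.\<close>
  have prev: "peval Const (iter_poly F j) (G i) \<in> fil 1" if j: "j < k" for j i
  proof (cases j)
    case (Suc j')
    thus ?thesis using it[of j'] j by (simp only: iter_poly_inverse[OF inv])
  next
    case 0
    obtain k' where k': "k = Suc k'" using k by (cases k) auto
    have "peval Const (iter_poly F k) (G i) - peval Const Var (G i) \<in> ?J"
      by (intro peval_cong_ideal[OF J PR] itR poly_over_Var[OF R] rel poly_over_Const[OF R])
        (use GR in \<open>auto simp: poly_over_def\<close>)
    hence "- (peval Const (iter_poly F k) (G i) - peval Const Var (G i)) \<in> ?J"
      by (rule ideal_uminus[OF J PR])
    hence "peval Const Var (G i) - iter_poly F k' i \<in> ?J"
      unfolding k' iter_poly_inverse[OF inv] by simp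
    thus ?thesis using fil_cong[OF it[of k' i]] k' 0 by simp
  qed
  \<comment> \<open>\<open>H\<close> at the \<open>j\<close>-th point is to be a coordinate of a
    neighbour in the cycle, of degree 1, which is at most \<open>c - 1\<close> since
    \<open>c \<ge> 2\<close>. The terms of \<open>H\<close> below the leading form also contribute
    at most \<open>c - 1\<close>. So the value of the leading form drops from degree
    \<open>c\<close> to \<open>c - 1\<close>.\<close>
  have top: "peval Const (iter_poly F j) (hcomp H c) \<in> fil (c - 1)"
    if "peval Const (iter_poly F j) H \<in> fil 1" "deg_le H c" "c \<ge> 2" "j < k" "H \<in> poly_over R" for H :: "'n cmpoly" and c j
  proof -
    note h = peval_hom[OF Const_hom, of "iter_poly F j"]
    have "peval Const (iter_poly F j) (H - hcomp H c) \<in> fil (c - 1)"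
      using that by (intro fil_peval[OF JA] it deg_le_lower subring_diff[OF PR] hcomp_poly_over[OF R]) auto
    moreover have "peval Const (iter_poly F j) H \<in> fil (c - 1)"
    proof (rule subsetD[OF fil_mono that(1)])
      show "1 \<le> c - 1" using that(3) by simp
    qed
    ultimately have "peval Const (iter_poly F j) H + - peval Const (iter_poly F j) (H - hcomp H c) \<in> fil (c - 1)"
      by (intro fil_add fil_uminus)
    thus ?thesis by (simp add: hom_diff[OF h])
  qed
  have "?Y z ^ N \<in> fil (N - 1)" if zZ: "z \<in> ?Z" for z
  proof -
    obtain j i where z: "z = (j, i)" "j < k" using zZ by auto
    note h = peval_hom[OF Const_hom, of "iter_poly F j"]
    have "?Y z ^ N = peval Const (iter_poly F j) (Var i ^ N)"
      by (simp add: z hom_power[OF h] peval_Var[OF Const_hom])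
    also have "\<dots> = (\<Sum>l\<in>UNIV. peval Const (iter_poly F j) (a i l) * peval Const (iter_poly F j) (hcomp (F l) d))
        + (\<Sum>l\<in>UNIV. peval Const (iter_poly F j) (b i l) * peval Const (iter_poly F j) (hcomp (G l) e))"
      unfolding cert by (simp add: hom_add[OF h] hom_sum[OF h] hom_mult[OF h])
    also have "\<dots> \<in> fil (N - 1)"
    proof (intro fil_add fil_sum)
      fix l
      have nx: "peval Const (iter_poly F j) (F l) \<in> fil 1" using nxt[OF z(2), of l] by simp
      have "peval Const (iter_poly F j) (a i l) * peval Const (iter_poly F j) (hcomp (F l) d) \<in> fil ((N - d) + (d - 1))"
        by (rule fil_mult[OF JA fil_peval[OF JA a it[OF z(2)]] top[OF nx d(1,2) z(2) FR]])
      thus "peval Const (iter_poly F j) (a i l) * peval Const (iter_poly F j) (hcomp (F l) d) \<in> fil (N - 1)"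
        using d by simp
      have "peval Const (iter_poly F j) (b i l) * peval Const (iter_poly F j) (hcomp (G l) e) \<in> fil ((N - e) + (e - 1))"
        by (rule fil_mult[OF JA fil_peval[OF JA b it[OF z(2)]] top[OF prev[OF z(2)] e(1,2) z(2) GR]])
      thus "peval Const (iter_poly F j) (b i l) * peval Const (iter_poly F j) (hcomp (G l) e) \<in> fil (N - 1)"
        using e by simp
    qed
    finally show ?thesis .
  qed
  hence stable: "fil D \<subseteq> fil (card ?Z * N)" for D using d by (intro fil_stable[OF JA]) auto
  have all: "g \<in> fil (card ?Z * N)" if "g \<in> poly_over R" for g
  proof -
    have "mdeg m \<le> (\<Sum>m\<in>Poly_Mapping.keys g. mdeg m)" if "m \<in> Poly_Mapping.keys g" for m
      using that by (intro member_le_sum) auto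
    hence "deg_le g (\<Sum>m\<in>Poly_Mapping.keys g. mdeg m)" by (simp add: deg_le_def in_keys_iff)
    hence "peval Const Var g \<in> fil (\<Sum>m\<in>Poly_Mapping.keys g. mdeg m)"
      by (intro fil_peval[OF JA] that V1)
    thus ?thesis using stable by (auto simp: peval_id)
  qed
  show ?thesis
  proof (intro exI[of _ "mon ` expo (card ?Z * N)"] conjI ballI)
    show "finite (mon ` expo (card ?Z * N))" by (rule finite_mons)
    show "mon ` expo (card ?Z * N) \<subseteq> poly_over R" using mon_poly_over by auto
    fix g :: "'n cmpoly" assume "g \<in> poly_over R"
    from all[OF this] show "\<exists>h\<in>span_by Const R (mon ` expo (card ?Z * N)). g - h \<in> ?J"
      by (simp add: fil_def)
  qed
qed

subsection \<open>Density of periodic points\<close>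

lemma number_field_subfield: "number_field K \<Longrightarrow> is_subfield K"
  by (auto simp: number_field_def is_subfield_def is_subring_def)

lemma number_field_algebraic:
  assumes "number_field K" "z \<in> K"
  shows "algebraic z"
proof -
  obtain B where B: "finite B" "\<And>x. x \<in> K \<Longrightarrow> \<exists>c. (\<forall>b\<in>B. c b \<in> \<rat>) \<and> x = (\<Sum>b\<in>B. c b * b)"
    using assms(1) unfolding number_field_def by blast
  have Q: "is_subring (\<rat> :: complex set)" by (simp add: is_subring_def)
  have K: "is_subring K" using number_field_subfield[OF assms(1)] by (simp add: is_subfield_def)
  have "x \<in> span_by (\<lambda>c. c) \<rat> B" if x: "x \<in> K" for x
  proof -
    obtain c where c: "\<forall>b\<in>B. c b \<in> \<rat>" "x = (\<Sum>b\<in>B. c b * b)" using B(2)[OF x] by blast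
    have "x = (\<Sum>b\<in>B. (if b \<in> B then c b else 0) * b)" unfolding c(2) by (intro sum.cong) auto
    moreover have "(\<Sum>b\<in>B. (if b \<in> B then c b else 0) * b) \<in> span_by (\<lambda>c. c) \<rat> B"
      using c(1) by (intro span_I[of "\<lambda>b. if b \<in> B then c b else 0"]) auto
    ultimately show ?thesis by simp
  qed
  thus ?thesis using subring_power[OF K assms(2)] by (intro algebraic_of_span[OF Q _ B(1)]) auto
qed

lemma frac_subfield:
  assumes R: "is_subring (R :: complex set)"
  shows "is_subfield {a / b | a b. a \<in> R \<and> b \<in> R \<and> b \<noteq> 0}" (is "is_subfield ?L")
proof -
  have I: "a / b \<in> ?L" if "a \<in> R" "b \<in> R" "b \<noteq> 0" for a b using that by blast
  have one: "1 \<in> ?L" using I[OF subring_1[OF R] subring_1[OF R]] by simp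
  have dm: "x - y \<in> ?L" "x * y \<in> ?L" if x: "x \<in> ?L" and y: "y \<in> ?L" for x y
  proof -
    obtain a b c d where e: "x = a / b" "y = c / d" and m: "a \<in> R" "b \<in> R" "c \<in> R" "d \<in> R" "b \<noteq> 0" "d \<noteq> 0"
      using x y by auto
    have "x - y = (a * d - c * b) / (b * d)" using m by (simp add: e field_simps)
    moreover have "(a * d - c * b) / (b * d) \<in> ?L"
      using m by (intro I subring_diff[OF R] subring_mult[OF R]) auto
    ultimately show "x - y \<in> ?L" by simp
    have "x * y = (a * c) / (b * d)" by (simp add: e)
    moreover have "(a * c) / (b * d) \<in> ?L" using m by (intro I subring_mult[OF R]) auto
    ultimately show "x * y \<in> ?L" by simp
  qed
  have iv: "inverse x \<in> ?L" if x: "x \<in> ?L" for x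
  proof -
    obtain a b where e: "x = a / b" and m: "a \<in> R" "b \<in> R" "b \<noteq> 0" using x by auto
    show ?thesis
    proof (cases "a = 0")
      case True
      thus ?thesis using I[OF subring_0[OF R] subring_1[OF R]] e by simp
    next
      case False
      thus ?thesis using I[OF m(2,1)] e by (simp add: inverse_eq_divide)
    qed
  qed
  show ?thesis unfolding is_subfield_def is_subring_def by (intro conjI ballI one dm iv)
qed

lemma common_denominator:
  assumes R: "is_subring (R :: complex set)" and "finite V" "\<And>v. v \<in> V \<Longrightarrow> \<exists>a\<in>R. \<exists>b\<in>R. b \<noteq> 0 \<and> v = a / b"
  shows "\<exists>b\<in>R. b \<noteq> 0 \<and> (\<forall>v\<in>V. b * v \<in> R)"
  using assms(2,3)
proof (induction V rule: finite_induct)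
  case empty
  thus ?case using subring_1[OF R] by (intro bexI[of _ 1]) auto
next
  case (insert v V)
  then obtain b where b: "b \<in> R" "b \<noteq> 0" "\<forall>v\<in>V. b * v \<in> R" by auto
  obtain a c where v: "a \<in> R" "c \<in> R" "c \<noteq> 0" "v = a / c" using insert.prems by blast
  have "(c * b) * v = b * a" using v by simp
  moreover have "(c * b) * w \<in> R" if "w \<in> V" for w
    using subring_mult[OF R v(2) b(3)[rule_format, OF that]] by (simp add: mult.assoc)
  ultimately show ?case using v b subring_mult[OF R]
    by (intro bexI[of _ "c * b"]) auto
qed

lemma poly_over_iff:
  assumes "0 \<in> R"
  shows "q \<in> poly_over R \<longleftrightarrow> cf q ` Poly_Mapping.keys q \<subseteq> R"
proof
  assume "cf q ` Poly_Mapping.keys q \<subseteq> R"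
  hence "cf q m \<in> R" for m using assms by (cases "cf q m = 0") (auto simp: in_keys_iff)
  thus "q \<in> poly_over R" by (simp add: poly_over_def)
qed (auto simp: poly_over_def)

text \<open>After the translation \<open>\<sigma>\<close> of \<open>x\<^sub>0\<close> to the origin, \<open>h\<close> is a unit modulo every step of the filtration,
  so that \<open>p\<^sup>s\<close> lies in \<open>J\<close> up to arbitrarily small errors.\<close>
lemma residual_point_lifts:
  fixes f :: "'v::finite \<Rightarrow> 'v cmpoly"
  assumes p: "prime p" and good: "good_ring p R"
    and f: "\<And>i. f i \<in> poly_over R" and x0: "\<And>i. x0 i \<in> R"
    and fx0: "\<And>i. \<exists>r\<in>R. mp_eval (f i) x0 = of_nat p * r"
    and E: "finite E" "E \<subseteq> poly_over R"
      "\<And>g. g \<in> poly_over R \<Longrightarrow> \<exists>y\<in>span_by Const (Zloc p) E. g - y \<in> gen_ideal (poly_over R) UNIV f"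
    and h: "h \<in> poly_over R" "mp_eval h x0 \<noteq> 0" "inverse (mp_eval h x0) \<in> R"
    and hm: "Const (of_nat p ^ s) * h ^ m \<in> gen_ideal (poly_over R) UNIV f"
  shows False
proof -
  note R = good_subring[OF p good]
  note PR = poly_over_subring[OF R]
  let ?A = "poly_over R :: 'v cmpoly set"
  define \<sigma> where "\<sigma> = peval Const (\<lambda>i. Var i + Const (x0 i) :: 'v cmpoly)"
  define \<sigma>' where "\<sigma>' = peval Const (\<lambda>i. Var i - Const (x0 i) :: 'v cmpoly)"
  have hom: "ring_hom_fun \<sigma>" unfolding \<sigma>_def by (rule peval_hom[OF Const_hom])
  have \<sigma>A: "\<sigma> g \<in> ?A" if "g \<in> ?A" for g
    unfolding \<sigma>_def by (intro poly_over_peval[OF R that] subring_add[OF PR] poly_over_Var[OF R] poly_over_Const[OF R x0])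
  have \<sigma>'A: "\<sigma>' g \<in> ?A" if "g \<in> ?A" for g
    unfolding \<sigma>'_def by (intro poly_over_peval[OF R that] subring_diff[OF PR] poly_over_Var[OF R] poly_over_Const[OF R x0])
  have inv: "\<sigma> (\<sigma>' g) = g" for g
    unfolding \<sigma>_def \<sigma>'_def
    by (rule poly_eqI_eval) (simp add: mp_eval_subst mp_eval_add mp_eval_diff mp_eval_Var mp_eval_Const)
  have \<sigma>C: "\<sigma> (Const a) = Const a" for a unfolding \<sigma>_def by (rule peval_Const[OF Const_hom])
  have \<sigma>0: "cf (\<sigma> g) 0 = mp_eval g x0" for g
    unfolding mp_eval_at_zero[symmetric] \<sigma>_def
    by (simp add: mp_eval_subst mp_eval_add mp_eval_Var mp_eval_Const)
  define f' where "f' i = \<sigma> (f i)" for i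
  define J where "J = gen_ideal ?A UNIV f'"
  have J: "is_ideal ?A J" unfolding J_def by (rule gen_ideal_ideal[OF PR])
  have \<sigma>J: "\<sigma> g \<in> J" if g: "g \<in> gen_ideal ?A UNIV f" for g
  proof -
    obtain q where q: "g = (\<Sum>k\<in>UNIV. q k * f k)" "\<forall>k. q k \<in> ?A" using g by (auto simp: gen_ideal_def)
    have "\<sigma> g = (\<Sum>k\<in>UNIV. \<sigma> (q k) * f' k)" unfolding q(1) by (simp add: hom_sum[OF hom] hom_mult[OF hom] f'_def)
    thus ?thesis unfolding J_def using gen_ideal_I[of "\<lambda>k. \<sigma> (q k)" ?A f' UNIV] \<sigma>A q(2) by simp
  qed
  define P where "P = (Const (of_nat p ^ s) :: 'v cmpoly)"
  have PA: "P \<in> ?A" unfolding P_def by (intro poly_over_Const[OF R] subring_power[OF R] subring_of_nat[OF R])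
  define c where "c = mp_eval h x0"
  \<comment> \<open>Normalised to constant term 1, so that \<open>v = 1 - w\<close> lies in (p, x_1,
    ..., x_n) and its powers become small.\<close>
  define w where "w = Const (inverse c ^ m) * \<sigma> h ^ m"
  have wA: "w \<in> ?A" unfolding w_def c_def
    by (intro subring_mult[OF PR] poly_over_Const[OF R] subring_power[OF R] subring_power[OF PR] \<sigma>A h)
  have "P * w = Const (inverse c ^ m) * \<sigma> (Const (of_nat p ^ s) * h ^ m)"
    by (simp add: w_def P_def hom_mult[OF hom] hom_power[OF hom] \<sigma>C mult_ac)
  also have "\<dots> \<in> J" unfolding c_def
    by (intro ideal_mult[OF J] \<sigma>J hm poly_over_Const[OF R] subring_power[OF R] h)
  finally have Pw: "P * w \<in> J" .
  define v where "v = 1 - w"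
  have vA: "v \<in> ?A" unfolding v_def by (intro subring_diff[OF PR] subring_1[OF PR] wA)
  have "cf w 0 = 1"
    unfolding w_def cf_Const_mult using \<sigma>0[of "h ^ m"] h(2)
    by (simp add: hom_power[OF hom] mp_eval_power c_def flip: power_mult_distrib)
  hence "cf v 0 = of_nat p * 0" by (simp add: v_def lookup_minus lookup_one)
  hence v1: "v \<in> val_ideal R p 1" by (intro val_ideal_1[OF R vA subring_0[OF R]])
  \<comment> \<open>Representatives modulo \<open>p ^ s\<close> of the combinations of
    \<open>E\<close>. The set does not depend on \<open>t\<close>, as
    \<open>no_finite_intersection\<close> demands one set for all \<open>t\<close>.\<close>
  define E' where "E' = (\<lambda>n. \<Sum>e\<in>E. Const (of_nat (n e)) * \<sigma> e) ` PiE E (\<lambda>_. {..<p ^ s})"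
  show False
  proof (rule no_finite_intersection[OF p good, of f' E'])
    show f'A: "f' k \<in> ?A" for k unfolding f'_def by (intro \<sigma>A f)
    show "f' k \<in> val_ideal R p 1" for k
    proof -
      obtain r where "r \<in> R" "mp_eval (f k) x0 = of_nat p * r" using fx0 by blast
      thus ?thesis using \<sigma>0[of "f k"] by (intro val_ideal_1[OF R f'A, of r]) (auto simp: f'_def)
    qed
    show "finite E'" unfolding E'_def by (intro finite_imageI finite_PiE E) auto
    show "E' \<subseteq> ?A" unfolding E'_def using E(2)
      by (auto intro!: subring_sum[OF PR] subring_mult[OF PR] poly_over_Const[OF R] subring_of_nat[OF R] \<sigma>A)
    fix t a assume a: "a \<in> ?A"
    obtain y where y: "y \<in> span_by Const (Zloc p) E" "\<sigma>' a - y \<in> gen_ideal ?A UNIV f"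
      using E(3)[OF \<sigma>'A[OF a]] by blast
    obtain n z where n: "n \<in> PiE E (\<lambda>_. {..<p ^ s})" "z \<in> span_by Const (Zloc p) E"
      "y = (\<Sum>e\<in>E. Const (of_nat (n e)) * e) + Const (of_nat p ^ s) * z"
      using span_residue[OF p Const_hom y(1), of s] by blast
    have zA: "z \<in> ?A"
    proof -
      obtain l where l: "z = (\<Sum>b\<in>E. Const (l b) * b)" "\<forall>b. l b \<in> Zloc p" using n(2) by (auto simp: span_by_def)
      have "Const (l b) * b \<in> ?A" if "b \<in> E" for b
        using that l(2) E(2) good_Zloc_subset[OF p good]
        by (intro subring_mult[OF PR] poly_over_Const[OF R]) auto
      thus ?thesis unfolding l(1) by (rule subring_sum[OF PR])
    qed
    define x where "x = (\<Sum>e\<in>E. Const (of_nat (n e)) * \<sigma> e)"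
    define S where "S = (\<Sum>i<t. v ^ i)"
    \<comment> \<open>The truncated geometric series \<open>S\<close> inverts \<open>w\<close> up to
      \<open>v ^ t\<close>. Hence \<open>P * \<sigma> z\<close> is a multiple of
      \<open>P * w\<close>, which lies in \<open>J\<close>, up to an error in step \<open>t\<close>
      of the filtration.\<close>
    define j where "j = \<sigma> (\<sigma>' a - y) + S * \<sigma> z * (P * w)"
    have SA: "S \<in> ?A" unfolding S_def by (intro subring_sum[OF PR] subring_power[OF PR] vA)
    have "1 - v ^ t = w * S" unfolding S_def one_diff_power_eq by (simp add: v_def)
    hence vt: "w * S = 1 - v ^ t" by simp
    have "\<sigma> y = x + P * \<sigma> z"
      by (simp add: n(3) x_def P_def hom_add[OF hom] hom_sum[OF hom] hom_mult[OF hom] \<sigma>C)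
    hence "a - x - j = P * \<sigma> z - (w * S) * (P * \<sigma> z)"
      by (simp add: j_def hom_diff[OF hom] inv algebra_simps)
    also have "\<dots> = (P * \<sigma> z) * v ^ t" unfolding vt by (simp add: algebra_simps)
    also have "\<dots> \<in> val_ideal R p t"
      by (intro ideal_mult[OF val_ideal_ideal[OF R]] val_ideal_power[OF R v1] subring_mult[OF PR] PA \<sigma>A zA)
    finally have "a - x - j \<in> val_ideal R p t" .
    moreover have "x \<in> E'" unfolding x_def E'_def using n(1) by blast
    moreover have "j \<in> J" unfolding j_def
      by (intro ideal_add[OF J] \<sigma>J y ideal_mult[OF J] Pw subring_mult[OF PR] SA \<sigma>A zA)
    ultimately show "\<exists>x\<in>E'. \<exists>j\<in>gen_ideal ?A UNIV f'. a - x - j \<in> val_ideal R p t"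
      unfolding J_def by blast
  qed
qed

text \<open>Passes from scalars in \<open>R\<close> to scalars in Z_(p), where residues modulo
  \<open>p ^ s\<close> are represented by the natural numbers below \<open>p ^ s\<close>.\<close>

lemma span_by_good:
  assumes p: "prime p" and good: "good_ring p R" and E: "finite E" "E \<subseteq> poly_over R"
  shows "\<exists>E'. finite E' \<and> E' \<subseteq> poly_over R \<and> span_by Const R E \<subseteq> span_by Const (Zloc p) (E' :: 'v::finite cmpoly set)"
proof -
  note R = good_subring[OF p good] and L = Zloc_subring[OF p]
  note PR = poly_over_subring[OF R]
  obtain B where B: "finite B" "B \<subseteq> R" "R \<subseteq> span_by (\<lambda>c. c) (Zloc p) B" using good_basis[OF p good] by blast
  define E' where "E' = (\<lambda>(b, e). Const b * e) ` (B \<times> E)"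
  have fE': "finite E'" unfolding E'_def using B E by auto
  have "span_by Const R E \<subseteq> span_by Const (Zloc p) E'"
  proof
    fix x assume "x \<in> span_by Const R E"
    then obtain c where c: "x = (\<Sum>e\<in>E. Const (c e) * e)" "\<forall>e. c e \<in> R" by (auto simp: span_by_def)
    have "Const (c y) * y \<in> span_by Const (Zloc p) E'" if y: "y \<in> E" for y
    proof -
      have "c y \<in> span_by (\<lambda>c. c) (Zloc p) B" using c B by auto
      then obtain d where d: "c y = (\<Sum>b\<in>B. d b * b)" "\<forall>b. d b \<in> Zloc p" by (auto simp: span_by_def)
      have "(\<Sum>b\<in>B. Const (d b) * (Const b * y)) \<in> span_by Const (Zloc p) E'"
        using d y by (intro span_sum[OF Const_hom L] span_scale[OF Const_hom L] span_base[OF Const_hom L fE'])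
          (auto simp: E'_def)
      thus ?thesis by (simp add: d hom_sum[OF Const_hom] hom_mult[OF Const_hom] sum_distrib_right mult.assoc)
    qed
    thus "x \<in> span_by Const (Zloc p) E'" unfolding c(1) by (intro span_sum[OF Const_hom L])
  qed
  moreover have "E' \<subseteq> poly_over R" unfolding E'_def using B E
    by (auto intro!: subring_mult[OF PR] poly_over_Const[OF R])
  ultimately show ?thesis using fE' by blast
qed

text \<open>The multipliers \<open>q k\<close> have complex coefficients. They can be replaced by
  multipliers over the fraction field of \<open>R\<close>, whose common denominator divides a power
  of \<open>p\<close> in \<open>R\<close>.\<close>

lemma clear_denominators:
  fixes f :: "'k::finite \<Rightarrow> 'v cmpoly"
  assumes p: "prime p" and good: "good_ring p R" and f: "\<And>k. f k \<in> poly_over R"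
    and g: "g \<in> poly_over R" "g = (\<Sum>k\<in>UNIV. q k * f k)"
  shows "\<exists>s. Const (of_nat p ^ s) * g \<in> gen_ideal (poly_over R) UNIV f"
proof -
  note R = good_subring[OF p good]
  note PR = poly_over_subring[OF R]
  define L where "L = {a / b | a b. a \<in> R \<and> b \<in> R \<and> b \<noteq> 0}"
  have L: "is_subfield L" unfolding L_def by (rule frac_subfield[OF R])
  have RL: "poly_over R \<subseteq> poly_over L"
  proof -
    have "a = a / 1" for a :: complex by simp
    hence "R \<subseteq> L" unfolding L_def using subring_1[OF R] by force
    thus ?thesis by (auto simp: poly_over_def)
  qed
  obtain q' where q': "\<And>k. q' k \<in> poly_over L" "g = (\<Sum>k\<in>UNIV. q' k * f k)"
    using ideal_descent[OF L, of f g q] RL f g by auto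
  define V where "V = (\<Union>k. cf (q' k) ` Poly_Mapping.keys (q' k))"
  have "finite V" unfolding V_def by auto
  moreover have "\<exists>a\<in>R. \<exists>b\<in>R. b \<noteq> 0 \<and> v = a / b" if v: "v \<in> V" for v
  proof -
    have "v \<in> L" using v q'(1) by (auto simp: V_def poly_over_def)
    thus ?thesis by (auto simp: L_def)
  qed
  ultimately obtain b where b: "b \<in> R" "b \<noteq> 0" "\<forall>v\<in>V. b * v \<in> R" using common_denominator[OF R] by metis
  obtain s r where r: "r \<in> R" "b * r = of_nat p ^ s" using good_dvd_prime_power[OF p good b(1,2)] by blast
  have "Const b * q' k \<in> poly_over R" for k
    unfolding poly_over_def
  proof (intro CollectI allI)
    fix m
    show "cf (Const b * q' k) m \<in> R"
      using b(3) subring_0[OF R] by (cases "cf (q' k) m = 0") (auto simp: cf_Const_mult V_def in_keys_iff)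
  qed
  hence "(\<Sum>k\<in>UNIV. (Const r * (Const b * q' k)) * f k) \<in> gen_ideal (poly_over R) UNIV f"
    by (intro gen_ideal_I[of "\<lambda>k. Const r * (Const b * q' k)"])
      (rule subring_mult[OF PR poly_over_Const[OF R r(1)]])
  also have "(\<Sum>k\<in>UNIV. (Const r * (Const b * q' k)) * f k) = Const (of_nat p ^ s) * g"
    unfolding q'(2) r(2)[symmetric] by (simp add: hom_mult[OF Const_hom] sum_distrib_left mult_ac)
  finally show ?thesis by blast
qed

text \<open>By pigeonhole two points of the orbit agree modulo \<open>p\<close>. As \<open>G\<close>
  has coefficients in \<open>R\<close> too, it can be applied to this congruence, which moves it
  back to the starting point.\<close>

lemma periodic_mod_prime:
  fixes F G :: "'n::finite polymap"
  assumes p: "prime p" and good: "good_ring p R" and inv: "pm_inverse F G"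
    and FR: "\<And>i. F i \<in> poly_over R" and GR: "\<And>i. G i \<in> poly_over R" and x: "\<And>i. x i \<in> R"
  shows "\<exists>k>0. \<forall>i. \<exists>r\<in>R. (pm_apply F ^^ k) x i - x i = of_nat p * r"
proof -
  note R = good_subring[OF p good] and L = Zloc_subring[OF p]
  define I where "I = {of_nat p * r | r. r \<in> R}"
  have I: "is_ideal R I"
    unfolding is_ideal_def
  proof (intro conjI ballI)
    show "0 \<in> I" unfolding I_def using subring_0[OF R] by force
    fix u v assume u: "u \<in> I"
    show "a * u \<in> I" if "a \<in> R" for a
    proof -
      obtain r where "u = of_nat p * r" "r \<in> R" using u by (auto simp: I_def)
      hence "a * u = of_nat p * (a * r)" "a * r \<in> R" using that subring_mult[OF R] by (auto simp: mult_ac)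
      thus ?thesis unfolding I_def by blast
    qed
    assume v: "v \<in> I"
    obtain r r' where "u = of_nat p * r" "r \<in> R" "v = of_nat p * r'" "r' \<in> R" using u v by (auto simp: I_def)
    hence "u + v = of_nat p * (r + r')" "r + r' \<in> R" using subring_add[OF R] by (auto simp: distrib_left)
    thus "u + v \<in> I" unfolding I_def by blast
  qed
  obtain B where B: "finite B" "B \<subseteq> R" "R \<subseteq> span_by (\<lambda>c. c) (Zloc p) B" using good_basis[OF p good] by blast
  have spR: "y \<in> R" if y: "y \<in> span_by (\<lambda>c. c) (Zloc p) B" for y
    using y B(2) good_Zloc_subset[OF p good] unfolding span_by_def
    by (auto intro!: subring_sum[OF R] subring_mult[OF R])
  define K where "K = PiE B (\<lambda>_. {..<p})"
  have fK: "finite K" unfolding K_def using B by (intro finite_PiE) auto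
  have "\<exists>k\<in>K. r - (\<Sum>b\<in>B. of_nat (k b) * b) \<in> I" if r: "r \<in> R" for r
  proof -
    obtain k y where k: "k \<in> PiE B (\<lambda>_. {..<p ^ 1})" "y \<in> span_by (\<lambda>c. c) (Zloc p) B"
      "r = (\<Sum>b\<in>B. of_nat (k b) * b) + of_nat p ^ 1 * y"
      using span_residue[OF p id_hom, of r B 1] B(3) r by blast
    have "r - (\<Sum>b\<in>B. of_nat (k b) * b) = of_nat p * y" using k(3) by simp
    thus ?thesis using k(1) spR[OF k(2)] unfolding K_def I_def by auto
  qed
  then obtain \<kappa> where \<kappa>: "\<And>r. r \<in> R \<Longrightarrow> \<kappa> r \<in> K" "\<And>r. r \<in> R \<Longrightarrow> r - (\<Sum>b\<in>B. of_nat (\<kappa> r b) * b) \<in> I" by metis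
  define z where "z j = (pm_apply F ^^ j) x" for j
  have zR: "z j i \<in> R" for j i
    unfolding z_def mp_eval_iter_poly[symmetric] by (intro mp_eval_in[OF R] iter_poly_over[OF R FR] x)
  have "finite (range (\<lambda>j i. \<kappa> (z j i)))"
  proof (rule finite_subset)
    show "range (\<lambda>j i. \<kappa> (z j i)) \<subseteq> PiE UNIV (\<lambda>_. K)" using \<kappa>(1) zR by (auto simp: PiE_UNIV_domain)
  qed (intro finite_PiE fK, simp)
  hence "\<not> inj (\<lambda>j i. \<kappa> (z j i))" using finite_imageD infinite_UNIV_nat by blast
  then obtain a b where "a \<noteq> b" "(\<lambda>i. \<kappa> (z a i)) = (\<lambda>i. \<kappa> (z b i))" unfolding inj_on_def by blast
  then obtain a b where ab: "a < b" and \<kappa>ab: "(\<lambda>i. \<kappa> (z a i)) = (\<lambda>i. \<kappa> (z b i))"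
    by (metis linorder_neqE_nat)
  have start: "z b i - z a i \<in> I" for i
  proof -
    have "z b i - z a i = (z b i - (\<Sum>c\<in>B. of_nat (\<kappa> (z b i) c) * c)) - (z a i - (\<Sum>c\<in>B. of_nat (\<kappa> (z a i) c) * c))"
      using fun_cong[OF \<kappa>ab, of i] by simp
    also have "\<dots> \<in> I" by (intro ideal_diff[OF I R] \<kappa>(2) zR)
    finally show ?thesis .
  qed
  have down: "z (b - c) i - z (a - c) i \<in> I" if "c \<le> a" for c i
    using that
  proof (induction c arbitrary: i)
    case 0
    show ?case using start by simp
  next
    case (Suc c)
    have G: "z j i = mp_eval (G i) (z (Suc j))" for j i
    proof -
      have "pm_apply G (z (Suc j)) = z j" using inv by (simp add: z_def pm_inverse_def)
      thus ?thesis by (metis pm_apply_def)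
    qed
    have "mp_eval (G i) (z (b - c)) - mp_eval (G i) (z (a - c)) \<in> I"
      unfolding mp_eval_peval
      by (intro peval_cong_ideal[OF I R] zR Suc.IH) (use GR Suc.prems in \<open>auto simp: poly_over_def\<close>)
    thus ?case using G[of "b - Suc c" i] G[of "a - Suc c" i] Suc.prems ab by (simp add: Suc_diff_Suc)
  qed
  show ?thesis
  proof (intro exI[of _ "b - a"] conjI allI)
    show "b - a > 0" using ab by simp
    fix i
    have "z (b - a) i - z 0 i \<in> I" using down[of a i] by simp
    thus "\<exists>r\<in>R. (pm_apply F ^^ (b - a)) x i - x i = of_nat p * r" by (auto simp: z_def I_def)
  qed
qed

text \<open>\<open>G i\<close> composed with \<open>F\<close> being \<open>Var i\<close> is a linear
  system over \<open>K\<close> for the coefficients of \<open>G i\<close>. A solution over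
  \<open>K\<close> gives a polynomial \<open>G'\<close> with the same composite, and it equals
  \<open>G i\<close> because \<open>F\<close> is surjective.\<close>

lemma inverse_coeffs_in:
  fixes F G :: "'n::finite polymap"
  assumes K: "is_subfield K" and F: "\<And>i. F i \<in> poly_over K" and inv: "pm_inverse F G"
  shows "G i \<in> poly_over K"
proof -
  have R: "is_subring K" using K by (simp add: is_subfield_def)
  note PR = poly_over_subring[OF R]
  define P where "P m = (\<Prod>l\<in>UNIV. F l ^ cf m l)" for m :: "'n \<Rightarrow>\<^sub>0 nat"
  have "Var i = peval Const F (G i)"
  proof (rule poly_eqI_eval)
    fix x
    have "mp_eval (peval Const F (G i)) x = pm_apply G (pm_apply F x) i"
      by (simp add: mp_eval_subst pm_apply_def)
    thus "mp_eval (Var i) x = mp_eval (peval Const F (G i)) x" using inv by (simp add: pm_inverse_def mp_eval_Var)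
  qed
  hence e: "Var i = (\<Sum>m\<in>Poly_Mapping.keys (G i). Const (cf (G i) m) * P m)" by (simp add: peval_def P_def)
  have PK: "P m \<in> poly_over K" for m unfolding P_def by (intro subring_prod[OF PR] subring_power[OF PR] F)
  obtain w where w: "\<And>m. w m \<in> K" "Var i = (\<Sum>m\<in>Poly_Mapping.keys (G i). Const (w m) * P m)"
    using linear_descent[OF K finite_keys PK poly_over_Var[OF R] e] by blast
  define G' where "G' = (\<Sum>m\<in>Poly_Mapping.keys (G i). Poly_Mapping.single m (w m))"
  have "peval Const F G' = Var i"
    unfolding w(2) G'_def by (simp add: peval_sum[OF Const_hom] peval_single[OF Const_hom] P_def)
  hence eval: "mp_eval G' (pm_apply F x) = x i" for x
    using mp_eval_subst[of F G' x] by (simp add: mp_eval_Var pm_apply_def)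
  have "G i = G'"
  proof (rule poly_eqI_eval)
    fix x
    have "mp_eval G' x = mp_eval G' (pm_apply F (pm_apply G x))" using inv by (simp add: pm_inverse_def)
    also have "\<dots> = mp_eval (G i) x" unfolding eval by (simp add: pm_apply_def)
    finally show "mp_eval (G i) x = mp_eval G' x" by simp
  qed
  moreover have "G' \<in> poly_over K" unfolding G'_def by (intro subring_sum[OF PR] poly_over_single[OF R] w)
  ultimately show ?thesis by simp
qed

lemma affine_eval:
  assumes "deg_le p 1"
  shows "mp_eval p (\<lambda>i. (1 - t) * u i + t * v i) = (1 - t) * mp_eval p u + t * mp_eval p (v :: 'v::finite \<Rightarrow> complex)"
proof -
  have "(\<Prod>i\<in>UNIV. ((1 - t) * u i + t * v i) ^ cf m i) =
      (1 - t) * (\<Prod>i\<in>UNIV. u i ^ cf m i) + t * (\<Prod>i\<in>UNIV. v i ^ cf m i)" if m: "mdeg m \<le> 1" for m :: "'v \<Rightarrow>\<^sub>0 nat"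
  proof (cases "m = 0")
    case False
    then obtain i where i: "cf m i \<noteq> 0" by (metis lookup_zero poly_mapping_eqI)
    have s: "mdeg m = cf m i + (\<Sum>j\<in>UNIV-{i}. cf m j)" unfolding mdeg_def by (rule sum.remove) auto
    hence "(\<Sum>j\<in>UNIV-{i}. cf m j) = 0" "cf m i = 1" using m i by linarith+
    hence "(\<Prod>j\<in>UNIV. w j ^ cf m j) = w i" for w :: "'v \<Rightarrow> complex"
      by (subst prod.remove[of _ i]) auto
    thus ?thesis by simp
  qed simp
  hence "mp_eval p (\<lambda>i. (1 - t) * u i + t * v i) = (\<Sum>m\<in>Poly_Mapping.keys p. cf p m *
      ((1 - t) * (\<Prod>i\<in>UNIV. u i ^ cf m i) + t * (\<Prod>i\<in>UNIV. v i ^ cf m i)))"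
    unfolding mp_eval_peval peval_def using assms by (intro sum.cong) (auto simp: deg_le_def in_keys_iff)
  also have "\<dots> = (1 - t) * mp_eval p u + t * mp_eval p v"
    unfolding mp_eval_peval peval_def sum_distrib_left sum.distrib[symmetric]
    by (intro sum.cong refl) (simp add: algebra_simps)
  finally show ?thesis .
qed

text \<open>If \<open>G\<close> were affine, \<open>F\<close> would respect affine combinations and
  have degree at most 1 on each line through the origin, so its leading forms would vanish. The
  bound lets the leading forms of \<open>G\<close> lower degrees in
  \<open>fixed_points_finite\<close> as those of \<open>F\<close> do.\<close>

lemma inverse_deg_ge_2:
  fixes F G :: "'n::finite polymap"
  assumes inv: "pm_inverse F G" and F: "pm_deg F \<ge> 2"
  shows "pm_deg G \<ge> 2"
proof (rule ccontr)
  assume "\<not> pm_deg G \<ge> 2"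
  hence G: "deg_le (G i) 1" for i using pm_deg_deg_le[of G i] by (fastforce simp: deg_le_def)
  have GF: "pm_apply G (pm_apply F x) = x" and FG: "pm_apply F (pm_apply G x) = x" for x
    using inv by (auto simp: pm_inverse_def)
  have aff: "pm_apply F (\<lambda>i. (1 - t) * u i + t * v i) = (\<lambda>i. (1 - t) * pm_apply F u i + t * pm_apply F v i)" for t u v
  proof -
    let ?w = "\<lambda>i. (1 - t) * pm_apply F u i + t * pm_apply F v i"
    have "pm_apply G ?w = (\<lambda>i. (1 - t) * pm_apply G (pm_apply F u) i + t * pm_apply G (pm_apply F v) i)"
      unfolding pm_apply_def[of G] by (intro ext affine_eval G)
    hence "pm_apply G ?w = (\<lambda>i. (1 - t) * u i + t * v i)" by (simp add: GF)
    thus ?thesis using FG[of ?w] by simp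
  qed
  have "hcomp (F i) (pm_deg F) = 0" for i
  proof (rule poly_eqI_eval)
    fix b :: "'n \<Rightarrow> complex"
    \<comment> \<open>\<open>F i\<close> along the line through 0 and \<open>b\<close>; its
      coefficient of a given degree is the value at \<open>b\<close> of the homogeneous part of that
      degree.\<close>
    define P where "P = (\<Sum>m\<in>Poly_Mapping.keys (F i). Polynomial.monom (cf (F i) m * (\<Prod>l\<in>UNIV. b l ^ cf m l)) (mdeg m))"
    have "poly P t = mp_eval (F i) (\<lambda>l. t * b l)" for t
      unfolding P_def mp_eval_peval peval_def mdeg_def
      by (simp add: poly_sum poly_monom power_mult_distrib prod.distrib power_sum mult_ac)
    also have "mp_eval (F i) (\<lambda>l. t * b l) = (1 - t) * mp_eval (F i) (\<lambda>_. 0) + t * mp_eval (F i) b" for t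
      using fun_cong[OF aff[of t "\<lambda>_. 0" b], of i] by (simp add: pm_apply_def)
    finally have "poly P = poly [:mp_eval (F i) (\<lambda>_. 0), mp_eval (F i) b - mp_eval (F i) (\<lambda>_. 0):]"
      by (intro ext) (simp add: algebra_simps)
    hence "P = [:mp_eval (F i) (\<lambda>_. 0), mp_eval (F i) b - mp_eval (F i) (\<lambda>_. 0):]" by (simp add: poly_eq_poly_eq_iff)
    hence "coeff P (pm_deg F) = 0" using F by (simp add: coeff_pCons split: nat.splits)
    moreover have "mp_eval (hcomp (F i) (pm_deg F)) b = coeff P (pm_deg F)"
    proof -
      have "coeff P (pm_deg F) = (\<Sum>m\<in>Poly_Mapping.keys (F i). if mdeg m = pm_deg F then cf (F i) m * (\<Prod>l\<in>UNIV. b l ^ cf m l) else 0)"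
        by (simp add: P_def coeff_sum)
      also have "\<dots> = (\<Sum>m\<in>{m \<in> Poly_Mapping.keys (F i). mdeg m = pm_deg F}. cf (F i) m * (\<Prod>l\<in>UNIV. b l ^ cf m l))"
        by (rule sum.inter_filter[symmetric]) simp
      also have "\<dots> = mp_eval (hcomp (F i) (pm_deg F)) b"
        unfolding hcomp_def mp_eval_sum by (simp add: mp_eval_peval peval_single[OF id_hom])
      finally show ?thesis by simp
    qed
    ultimately show "mp_eval (hcomp (F i) (pm_deg F)) b = mp_eval 0 b" by (simp add: mp_eval_def)
  qed
  thus False using pm_deg_attained[of F] F by auto
qed

text \<open>Regularity says that the leading forms of \<open>F\<close> and \<open>G\<close> have no common projective zero.\<close>
lemma regular_certificate:
  fixes F G :: "'n::finite polymap"
  assumes K: "is_subfield K" and F: "\<And>i. F i \<in> poly_over K" and G: "\<And>i. G i \<in> poly_over K"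
    and reg: "pm_indet F \<inter> pm_indet G = {}"
  defines "d \<equiv> pm_deg F" and "e \<equiv> pm_deg G"
  shows "\<exists>N a b. d \<le> N \<and> e \<le> N \<and> (\<forall>i l. a i l \<in> poly_over K \<and> deg_le (a i l) (N - d))
    \<and> (\<forall>i l. b i l \<in> poly_over K \<and> deg_le (b i l) (N - e))
    \<and> (\<forall>i. Var i ^ N = (\<Sum>l\<in>UNIV. a i l * hcomp (F l) d) + (\<Sum>l\<in>UNIV. b i l * hcomp (G l) e))"
proof -
  have R: "is_subring K" using K by (simp add: is_subfield_def)
  note PR = poly_over_subring[OF R]
  define f :: "'n + 'n \<Rightarrow> 'n cmpoly" where "f = case_sum (\<lambda>l. hcomp (F l) d) (\<lambda>l. hcomp (G l) e)"
  have fK: "f k \<in> poly_over K" for k unfolding f_def by (cases k) (auto intro: hcomp_poly_over R F G)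
  have split: "(\<Sum>k\<in>UNIV. q k * f k) = (\<Sum>l\<in>UNIV. q (Inl l) * hcomp (F l) d) + (\<Sum>l\<in>UNIV. q (Inr l) * hcomp (G l) e)" for q
    unfolding UNIV_Plus_UNIV[symmetric] by (subst sum.Plus) (auto simp: f_def)
  have "\<exists>N q. (\<forall>k. q k \<in> poly_over K) \<and> Var i ^ N = (\<Sum>k\<in>UNIV. q k * f k)" for i
  proof -
    have "mp_eval (Var i) x = 0" if z: "\<And>k. mp_eval (f k) x = 0" for x
    proof -
      have "mp_hom_eval (F l) (pm_deg F) x = 0" "mp_hom_eval (G l) (pm_deg G) x = 0" for l
        using z[of "Inl l"] z[of "Inr l"] by (auto simp: f_def d_def e_def mp_hom_eval_hcomp)
      hence "x = (\<lambda>_. 0)" using reg by (auto simp: pm_indet_def)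
      thus ?thesis by (simp add: mp_eval_Var)
    qed
    then obtain N q where q: "Var i ^ N = (\<Sum>k\<in>UNIV. q k * f k)" using nullstellensatz[of f "Var i"] by blast
    have VK: "Var i ^ N \<in> poly_over K" by (intro subring_power[OF PR] poly_over_Var[OF R])
    show ?thesis using ideal_descent[OF K fK VK q] by metis
  qed
  hence "\<forall>i. \<exists>N q. (\<forall>k. q k \<in> poly_over K) \<and> Var i ^ N = (\<Sum>k\<in>UNIV. q k * f k)" by blast
  then obtain n q where q: "\<And>i k. q i k \<in> poly_over K" "\<And>i. Var i ^ n i = (\<Sum>k\<in>UNIV. q i k * f k)" by metis
  \<comment> \<open>One exponent for all variables, enlarged by \<open>d\<close> and
    \<open>e\<close> so that \<open>N - d\<close> and \<open>N - e\<close> are genuine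
    differences.\<close>
  define N where "N = (\<Sum>i\<in>UNIV. n i) + d + e"
  have nN: "n i \<le> N" for i
    using member_le_sum[of i UNIV n] by (simp add: N_def)
  \<comment> \<open>Passing to the part of degree \<open>N\<close> of the identity makes the
    multipliers homogeneous, which bounds their degrees.\<close>
  define a where "a i l = hcomp (Var i ^ (N - n i) * q i (Inl l)) (N - d)" for i l
  define b where "b i l = hcomp (Var i ^ (N - n i) * q i (Inr l)) (N - e)" for i l
  have "Var i ^ N = (\<Sum>l\<in>UNIV. a i l * hcomp (F l) d) + (\<Sum>l\<in>UNIV. b i l * hcomp (G l) e)" for i
  proof -
    have "Var i ^ N = Var i ^ (N - n i) * (\<Sum>k\<in>UNIV. q i k * f k)"
      unfolding q(2)[symmetric] using nN[of i] by (simp flip: power_add)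
    also have "\<dots> = (\<Sum>l\<in>UNIV. (Var i ^ (N - n i) * q i (Inl l)) * hcomp (F l) d)
        + (\<Sum>l\<in>UNIV. (Var i ^ (N - n i) * q i (Inr l)) * hcomp (G l) e)"
      unfolding split by (simp add: distrib_left sum_distrib_left mult.assoc)
    finally have eq: "Var i ^ N = \<dots>" .
    have "Var i ^ N = hcomp (Var i ^ N) N" by (rule hcomp_Var_power[symmetric])
    also have "\<dots> = (\<Sum>l\<in>UNIV. a i l * hcomp (F l) d) + (\<Sum>l\<in>UNIV. b i l * hcomp (G l) e)"
      unfolding eq by (simp add: hcomp_add hcomp_sum hcomp_mult a_def b_def N_def)
    finally show ?thesis .
  qed
  moreover have "a i l \<in> poly_over K" "b i l \<in> poly_over K" for i l
    unfolding a_def b_def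
    by (intro hcomp_poly_over[OF R] subring_mult[OF PR] subring_power[OF PR] poly_over_Var[OF R] q(1))+
  moreover have "deg_le (a i l) (N - d)" "deg_le (b i l) (N - e)" for i l
    unfolding a_def b_def by (rule deg_le_hcomp)+
  moreover have "d \<le> N" "e \<le> N" by (auto simp: N_def)
  ultimately show ?thesis by blast
qed

text \<open>The bound on \<open>pm_deg F\<close> excludes translations: their leading forms are the
  coordinates, so they satisfy \<open>regular_automorphism\<close>, but a nonzero translation has no
  periodic points.\<close>

theorem theoremC:
  fixes K :: "complex set" and F G :: "('n::finite) polymap"
  assumes "number_field K"
    and "pm_coeffs_in F K"
    and "regular_automorphism F G"
    and "pm_deg F \<ge> 2"
  shows "zariski_dense_Qbar (periodic_points F)"
proof -
  have K: "is_subfield K" by (rule number_field_subfield[OF assms(1)])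
  have FK: "F i \<in> poly_over K" for i using assms(2) by (auto simp: pm_coeffs_in_def poly_over_def)
  have inv: "pm_inverse F G" and reg: "pm_indet F \<inter> pm_indet G = {}"
    using assms(3) by (auto simp: regular_automorphism_def)
  have GK: "G i \<in> poly_over K" for i by (rule inverse_coeffs_in[OF K FK inv])
  have e2: "pm_deg G \<ge> 2" by (rule inverse_deg_ge_2[OF inv assms(4)])
  obtain N a b where N: "pm_deg F \<le> N" "pm_deg G \<le> N"
    and a: "\<And>i l. a i l \<in> poly_over K" "\<And>i l. deg_le (a i l) (N - pm_deg F)"
    and b: "\<And>i l. b i l \<in> poly_over K" "\<And>i l. deg_le (b i l) (N - pm_deg G)"
    and cert: "\<And>i. Var i ^ N = (\<Sum>l\<in>UNIV. a i l * hcomp (F l) (pm_deg F)) + (\<Sum>l\<in>UNIV. b i l * hcomp (G l) (pm_deg G))"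
    using regular_certificate[OF K FK GK reg] by blast
  have "h = 0" if hQ: "\<And>m. cf h m \<in> Qbar" and h0: "\<And>x. x \<in> periodic_points F \<Longrightarrow> mp_eval h x = 0" for h :: "'n cmpoly"
  proof (rule ccontr)
    assume "h \<noteq> 0"
    then obtain x where x: "mp_eval h (\<lambda>i. of_nat (x i)) \<noteq> 0" using nonzero_poly_value by blast
    define x0 :: "'n \<Rightarrow> complex" where "x0 = (\<lambda>i. of_nat (x i))"
    define c where "c = mp_eval h x0"
    have c0: "c \<noteq> 0" using x by (simp add: c_def x0_def)
    let ?co = "\<lambda>q :: 'n cmpoly. cf q ` Poly_Mapping.keys q"
    \<comment> \<open>This allows \<open>inverse c\<close> to be put into \<open>R\<close>, so that
      \<open>h\<close> is a unit at \<open>x0\<close> modulo \<open>p\<close>.\<close>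
    have "algebraic c"
    proof -
      obtain p R where pR: "prime p" "good_ring p R" "?co h \<subseteq> R"
        using common_good_ring[of "?co h"] hQ by (auto simp: Qbar_def)
      note R = good_subring[OF pR(1,2)]
      have "c \<in> R" unfolding c_def x0_def
        using pR(3) by (intro mp_eval_in[OF R] subring_of_nat[OF R]) (simp add: poly_over_iff[OF subring_0[OF R]])
      thus ?thesis by (rule good_algebraic[OF pR(1,2)])
    qed
    \<comment> \<open>All that must lie in \<open>R\<close>, the coefficients of the certificate
      included, is listed before \<open>p\<close> is chosen; the period \<open>k\<close> comes later
      and depends on \<open>p\<close>.\<close>
    define V where "V = insert (inverse c) (?co h \<union> (\<Union>i. ?co (F i)) \<union> (\<Union>i. ?co (G i))
      \<union> (\<Union>i. \<Union>l. ?co (a i l)) \<union> (\<Union>i. \<Union>l. ?co (b i l)))"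
    have "finite V" unfolding V_def by auto
    moreover have "algebraic v" if v: "v \<in> V" for v
    proof -
      have "v = inverse c \<or> v \<in> Qbar \<or> v \<in> K"
        using v hQ FK GK a(1) b(1) by (auto simp: V_def poly_over_def)
      thus ?thesis using \<open>algebraic c\<close> number_field_algebraic[OF assms(1)] by (auto simp: Qbar_def)
    qed
    ultimately obtain p R where p: "prime p" and good: "good_ring p R" and V: "V \<subseteq> R"
      using common_good_ring by metis
    note R = good_subring[OF p good] and L = Zloc_subring[OF p]
    note PR = poly_over_subring[OF R]
    note iff = poly_over_iff[OF subring_0[OF R]]
    have cR: "inverse c \<in> R" using V by (simp add: V_def)
    have hR: "h \<in> poly_over R" unfolding iff by (rule order_trans[OF _ V], unfold V_def, blast)
    have FR: "F i \<in> poly_over R" for i unfolding iff by (rule order_trans[OF _ V], unfold V_def, blast)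
    have GR: "G i \<in> poly_over R" for i unfolding iff by (rule order_trans[OF _ V], unfold V_def, blast)
    have aR: "a i l \<in> poly_over R" for i l
      unfolding iff by (rule order_trans[OF _ V], unfold V_def, rule subsetI, rule insertI2, rule UnI1,
        rule UnI2, rule UN_I[of i], rule UNIV_I, rule UN_I[of l], rule UNIV_I)
    have bR: "b i l \<in> poly_over R" for i l
      unfolding iff by (rule order_trans[OF _ V], unfold V_def, rule subsetI, rule insertI2, rule UnI2,
        rule UN_I[of i], rule UNIV_I, rule UN_I[of l], rule UNIV_I)
    have x0R: "x0 i \<in> R" for i unfolding x0_def by (rule subring_of_nat[OF R])
    obtain k where k: "k > 0" "\<forall>i. \<exists>r\<in>R. (pm_apply F ^^ k) x0 i - x0 i = of_nat p * r"
      using periodic_mod_prime[OF p good inv FR GR, of x0, OF x0R] by (elim exE conjE)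
    define f where "f = (\<lambda>i. iter_poly F k i - Var i)"
    let ?J = "gen_ideal (poly_over R) UNIV f"
    have feval: "mp_eval (f i) y = (pm_apply F ^^ k) y i - y i" for i y
      by (simp add: f_def mp_eval_diff mp_eval_iter_poly mp_eval_Var)
    have fR: "f i \<in> poly_over R" for i
      unfolding f_def by (intro subring_diff[OF PR] iter_poly_over[OF R FR] poly_over_Var[OF R])
    have fixJ: "fix_ideal R F k = ?J" by (simp add: fix_ideal_def f_def)
    obtain E1 where E1: "finite E1" "E1 \<subseteq> poly_over R"
      "\<forall>g\<in>poly_over R. \<exists>h\<in>span_by Const R E1. g - h \<in> ?J"
      using fixed_points_finite[OF R inv k(1) FR GR pm_deg_deg_le assms(4) N(1) pm_deg_deg_le e2 N(2) aR a(2) bR b(2) cert]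
      unfolding fixJ by (elim exE conjE)
    obtain E where E: "finite E" "E \<subseteq> poly_over R" "span_by Const R E1 \<subseteq> span_by Const (Zloc p) E"
      using span_by_good[OF p good E1(1,2)] by (elim exE conjE)
    have span: "\<exists>y\<in>span_by Const (Zloc p) E. g - y \<in> ?J" if "g \<in> poly_over R" for g
      using bspec[OF E1(3) that] E(3) by blast
    \<comment> \<open>Zeros of the \<open>f i\<close> are arbitrary complex points, whereas
      \<open>h\<close> is known to vanish only at algebraic periodic points. Finite generation of
      R[x]/J closes the gap: each coordinate function satisfies a relation over Z_(p) modulo
      J.\<close>
    have hfix: "mp_eval h y = 0" if y: "\<And>i. mp_eval (f i) y = 0" for y
    proof (rule h0)
      have Jy: "mp_eval g y = 0" if g: "g \<in> ?J" for g
        using g y by (auto simp: gen_ideal_def mp_eval_sum mp_eval_mult)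
      have "algebraic (y i)" for i
      proof -
        have J: "is_ideal (poly_over R) ?J" by (rule gen_ideal_ideal[OF PR])
        have "Const u \<in> poly_over R" if "u \<in> Zloc p" for u
          using that good_Zloc_subset[OF p good] by (intro poly_over_Const[OF R]) auto
        from power_relation[OF Const_hom L J PR this E(1), of "Var i"]
        obtain l where l: "\<forall>j. l j \<in> Zloc p" "\<exists>j\<le>card E. l j \<noteq> 0" "(\<Sum>j\<le>card E. Const (l j) * Var i ^ j) \<in> ?J"
          using span[OF subring_power[OF PR poly_over_Var[OF R]]] by auto
        define P where "P = (\<Sum>j\<le>card E. Polynomial.monom (l j) j)"
        have cP: "coeff P j = (if j \<le> card E then l j else 0)" for j by (simp add: P_def coeff_sum)
        have "poly P (y i) = 0"
          using Jy[OF l(3)] by (simp add: P_def poly_sum poly_monom mp_eval_sum mp_eval_mult mp_eval_power mp_eval_Const mp_eval_Var)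
        moreover have "coeff P j \<in> \<rat>" for j using l(1) Zloc_rat[of p] by (auto simp: cP)
        moreover have "P \<noteq> 0" using l(2) cP by (metis coeff_0)
        ultimately show ?thesis by (intro algebraicI')
      qed
      moreover have "(pm_apply F ^^ k) y = y" using y by (auto simp: feval)
      ultimately show "y \<in> periodic_points F" using k(1) by (auto simp: periodic_points_def Qbar_def)
    qed
    have "\<exists>m q. h ^ m = (\<Sum>i\<in>UNIV. q i * f i)"
    proof (rule nullstellensatz)
      show "mp_eval h y = 0" if "\<And>i. mp_eval (f i) y = 0" for y using that by (rule hfix)
    qed
    then obtain m q where m: "h ^ m = (\<Sum>i\<in>UNIV. q i * f i)" by (elim exE)
    obtain s where s: "Const (of_nat p ^ s) * h ^ m \<in> ?J"
      using clear_denominators[OF p good fR subring_power[OF PR hR] m] by blast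
    show False
      by (rule residual_point_lifts[OF p good fR x0R _ E(1,2) span hR _ _ s])
        (use k c0 cR in \<open>auto simp: feval c_def\<close>)
  qed
  thus ?thesis unfolding zariski_dense_Qbar_def by (auto simp: periodic_points_def)
qed

end
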